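(* Let $G$ be a finite group having cyclic Sylow $p$-subgroups for some prime $p$. Then any finite $p$-subgroup of $\mathrm{V}(\mathbb{Z}G)$, the group of units of augmentation one in the integral group ring $\mathbb{Z}G$, is isomorphic to a subgroup of $G$.
   Context: For a finite group $G$, the augmentation of an element $\sum_{g\in G}a_g g$ of $\mathbb{Z}G$ (with all $a_g\in\mathbb{Z}$) is the integer $\sum_{g\in G}a_g$. $\mathrm{V}(\mathbb{Z}G)$ is the group of those units of $\mathbb{Z}G$ whose augmentation is $1$. *)

theory Defs
  imports "HOL-Algebra.Algebra" "HOL-Computational_Algebra.Primes"
begin

text \<open>
  For a finite group \<open>G\<close>, the element \<open>\<Sum>g. a\<^sub>g g\<close> of \<open>\<int>G\<close> is represented by its coefficient
  function. The carrier may be a proper subset of its type, so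
  coefficients outside \<open>carrier G\<close> are fixed to \<open>0\<close>, making equality in \<open>\<int>G\<close> the equality of
  functions. For infinite \<open>G\<close> the definition is not meaningful (no finite support is imposed).
\<close>

definition int_group_ring :: "('a, 'b) monoid_scheme \<Rightarrow> ('a \<Rightarrow> int) ring"
  where "int_group_ring G =
    \<lparr>carrier = {a. \<forall>g. g \<notin> carrier G \<longrightarrow> a g = 0},
     monoid.mult = (\<lambda>a b x. \<Sum>(g, h) | g \<in> carrier G \<and> h \<in> carrier G \<and> g \<otimes>\<^bsub>G\<^esub> h = x. a g * b h),
     one = (\<lambda>x. if x = \<one>\<^bsub>G\<^esub> then 1 else 0),
     ring.zero = (\<lambda>x. 0),
     ring.add = (\<lambda>a b x. a x + b x)\<rparr>"

definition augmentation :: "('a, 'b) monoid_scheme \<Rightarrow> ('a \<Rightarrow> int) \<Rightarrow> int"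
  where "augmentation G a = (\<Sum>g\<in>carrier G. a g)"

definition normalized_units :: "('a, 'b) monoid_scheme \<Rightarrow> ('a \<Rightarrow> int) monoid"
  where "normalized_units G =
    (units_of (int_group_ring G))
      \<lparr>carrier := {u \<in> Units (int_group_ring G). augmentation G u = 1}\<rparr>"

text \<open>Infinite groups have \<open>order\<close> \<open>0\<close>, so for \<open>p > 0\<close> the following implies finiteness.\<close>

definition finite_p_group :: "nat \<Rightarrow> ('a, 'b) monoid_scheme \<Rightarrow> bool"
  where "finite_p_group p H \<longleftrightarrow> group H \<and> (\<exists>n. order H = p ^ n)"

text \<open>Intended for finite \<open>G\<close> and prime \<open>p\<close>; if \<open>p\<close> does not divide the order, the trivial
  subgroup is the only Sylow \<open>p\<close>-subgroup.\<close>

definition sylow_subgroup :: "nat \<Rightarrow> 'a set \<Rightarrow> ('a, 'b) monoid_scheme \<Rightarrow> bool"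
  where "sylow_subgroup p P G \<longleftrightarrow> subgroup P G \<and> card P = p ^ multiplicity p (order G)"

lemma sylow_subgroup_exists:
  assumes "group G" "finite (carrier G)" "Factorial_Ring.prime p"
  shows "\<exists>P. sylow_subgroup p P G"
proof -
  have "order G \<noteq> 0"
    using assms(2) monoid.one_closed[OF group.is_monoid[OF assms(1)]]
    by (auto simp: order_def card_eq_0_iff)
  then obtain m where "order G = p ^ multiplicity p (order G) * m"
    by (metis multiplicity_dvd dvdE)
  from sylow_thm[OF assms(3,1) this assms(2)] show ?thesis
    unfolding sylow_subgroup_def by blast
qed

context group
begin

lemma int_group_ring_mult:
  assumes fin: "finite (carrier G)" and x: "x \<in> carrier G"
  shows "(a \<otimes>\<^bsub>int_group_ring G\<^esub> b) x = (\<Sum>g\<in>carrier G. a g * b (inv g \<otimes> x))"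
proof -
  have "(\<Sum>(g, h) | g \<in> carrier G \<and> h \<in> carrier G \<and> g \<otimes> h = x. a g * b h)
        = (\<Sum>g\<in>carrier G. a g * b (inv g \<otimes> x))"
    by (rule sum.reindex_bij_witness[where i = "\<lambda>g. (g, inv g \<otimes> x)" and j = fst])
       (auto simp: x inv_solve_left' m_assoc[symmetric])
  then show ?thesis
    by (simp add: int_group_ring_def)
qed

lemma int_group_ring_mult_outside:
  assumes "x \<notin> carrier G"
  shows "(a \<otimes>\<^bsub>int_group_ring G\<^esub> b) x = 0"
proof -
  have "{(g, h). g \<in> carrier G \<and> h \<in> carrier G \<and> g \<otimes> h = x} = {}"
    using assms by auto
  then show ?thesis
    by (simp only: int_group_ring_def monoid.simps sum.empty)
qed

lemma int_group_ring_assoc: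
  assumes fin: "finite (carrier G)"
  shows "(a \<otimes>\<^bsub>int_group_ring G\<^esub> b) \<otimes>\<^bsub>int_group_ring G\<^esub> c
    = a \<otimes>\<^bsub>int_group_ring G\<^esub> (b \<otimes>\<^bsub>int_group_ring G\<^esub> c)"
proof
  fix x
  show "((a \<otimes>\<^bsub>int_group_ring G\<^esub> b) \<otimes>\<^bsub>int_group_ring G\<^esub> c) x
    = (a \<otimes>\<^bsub>int_group_ring G\<^esub> (b \<otimes>\<^bsub>int_group_ring G\<^esub> c)) x"
  proof (cases "x \<in> carrier G")
    case x: True
    have key: "inv (inv g \<otimes> h) \<otimes> (inv g \<otimes> x) = inv h \<otimes> x"
      if g: "g \<in> carrier G" and h: "h \<in> carrier G" for g h
      by (metis (no_types) g h x inv_closed inv_inv inv_mult_group inv_solve_left m_assoc m_closed)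
    have shift: "(\<Sum>h\<in>carrier G. b (inv g \<otimes> h) * c (inv h \<otimes> x))
        = (\<Sum>k\<in>carrier G. b k * c (inv k \<otimes> (inv g \<otimes> x)))" if g: "g \<in> carrier G" for g
      by (rule sum.reindex_bij_witness[where i = "\<lambda>k. g \<otimes> k" and j = "\<lambda>h. inv g \<otimes> h"])
         (use g in \<open>simp_all add: key\<close>, simp_all add: m_assoc[symmetric])
    have "((a \<otimes>\<^bsub>int_group_ring G\<^esub> b) \<otimes>\<^bsub>int_group_ring G\<^esub> c) x
        = (\<Sum>h\<in>carrier G. \<Sum>g\<in>carrier G. a g * (b (inv g \<otimes> h) * c (inv h \<otimes> x)))"
      by (simp add: int_group_ring_mult fin x sum_distrib_right mult.assoc)
    also have "\<dots> = (\<Sum>g\<in>carrier G. a g * (\<Sum>h\<in>carrier G. b (inv g \<otimes> h) * c (inv h \<otimes> x)))"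
      by (subst sum.swap) (simp add: sum_distrib_left)
    also have "\<dots> = (a \<otimes>\<^bsub>int_group_ring G\<^esub> (b \<otimes>\<^bsub>int_group_ring G\<^esub> c)) x"
      by (simp add: int_group_ring_mult fin x shift)
    finally show ?thesis .
  qed (simp add: int_group_ring_mult_outside)
qed

lemma int_group_ring_is_ring:
  assumes fin: "finite (carrier G)"
  shows "ring (int_group_ring G)"
proof -
  let ?R = "int_group_ring G"
  have carr: "carrier ?R = {a. \<forall>g. g \<notin> carrier G \<longrightarrow> a g = 0}"
    by (simp add: int_group_ring_def)
  have add: "a \<oplus>\<^bsub>?R\<^esub> b = (\<lambda>x. a x + b x)" for a b
    by (simp add: int_group_ring_def)
  have one: "\<one>\<^bsub>?R\<^esub> = (\<lambda>x. if x = \<one> then 1 else 0)"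
    by (simp add: int_group_ring_def)
  have l_one: "\<one>\<^bsub>?R\<^esub> \<otimes>\<^bsub>?R\<^esub> a = a" if "a \<in> carrier ?R" for a
  proof
    fix x
    show "(\<one>\<^bsub>?R\<^esub> \<otimes>\<^bsub>?R\<^esub> a) x = a x"
    proof (cases "x \<in> carrier G")
      case True
      have "(\<one>\<^bsub>?R\<^esub> \<otimes>\<^bsub>?R\<^esub> a) x = (\<Sum>g\<in>carrier G. if g = \<one> then a (inv g \<otimes> x) else 0)"
        unfolding int_group_ring_mult[OF fin True] one by (rule sum.cong) auto
      then show ?thesis
        using True by (simp add: fin)
    qed (use that in \<open>simp add: int_group_ring_mult_outside carr\<close>)
  qed
  have r_one: "a \<otimes>\<^bsub>?R\<^esub> \<one>\<^bsub>?R\<^esub> = a" if "a \<in> carrier ?R" for a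
  proof
    fix x
    show "(a \<otimes>\<^bsub>?R\<^esub> \<one>\<^bsub>?R\<^esub>) x = a x"
    proof (cases "x \<in> carrier G")
      case True
      have iff: "inv g \<otimes> x = \<one> \<longleftrightarrow> g = x" if "g \<in> carrier G" for g
        using that True by (metis inv_closed inv_equality inv_inv l_inv)
      have "(a \<otimes>\<^bsub>?R\<^esub> \<one>\<^bsub>?R\<^esub>) x = (\<Sum>g\<in>carrier G. if g = x then a g else 0)"
        unfolding int_group_ring_mult[OF fin True] one by (rule sum.cong) (auto simp: iff)
      then show ?thesis
        using True by (simp add: fin)
    qed (use that in \<open>simp add: int_group_ring_mult_outside carr\<close>)
  qed
  have mon: "monoid ?R"
  proof (rule monoidI)
    show "\<one>\<^bsub>?R\<^esub> \<in> carrier ?R"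
      by (auto simp: carr one)
    show "a \<otimes>\<^bsub>?R\<^esub> b \<in> carrier ?R" for a b
      by (simp add: carr int_group_ring_mult_outside)
  qed (use l_one r_one in \<open>simp_all add: int_group_ring_assoc fin\<close>)
  have ab: "abelian_group ?R"
  proof (rule abelian_groupI)
    fix a assume "a \<in> carrier ?R"
    then show "\<exists>b\<in>carrier ?R. b \<oplus>\<^bsub>?R\<^esub> a = \<zero>\<^bsub>?R\<^esub>"
      by (intro bexI[of _ "\<lambda>x. - a x"]) (auto simp: int_group_ring_def)
  qed (auto simp: int_group_ring_def algebra_simps)
  have l_distr: "(a \<oplus>\<^bsub>?R\<^esub> b) \<otimes>\<^bsub>?R\<^esub> c = a \<otimes>\<^bsub>?R\<^esub> c \<oplus>\<^bsub>?R\<^esub> b \<otimes>\<^bsub>?R\<^esub> c"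
    and r_distr: "c \<otimes>\<^bsub>?R\<^esub> (a \<oplus>\<^bsub>?R\<^esub> b) = c \<otimes>\<^bsub>?R\<^esub> a \<oplus>\<^bsub>?R\<^esub> c \<otimes>\<^bsub>?R\<^esub> b" for a b c
    by (auto simp: int_group_ring_def algebra_simps sum.distrib case_prod_beta)
  show ?thesis
    by (rule ringI[OF ab mon]) (simp_all add: l_distr r_distr)
qed

lemma augmentation_mult:
  assumes fin: "finite (carrier G)"
  shows "augmentation G (a \<otimes>\<^bsub>int_group_ring G\<^esub> b) = augmentation G a * augmentation G b"
proof -
  have shift: "(\<Sum>x\<in>carrier G. b (inv g \<otimes> x)) = (\<Sum>x\<in>carrier G. b x)"
    if g: "g \<in> carrier G" for g
    by (rule sum.reindex_bij_witness[where i = "\<lambda>k. g \<otimes> k" and j = "\<lambda>h. inv g \<otimes> h"])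
       (auto simp: g m_assoc[symmetric])
  have "augmentation G (a \<otimes>\<^bsub>int_group_ring G\<^esub> b)
      = (\<Sum>x\<in>carrier G. \<Sum>g\<in>carrier G. a g * b (inv g \<otimes> x))"
    by (simp add: augmentation_def int_group_ring_mult fin)
  also have "\<dots> = (\<Sum>g\<in>carrier G. a g * (\<Sum>x\<in>carrier G. b (inv g \<otimes> x)))"
    by (subst sum.swap) (simp add: sum_distrib_left)
  also have "\<dots> = augmentation G a * augmentation G b"
    by (simp add: shift augmentation_def sum_distrib_right)
  finally show ?thesis .
qed

lemma augmentation_one:
  assumes "finite (carrier G)"
  shows "augmentation G \<one>\<^bsub>int_group_ring G\<^esub> = 1"
  using assms by (simp add: augmentation_def int_group_ring_def)

lemma normalized_units_is_group:
  assumes fin: "finite (carrier G)"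
  shows "group (normalized_units G)"
proof -
  let ?R = "int_group_ring G"
  interpret R: ring ?R
    by (rule int_group_ring_is_ring[OF fin])
  interpret U: group "units_of ?R"
    by (rule R.units_group)
  have "subgroup {u \<in> Units ?R. augmentation G u = 1} (units_of ?R)"
  proof (rule U.subgroupI)
    show "{u \<in> Units ?R. augmentation G u = 1} \<noteq> {}"
      using augmentation_one[OF fin] by blast
    fix u assume u: "u \<in> {u \<in> Units ?R. augmentation G u = 1}"
    then have "augmentation G (inv\<^bsub>?R\<^esub> u) * augmentation G u = 1"
      by (metis (lifting) R.Units_l_inv augmentation_mult augmentation_one fin mem_Collect_eq)
    with u show "inv\<^bsub>units_of ?R\<^esub> u \<in> {u \<in> Units ?R. augmentation G u = 1}"
      by (simp add: R.units_of_inv)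
  next
    fix u v assume "u \<in> {u \<in> Units ?R. augmentation G u = 1}"
      and "v \<in> {u \<in> Units ?R. augmentation G u = 1}"
    then show "u \<otimes>\<^bsub>units_of ?R\<^esub> v \<in> {u \<in> Units ?R. augmentation G u = 1}"
      by (simp add: units_of_mult augmentation_mult fin)
  qed (auto simp: units_of_carrier)
  then show ?thesis
    unfolding normalized_units_def by (rule U.subgroup_imp_group)
qed

end

end

theory Submission
  imports Defs "Jordan_Normal_Form.Schur_Decomposition" "HOL-Number_Theory.Residues"
begin

text \<open>
  Let \<open>U\<close> be a finite \<open>p\<close>-subgroup of \<open>V(\<int>G)\<close>, and let \<open>P = \<langle>c\<rangle>\<close> be a Sylow \<open>p\<close>-subgroup of \<open>G\<close>.
  The order of \<open>U\<close> divides the order of \<open>G\<close>, because the average of the elements of \<open>U\<close> is an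
  idempotent whose trace on \<open>\<complex>G\<close> is \<open>|G| / |U|\<close> (\<open>card_finite_subgroup_dvd\<close>). As \<open>P\<close> has a subgroup
  of every order dividing \<open>|P|\<close>, and it is cyclic, it remains to see that \<open>U\<close> is cyclic. A finite
  \<open>p\<close>-group is cyclic if it contains no elementary abelian subgroup of order \<open>p\<^sup>2\<close> and, for
  \<open>p = 2\<close>, no involution that is a commutator; the second condition excludes the quaternion group
  (\<open>p_subgroup_cyclic\<close>).

  Both conditions are read off from one character. Let \<open>\<lambda>\<close> be a faithful linear character of \<open>P\<close>,
  and let \<open>\<Psi>\<close> be the character of \<open>G\<close> induced from \<open>1 + \<lambda> + \<dots> + \<lambda>\<^sup>p\<^sup>-\<^sup>1\<close>. Its degree is
  \<open>p |G : P|\<close>, and it vanishes at the elements of order \<open>p\<close>, and at those whose order is not a power of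
  \<open>p\<close>. Let \<open>u\<close> be an element of order \<open>p\<close> in \<open>V(\<int>G)\<close>. The value \<open>\<Psi>(u)\<close> is the sum of the values of
  \<open>\<Psi>\<close> at the conjugacy classes of \<open>G\<close>, weighted by the partial augmentations of \<open>u\<close>. The partial
  augmentation of \<open>u\<close> at \<open>1\<close> is zero (Berman and Higman, \<open>finite_order_coefficient_one_zero\<close>), and so
  are those at elements of order \<open>p\<^sup>j\<close> with \<open>j \<ge> 2\<close> (\<open>class_sum_zero_of_larger_order\<close>). Therefore
  \<open>\<Psi>(u) = 0\<close>. If \<open>K\<close> is elementary abelian of order \<open>p\<^sup>2\<close>, the trivial character then has the
  multiplicity \<open>|G : P| / p\<close> in the restriction of \<open>\<Psi>\<close> to \<open>K\<close>, which is not an integer. If \<open>p = 2\<close>, an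
  involution \<open>u\<close> has the eigenvalue \<open>-1\<close> with the odd multiplicity \<open>|G : P|\<close>, so its determinant
  is \<open>-1\<close> and it is not a commutator.

  The vanishing at elements \<open>y\<close> of order \<open>p\<^sup>j\<close>, \<open>j \<ge> 2\<close>, concerns the lattice \<open>\<int>G\<close>
  with the operator \<open>s: v \<mapsto> u v y\<^sup>-\<^sup>1\<close>, whose trace is a multiple of the partial augmentation. The
  power \<open>s\<^sup>p\<close> permutes \<open>G\<close> in orbits of the same length \<open>p\<^sup>j\<^sup>-\<^sup>1\<close>, so \<open>\<int>G\<close> is free over
  \<open>\<langle>s\<^sup>p\<rangle>\<close>. As \<open>\<langle>s\<rangle>\<close> is cyclic and \<open>\<langle>s\<^sup>p\<rangle>\<close> is not trivial, it follows that \<open>\<int>G\<close> is a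
  projective module over \<open>\<langle>s\<rangle>\<close> (\<open>cyclic_lift_of_unit\<close>). The character of a projective module over a
  \<open>p\<close>-group vanishes outside \<open>1\<close> (\<open>trace_zero_of_graded_idempotent\<close>), so the trace of \<open>s\<close> is zero.
\<close>

section \<open>Rank elements of projective modules over cyclic \<open>p\<close>-groups\<close>

text \<open>
  Let \<open>s = S 1\<close> generate a cyclic group of order \<open>m = p q\<close> inside the corner ring with identity \<open>S 0\<close>.
  An element \<open>D\<close> whose conjugates under \<open>\<langle>s\<^sup>p\<rangle>\<close> sum to the identity expresses that a module is
  projective relative to the trivial subgroup of \<open>\<langle>s\<^sup>p\<rangle>\<close> (Higman's criterion). For \<open>p\<close> dividing
  \<open>q\<close> the same then holds for \<open>\<langle>s\<rangle>\<close>. The reason is cohomological. Write \<open>\<gamma>\<close> for conjugation by \<open>s\<close>.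
  The element \<open>\<gamma> D - D\<close> has norm zero under \<open>\<langle>s\<^sup>p\<rangle>\<close>, so it is \<open>\<gamma>\<^sup>p \<theta>\<^sub>1 - \<theta>\<^sub>1\<close> for some
  \<open>\<theta>\<^sub>1\<close>. Subtracting the first \<open>p\<close> conjugates of \<open>\<theta>\<^sub>1\<close> from \<open>D\<close> leaves a fixed point \<open>\<kappa>\<close>, and
  \<open>1 = N \<theta>\<^sub>1 + q \<kappa>\<close> for the norm \<open>N\<close> of \<open>\<langle>s\<rangle>\<close>. The error \<open>q \<kappa>\<close> is removed by multiplying with
  \<open>1 + q \<kappa>\<close>, since \<open>q\<^sup>2 \<kappa>\<^sup>2 = m (q / p) \<kappa>\<^sup>2\<close> is itself a norm.
\<close>

lemma cyclic_lift_of_unit: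
  fixes S :: "int \<Rightarrow> 'r::ring_1" and D :: 'r and p q :: nat
  assumes S_add: "\<And>i j. S i * S j = S (i + j)"
    and S_per: "\<And>i. S (i + int (p * q)) = S i"
    and p: "p > 0" and pq: "p dvd q"
    and D: "S 0 * D = D" "D * S 0 = D"
    and sum_D: "(\<Sum>i<q. S (int (p * i)) * D * S (- int (p * i))) = S 0"
  obtains \<theta> where "S 0 * \<theta> = \<theta>" "\<theta> * S 0 = \<theta>"
    "(\<Sum>i<p * q. S (int i) * \<theta> * S (- int i)) = S 0"
proof -
  define \<gamma> where "\<gamma> i x = S i * x * S (- i)" for i x
  have \<gamma>_add: "\<gamma> i (x + y) = \<gamma> i x + \<gamma> i y" and \<gamma>_diff: "\<gamma> i (x - y) = \<gamma> i x - \<gamma> i y"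
    and \<gamma>_minus: "\<gamma> i (- x) = - \<gamma> i x" for i x y
    by (simp_all add: \<gamma>_def algebra_simps)
  have \<gamma>_sum: "\<gamma> i (sum f A) = (\<Sum>a\<in>A. \<gamma> i (f a))" for i f and A :: "nat set"
    by (simp add: \<gamma>_def sum_distrib_left sum_distrib_right)
  have \<gamma>_\<gamma>: "\<gamma> i (\<gamma> j x) = \<gamma> (i + j) x" for i j x
  proof -
    have "\<gamma> i (\<gamma> j x) = (S i * S j) * x * (S (- j) * S (- i))"
      by (simp add: \<gamma>_def mult.assoc)
    then show ?thesis
      by (simp add: S_add \<gamma>_def add.commute)
  qed
  have \<gamma>_mult: "\<gamma> i (x * y) = \<gamma> i x * \<gamma> i y" if "x * S 0 = x" for i x y
  proof -
    have "\<gamma> i x * \<gamma> i y = S i * x * (S (- i) * S i) * y * S (- i)"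
      by (simp add: \<gamma>_def mult.assoc)
    also have "\<dots> = S i * (x * S 0) * y * S (- i)"
      by (simp add: S_add mult.assoc)
    finally show ?thesis
      by (simp add: that \<gamma>_def mult.assoc)
  qed
  have \<gamma>_0: "\<gamma> 0 x = x" if "S 0 * x = x" "x * S 0 = x" for x
    using that by (simp add: \<gamma>_def)
  have \<gamma>_e: "\<gamma> i (S 0) = S 0" for i
    by (simp add: \<gamma>_def S_add)
  have corner_\<gamma>: "S 0 * \<gamma> i x = \<gamma> i x" "\<gamma> i x * S 0 = \<gamma> i x" for i x
    by (simp add: \<gamma>_def S_add mult.assoc[symmetric]) (simp add: \<gamma>_def S_add mult.assoc)
  have sum_D': "(\<Sum>i<q. \<gamma> (int (p * i)) D) = S 0"
    using sum_D by (simp add: \<gamma>_def)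
  have sum_D_shift: "(\<Sum>i<q. \<gamma> (int (p * Suc i)) D) = S 0"
  proof -
    have "\<gamma> (int p) (\<Sum>i<q. \<gamma> (int (p * i)) D) = (\<Sum>i<q. \<gamma> (int (p * Suc i)) D)"
      by (simp add: \<gamma>_sum \<gamma>_\<gamma>)
    then show ?thesis
      unfolding sum_D' \<gamma>_e by (rule sym)
  qed
  define Y where "Y = \<gamma> 1 D - D"
  have Y: "S 0 * Y = Y" "Y * S 0 = Y"
    by (simp_all add: Y_def algebra_simps corner_\<gamma> D)
  define T where "T k = (\<Sum>i<k. \<gamma> (int (p * i)) Y)" for k
  have T_q: "T q = 0"
  proof -
    have "T q = \<gamma> 1 (\<Sum>i<q. \<gamma> (int (p * i)) D) - (\<Sum>i<q. \<gamma> (int (p * i)) D)"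
      by (simp add: T_def Y_def \<gamma>_diff \<gamma>_sum \<gamma>_\<gamma> sum_subtractf add.commute)
    then show ?thesis
      unfolding sum_D' \<gamma>_e by simp
  qed
  have T_Suc: "\<gamma> (int p) (T k) = T (Suc k) - Y" for k
    unfolding T_def sum.lessThan_Suc_shift by (simp add: \<gamma>_sum \<gamma>_\<gamma> \<gamma>_0[OF Y])
  have T_corner: "T k * S 0 = T k" "S 0 * T k = T k" for k
    by (simp_all add: T_def sum_distrib_right sum_distrib_left corner_\<gamma>)
  \<comment> \<open>The contracting homotopy of the standard resolution, built from the partial norms \<open>T k\<close> of \<open>Y\<close>.\<close>
  define \<theta>\<^sub>1 where "\<theta>\<^sub>1 = - (\<Sum>k<q. T k * \<gamma> (int (p * k)) D)"
  have \<theta>\<^sub>1: "S 0 * \<theta>\<^sub>1 = \<theta>\<^sub>1" "\<theta>\<^sub>1 * S 0 = \<theta>\<^sub>1"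
    by (simp_all add: \<theta>\<^sub>1_def sum_distrib_right sum_distrib_left mult.assoc corner_\<gamma>)
       (simp add: mult.assoc[symmetric] T_corner)
  have \<theta>\<^sub>1_p: "\<gamma> (int p) \<theta>\<^sub>1 = \<theta>\<^sub>1 + Y"
  proof -
    define g where "g k = T k * \<gamma> (int (p * k)) D" for k
    have "\<gamma> (int p) (\<Sum>k<q. g k) = (\<Sum>k<q. (T (Suc k) - Y) * \<gamma> (int (p * Suc k)) D)"
      by (simp add: g_def \<gamma>_sum \<gamma>_mult T_corner T_Suc \<gamma>_\<gamma>)
    also have "\<dots> = (\<Sum>k<q. g (Suc k)) - Y * (\<Sum>k<q. \<gamma> (int (p * Suc k)) D)"
      by (simp only: g_def left_diff_distrib sum_subtractf sum_distrib_left)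
    also have "(\<Sum>k<q. g (Suc k)) = (\<Sum>k<q. g k)"
    proof -
      have "g q = 0" "g 0 = 0"
        by (simp_all add: g_def T_q) (simp add: T_def)
      then have "(\<Sum>k<q. g (Suc k)) = (\<Sum>k<Suc q. g k)"
        by (simp only: sum.lessThan_Suc_shift[of g q] add_0_left)
      then show ?thesis
        by (simp only: sum.lessThan_Suc \<open>g q = 0\<close> add_0_right)
    qed
    finally have "\<gamma> (int p) (\<Sum>k<q. g k) = (\<Sum>k<q. g k) - Y"
      unfolding sum_D_shift Y .
    then show ?thesis
      by (simp add: \<theta>\<^sub>1_def g_def \<gamma>_minus)
  qed
  define \<kappa> where "\<kappa> = D - (\<Sum>i<p. \<gamma> (int i) \<theta>\<^sub>1)"
  have \<kappa>: "S 0 * \<kappa> = \<kappa>" "\<kappa> * S 0 = \<kappa>"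
    by (simp_all add: \<kappa>_def algebra_simps sum_distrib_left sum_distrib_right corner_\<gamma> D)
  have \<kappa>_1: "\<gamma> 1 \<kappa> = \<kappa>"
  proof -
    have "(\<Sum>i<p. \<gamma> (int (Suc i)) \<theta>\<^sub>1) + \<gamma> 0 \<theta>\<^sub>1 = (\<Sum>i<p. \<gamma> (int i) \<theta>\<^sub>1) + \<gamma> (int p) \<theta>\<^sub>1"
      using sum.lessThan_Suc_shift[of "\<lambda>i. \<gamma> (int i) \<theta>\<^sub>1" p] by (simp add: add.commute)
    then have "(\<Sum>i<p. \<gamma> (int (Suc i)) \<theta>\<^sub>1) = (\<Sum>i<p. \<gamma> (int i) \<theta>\<^sub>1) + Y"
      by (simp add: \<gamma>_0[OF \<theta>\<^sub>1] \<theta>\<^sub>1_p algebra_simps)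
    moreover have "\<gamma> 1 \<kappa> = \<gamma> 1 D - (\<Sum>i<p. \<gamma> (int (Suc i)) \<theta>\<^sub>1)"
      by (simp add: \<kappa>_def \<gamma>_diff \<gamma>_sum \<gamma>_\<gamma> add.commute)
    ultimately show ?thesis
      by (simp add: \<kappa>_def Y_def)
  qed
  have \<kappa>_fix: "\<gamma> (int i) \<kappa> = \<kappa>" for i
  proof (induction i)
    case (Suc i)
    have "\<gamma> (int (Suc i)) \<kappa> = \<gamma> 1 (\<gamma> (int i) \<kappa>)"
      by (simp add: \<gamma>_\<gamma>)
    then show ?case
      by (simp add: Suc \<kappa>_1)
  qed (simp add: \<gamma>_0[OF \<kappa>])
  have e_eq: "S 0 = of_nat q * \<kappa> + (\<Sum>i<p * q. \<gamma> (int i) \<theta>\<^sub>1)"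
  proof -
    have D_eq: "D = \<kappa> + (\<Sum>i<p. \<gamma> (int i) \<theta>\<^sub>1)"
      by (simp add: \<kappa>_def)
    have block: "(\<Sum>i<p. \<gamma> (int (p * k) + int i) \<theta>\<^sub>1) = (\<Sum>i=k * p..<k * p + p. \<gamma> (int i) \<theta>\<^sub>1)" for k
      by (rule sum.reindex_bij_witness[where i = "\<lambda>i. i - k * p" and j = "\<lambda>i. k * p + i"])
         (auto simp: mult.commute)
    have "S 0 = (\<Sum>k<q. \<gamma> (int (p * k)) (\<kappa> + (\<Sum>i<p. \<gamma> (int i) \<theta>\<^sub>1)))"
      using sum_D' D_eq by simp
    also have "\<dots> = (\<Sum>k<q. \<kappa> + (\<Sum>i=k * p..<k * p + p. \<gamma> (int i) \<theta>\<^sub>1))"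
      by (rule sum.cong) (simp_all only: \<gamma>_add \<kappa>_fix \<gamma>_sum \<gamma>_\<gamma> block)
    also have "\<dots> = of_nat q * \<kappa> + (\<Sum>i<p * q. \<gamma> (int i) \<theta>\<^sub>1)"
      by (simp add: sum.distrib sum.nat_group mult.commute)
    finally show ?thesis .
  qed
  obtain r where r: "q = p * r"
    using pq by auto
  \<comment> \<open>Here \<open>N(\<theta>\<^sub>1 (1 + q \<kappa>)) = (1 - q \<kappa>)(1 + q \<kappa>)\<close> and \<open>N(r \<kappa>\<^sup>2) = p q r \<kappa>\<^sup>2 = q\<^sup>2 \<kappa>\<^sup>2\<close>.\<close>
  define \<theta> where "\<theta> = \<theta>\<^sub>1 * (S 0 + of_nat q * \<kappa>) + of_nat r * (\<kappa> * \<kappa>)"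
  have \<kappa>\<kappa>: "S 0 * (\<kappa> * \<kappa>) = \<kappa> * \<kappa>" "\<kappa> * \<kappa> * S 0 = \<kappa> * \<kappa>"
    by (simp add: mult.assoc[symmetric] \<kappa>) (simp add: mult.assoc \<kappa>)
  have nat_comm: "x * (of_nat n * y) = of_nat n * (x * y)" for n x and y :: 'r
    by (metis mult.assoc mult_of_nat_commute)
  have "\<gamma> (int i) \<theta> = \<gamma> (int i) \<theta>\<^sub>1 * (S 0 + of_nat q * \<kappa>) + of_nat r * (\<kappa> * \<kappa>)" for i
  proof -
    have nat: "\<gamma> (int i) (of_nat n * x) = of_nat n * \<gamma> (int i) x" for n x
      by (simp add: \<gamma>_def nat_comm[of "S (int i)"] mult.assoc)
    show ?thesis
      by (simp add: \<theta>_def \<gamma>_add \<gamma>_mult \<theta>\<^sub>1 \<kappa> nat \<gamma>_e \<kappa>_fix)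
  qed
  then have "(\<Sum>i<p * q. \<gamma> (int i) \<theta>) =
      (\<Sum>i<p * q. \<gamma> (int i) \<theta>\<^sub>1) * (S 0 + of_nat q * \<kappa>) + of_nat (p * q * r) * (\<kappa> * \<kappa>)"
    by (simp add: sum.distrib sum_distrib_right mult.assoc)
  also have "(\<Sum>i<p * q. \<gamma> (int i) \<theta>\<^sub>1) = S 0 - of_nat q * \<kappa>"
    using e_eq by (simp add: algebra_simps)
  also have "(S 0 - of_nat q * \<kappa>) * (S 0 + of_nat q * \<kappa>) = S 0 - of_nat (q * q) * (\<kappa> * \<kappa>)"
  proof -
    have "(S 0 - of_nat q * \<kappa>) * (S 0 + of_nat q * \<kappa>)
        = S 0 * S 0 + of_nat q * (S 0 * \<kappa>) - of_nat q * (\<kappa> * S 0) - of_nat q * (of_nat q * (\<kappa> * \<kappa>))"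
      by (simp add: distrib_left left_diff_distrib nat_comm[of "S 0"] nat_comm[of \<kappa>] mult.assoc)
    then show ?thesis
      by (simp add: \<kappa> S_add mult.assoc)
  qed
  also have "p * q * r = q * q"
    by (simp add: r)
  finally have "(\<Sum>i<p * q. S (int i) * \<theta> * S (- int i)) = S 0"
    by (simp add: \<gamma>_def)
  moreover have "S 0 * \<theta> = \<theta>"
    by (simp add: \<theta>_def distrib_left nat_comm[of "S 0" r] mult.assoc[of "S 0" \<theta>\<^sub>1, symmetric]
        \<theta>\<^sub>1 \<kappa>\<kappa>)
  moreover have "\<theta> * S 0 = \<theta>"
    by (simp add: \<theta>_def distrib_right mult.assoc \<kappa> \<kappa>\<kappa>[unfolded mult.assoc] S_add)
  ultimately show thesis
    using that by blast
qed

text \<open>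
  All orbit lengths divide \<open>p ^ N\<close> and do not divide \<open>p ^ M\<close>, hence they are multiples of
  \<open>p ^ Suc M\<close>, and the weight is constant on each orbit.
\<close>

lemma dvd_weighted_sum_of_long_orbits:
  fixes wt :: "'w \<Rightarrow> int"
  assumes p: "Factorial_Ring.prime p"
    and "finite W" "\<And>w. w \<in> W \<Longrightarrow> \<rho> w \<in> W"
    and "\<And>w. w \<in> W \<Longrightarrow> (\<rho> ^^ (p ^ N)) w = w"
    and "\<And>w. w \<in> W \<Longrightarrow> (\<rho> ^^ (p ^ M)) w \<noteq> w"
    and "\<And>w. w \<in> W \<Longrightarrow> wt (\<rho> w) = wt w"
  shows "int (p ^ Suc M) dvd (\<Sum>w\<in>W. wt w)"
  using assms(2-)
proof (induction "card W" arbitrary: W rule: less_induct)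
  case less
  show ?case
  proof (cases "W = {}")
    case False
    then obtain w where w: "w \<in> W"
      by blast
    have orbit_W: "(\<rho> ^^ i) w \<in> W" for i
      by (induction i) (simp_all add: w less.prems(2))
    have wt_orbit: "wt ((\<rho> ^^ i) w) = wt w" for i
      by (induction i) (simp_all add: orbit_W less.prems(5))
    define d where "d = (LEAST d. 0 < d \<and> (\<rho> ^^ d) w = w)"
    have d: "0 < d" "(\<rho> ^^ d) w = w"
    proof -
      have "0 < p ^ N \<and> (\<rho> ^^ (p ^ N)) w = w"
        using p w less.prems(3) by (simp add: prime_gt_0_nat)
      then have "0 < d \<and> (\<rho> ^^ d) w = w"
        unfolding d_def by (rule LeastI)
      then show "0 < d" "(\<rho> ^^ d) w = w"
        by simp_all
    qed
    have d_min: "i = 0" if "i < d" "(\<rho> ^^ i) w = w" for i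
      using that not_less_Least[of i "\<lambda>d. 0 < d \<and> (\<rho> ^^ d) w = w"] by (auto simp: d_def)
    have dvd_iff: "(\<rho> ^^ i) w = w \<longleftrightarrow> d dvd i" for i
    proof
      assume "(\<rho> ^^ i) w = w"
      then have "(\<rho> ^^ (i mod d)) w = w"
        using funpow_mod_eq[where f = \<rho>, OF d(2), of i] by simp
      then show "d dvd i"
        using d_min[of "i mod d"] d(1) by auto
    next
      assume "d dvd i"
      then show "(\<rho> ^^ i) w = w"
        using funpow_mod_eq[where f = \<rho>, OF d(2), of i] by simp
    qed
    obtain b where b: "d = p ^ b"
      using dvd_iff[of "p ^ N"] less.prems(3)[OF w] divides_primepow_nat[OF p] by blast
    have "M < b"
      using dvd_iff[of "p ^ M"] less.prems(4)[OF w] by (auto simp: b not_le[symmetric] le_imp_power_dvd)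
    then have dvd_d: "int (p ^ Suc M) dvd int d"
      unfolding b by (metis Suc_leI le_imp_power_dvd of_nat_dvd_iff)
    define O' where "O' = (\<lambda>i. (\<rho> ^^ i) w) ` {..<d}"
    have O'_mem: "(\<rho> ^^ i) w \<in> O'" for i
    proof -
      have "(\<rho> ^^ (i mod d)) w \<in> O'"
        using d(1) by (simp add: O'_def)
      then show ?thesis
        using funpow_mod_eq[where f = \<rho>, OF d(2), of i] by simp
    qed
    have inj: "inj_on (\<lambda>i. (\<rho> ^^ i) w) {..<d}"
    proof (rule linorder_inj_onI')
      fix i j assume ij: "i \<in> {..<d}" "j \<in> {..<d}" "i < j"
      show "(\<rho> ^^ i) w \<noteq> (\<rho> ^^ j) w"
      proof
        assume "(\<rho> ^^ i) w = (\<rho> ^^ j) w"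
        then have "(\<rho> ^^ (d - j)) ((\<rho> ^^ i) w) = (\<rho> ^^ (d - j)) ((\<rho> ^^ j) w)"
          by simp
        then have "(\<rho> ^^ (d - j + i)) w = (\<rho> ^^ (d - j + j)) w"
          by (simp add: funpow_add)
        then have "(\<rho> ^^ (d - j + i)) w = w"
          using ij d(2) by simp
        then have "d dvd d - j + i"
          by (simp add: dvd_iff)
        then show False
          using ij by (auto dest!: dvd_imp_le)
      qed
    qed
    have O'_W: "O' \<subseteq> W"
      using orbit_W by (auto simp: O'_def)
    have sum_O': "(\<Sum>v\<in>O'. wt v) = int d * wt w"
      by (simp add: O'_def sum.reindex[OF inj] wt_orbit)
    have rest: "int (p ^ Suc M) dvd (\<Sum>v\<in>W - O'. wt v)"
    proof (rule less.hyps)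
      show "card (W - O') < card W"
        using O'_mem[of 0] w less.prems(1) by (intro psubset_card_mono) auto
      fix v assume v: "v \<in> W - O'"
      show "\<rho> v \<in> W - O'"
      proof
        show "\<rho> v \<notin> O'"
        proof
          assume "\<rho> v \<in> O'"
          then obtain i where i: "\<rho> v = (\<rho> ^^ i) w"
            by (auto simp: O'_def)
          have "(\<rho> ^^ (p ^ N)) v = (\<rho> ^^ (p ^ N - 1)) (\<rho> v)"
            using p by (metis One_nat_def Suc_pred comp_apply funpow_Suc_right prime_gt_0_nat zero_less_power)
          also have "\<dots> = (\<rho> ^^ (p ^ N - 1 + i)) w"
            by (simp add: i funpow_add)
          finally have "v \<in> O'"
            using less.prems(3)[of v] v O'_mem by auto
          with v show False
            by simp
        qed
      qed (use v less.prems(2) in auto)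
    qed (use less.prems in auto)
    have "(\<Sum>v\<in>W. wt v) = (\<Sum>v\<in>W - O'. wt v) + (\<Sum>v\<in>O'. wt v)"
      by (rule sum.subset_diff[OF O'_W less.prems(1)])
    then show ?thesis
      using rest dvd_d by (simp add: sum_O')
  qed simp
qed

lemma sum_list_rotation_invariant:
  fixes w :: "nat list"
  assumes "length w = d * c" "rotate d w = w" "c > 0"
  shows "sum_list w = c * sum_list (take d w)"
  using assms
proof (induction c arbitrary: w)
  case (Suc c)
  show ?case
  proof (cases "c = 0")
    case False
    define t v where "t = take d w" and "v = drop d w"
    have w: "w = t @ v" and t: "length t = d" and v: "length v = d * c"
      using Suc.prems by (simp_all add: t_def v_def)
    have comm: "v @ t = t @ v"
    proof -
      have "rotate d w = v @ t"
        by (simp add: w t[symmetric] rotate_append)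
      with Suc.prems(2) w show ?thesis
        by simp
    qed
    have "d \<le> length v"
      using v False by simp
    then have take_v: "take d v = t"
      using arg_cong[OF comm, of "take d"] t by simp
    have "rotate d v = drop d v @ t"
      using rotate_append[of "take d v" "drop d v"] take_v t by (metis append_take_drop_id)
    also have "\<dots> = v"
      using arg_cong[OF comm, of "drop d"] \<open>d \<le> length v\<close> t by simp
    finally have "sum_list v = c * sum_list (take d v)"
      using Suc.IH[of v] v False by simp
    then show ?thesis
      by (simp add: w t take_v)
  qed (use Suc.prems in simp)
qed simp

text \<open>
  The hypothesis says that \<open>\<Sum>k. Z k c\<^sup>k\<close> is an idempotent over the group ring of the cyclic group \<open>\<langle>c\<rangle>\<close>
  of order \<open>p ^ j\<close>; the conclusion says that its trace, an element of this group ring, is supported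
  at \<open>1\<close>. Replacing the idempotent by its power with exponent \<open>L = p ^ (M + j)\<close> expresses \<open>Z k\<close> as a sum
  over the words of length \<open>L\<close> with sum \<open>k\<close> modulo \<open>p ^ j\<close>. The trace of a product is invariant under
  rotation of the word. A word fixed by the rotation by \<open>p ^ M\<close> is a repetition of a word of
  length \<open>p ^ M\<close>, so its sum is a multiple of \<open>p ^ j\<close>, unlike \<open>k\<close>. Hence all rotation orbits are
  long, and the trace of \<open>Z k\<close> is divisible by every power of \<open>p\<close>.
\<close>

lemma trace_zero_of_graded_idempotent:
  fixes Z :: "int \<Rightarrow> 'r::ring_1" and \<tau> :: "'r \<Rightarrow> int"
  assumes p: "Factorial_Ring.prime p"
    and Z_per: "\<And>i. Z (i mod int (p ^ j)) = Z i"
    and Z_mult: "\<And>k. Z k = (\<Sum>i<p ^ j. Z (int i) * Z (k - int i))"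
    and \<tau>_add: "\<And>x y. \<tau> (x + y) = \<tau> x + \<tau> y"
    and \<tau>_comm: "\<And>i x. e * x = x \<Longrightarrow> x * e = x \<Longrightarrow> \<tau> (Z i * x) = \<tau> (x * Z i)"
    and e: "\<And>i. Z i * e = Z i" "\<And>i. e * Z i = Z i"
    and k: "\<not> int (p ^ j) dvd k"
  shows "\<tau> (Z k) = 0"
proof -
  let ?m = "p ^ j"
  have m: "?m > 0"
    using p by (simp add: prime_gt_0_nat)
  have \<tau>_0: "\<tau> 0 = 0"
    using \<tau>_add[of 0 0] by simp
  have \<tau>_sum: "\<tau> (sum f A) = (\<Sum>a\<in>A. \<tau> (f a))" if "finite A" for f and A :: "nat list set"
    using that by (induction A) (simp_all add: \<tau>_0 \<tau>_add)
  define W where "W L k = {w :: nat list. length w = L \<and> set w \<subseteq> {..<?m} \<and> int ?m dvd int (sum_list w) - k}"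
    for L k
  define \<pi> where "\<pi> w = prod_list (map (\<lambda>i. Z (int i)) w)" for w
  have fin_W: "finite (W L k)" for L k
    by (rule finite_subset[OF _ finite_lists_length_eq[of "{..<?m}" L]]) (auto simp: W_def)
  have expand: "Z k = (\<Sum>w\<in>W (Suc L) k. \<pi> w)" for L k
  proof (induction L arbitrary: k)
    case 0
    define i where "i = nat (k mod int ?m)"
    have i: "int i = k mod int ?m" "i < ?m"
      using m by (simp_all add: i_def nat_less_iff del: of_nat_power)
    have uniq: "i' = i" if "i' < ?m" "int ?m dvd int i' - k" for i'
    proof -
      have "int i' mod int ?m = k mod int ?m"
        using that(2) by (simp only: mod_eq_dvd_iff)
      then show ?thesis
        using that(1) i(1) by (metis mod_less of_nat_eq_iff zmod_int)
    qed
    have mem: "int ?m dvd int i - k"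
      unfolding i(1) by (metis mod_eq_dvd_iff mod_mod_trivial)
    have "W (Suc 0) k = {[i]}"
    proof (intro equalityI subsetI)
      fix w assume "w \<in> W (Suc 0) k"
      then have w: "length w = Suc 0" "set w \<subseteq> {..<?m}" "int ?m dvd int (sum_list w) - k"
        unfolding W_def by blast+
      then obtain i' where "w = [i']"
        by (auto simp: length_Suc_conv)
      with w uniq show "w \<in> {[i]}"
        by (simp del: of_nat_power)
    qed (use i(2) mem in \<open>simp add: W_def del: of_nat_power\<close>)
    then show ?case
      using Z_per[of k] by (simp add: \<pi>_def i(1))
  next
    case (Suc L)
    have split: "W (Suc (Suc L)) k = (\<Union>i\<in>{..<?m}. (#) i ` W (Suc L) (k - int i))"
    proof (intro equalityI subsetI)
      fix w assume w: "w \<in> W (Suc (Suc L)) k"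
      then obtain i v where iv: "w = i # v"
        by (auto simp: W_def length_Suc_conv)
      with w have "v \<in> W (Suc L) (k - int i)" "i < ?m"
        by (auto simp: W_def algebra_simps)
      then show "w \<in> (\<Union>i\<in>{..<?m}. (#) i ` W (Suc L) (k - int i))"
        using iv by auto
    qed (auto simp: W_def algebra_simps)
    have "(\<Sum>w\<in>W (Suc (Suc L)) k. \<pi> w) = (\<Sum>i<?m. \<Sum>w\<in>(#) i ` W (Suc L) (k - int i). \<pi> w)"
      unfolding split by (rule sum.UNION_disjoint) (auto simp: fin_W)
    also have "\<dots> = (\<Sum>i<?m. Z (int i) * (\<Sum>w\<in>W (Suc L) (k - int i). \<pi> w))"
      by (simp add: sum.reindex \<pi>_def sum_distrib_left)
    also have "\<dots> = (\<Sum>i<?m. Z (int i) * Z (k - int i))"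
      by (simp add: Suc.IH)
    finally show ?case
      using Z_mult[of k] by simp
  qed
  have dvd: "int (p ^ Suc M) dvd \<tau> (Z k)" for M
  proof -
    define L where "L = p ^ (M + j)"
    have L: "L > 0"
      using p by (simp add: L_def prime_gt_0_nat)
    have "int (p ^ Suc M) dvd (\<Sum>w\<in>W L k. \<tau> (\<pi> w))"
    proof (rule dvd_weighted_sum_of_long_orbits[OF p fin_W, where \<rho> = rotate1 and N = "M + j"])
      fix w assume w: "w \<in> W L k"
      show "rotate1 w \<in> W L k"
        using w by (cases w) (auto simp: W_def add.commute)
      show "(rotate1 ^^ (p ^ (M + j))) w = w"
        using w by (simp add: W_def L_def rotate_def[symmetric])
      show "(rotate1 ^^ (p ^ M)) w \<noteq> w"
      proof
        assume "(rotate1 ^^ (p ^ M)) w = w"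
        then have "sum_list w = ?m * sum_list (take (p ^ M) w)"
          using w m by (intro sum_list_rotation_invariant) (simp_all add: W_def L_def rotate_def power_add)
        then have "int ?m dvd int (sum_list w)"
          by simp
        moreover have "int ?m dvd int (sum_list w) - k"
          using w unfolding W_def by blast
        ultimately show False
          using k by (metis dvd_diff_right_iff)
      qed
      show "\<tau> (\<pi> (rotate1 w)) = \<tau> (\<pi> w)"
      proof (cases w)
        case (Cons i v)
        show ?thesis
        proof (cases "v = []")
          case False
          have "\<pi> v * e = \<pi> v"
            using False by (induction v rule: list_nonempty_induct) (simp_all add: \<pi>_def e mult.assoc)
          moreover have "e * \<pi> v = \<pi> v"
            using False by (cases v) (simp_all add: \<pi>_def e mult.assoc[symmetric])
          ultimately show ?thesis
            using \<tau>_comm[of "\<pi> v" "int i"] by (simp add: Cons \<pi>_def mult.assoc)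
        qed (simp add: Cons)
      qed simp
    qed
    moreover have "\<tau> (Z k) = (\<Sum>w\<in>W L k. \<tau> (\<pi> w))"
      using expand[of k "L - 1"] L \<tau>_sum[OF fin_W] by simp
    ultimately show ?thesis
      by simp
  qed
  show ?thesis
  proof (rule ccontr)
    assume "\<tau> (Z k) \<noteq> 0"
    define M where "M = nat \<bar>\<tau> (Z k)\<bar>"
    have "int (p ^ Suc M) \<le> \<bar>\<tau> (Z k)\<bar>"
      using dvd[of M] \<open>\<tau> (Z k) \<noteq> 0\<close> by (metis dvd_imp_le_int abs_of_nat)
    moreover have "Suc M < p ^ Suc M"
      using prime_gt_1_nat[OF p] by (simp only: power_gt_expt One_nat_def)
    ultimately show False
      unfolding M_def by linarith
  qed
qed

text \<open>
  With \<open>\<theta>\<close> from \<open>cyclic_lift_of_unit\<close>, the elements \<open>\<theta> S(-k)\<close> are the coefficients of the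
  idempotent that presents the module as a summand of an induced module. Their traces determine
  those of the \<open>S k\<close>, because \<open>S k\<close> is the sum of the conjugates of \<open>\<theta> S k\<close>.
\<close>

lemma trace_zero_of_lifted_cyclic_family:
  fixes S :: "int \<Rightarrow> 'r::ring_1" and D :: 'r and \<tau> :: "'r \<Rightarrow> int" and p q j :: nat
  assumes p: "Factorial_Ring.prime p" and pq: "p * q = p ^ j" "p dvd q"
    and S_add: "\<And>i j. S i * S j = S (i + j)"
    and S_per: "\<And>i. S (i + int (p * q)) = S i"
    and D: "S 0 * D = D" "D * S 0 = D"
    and sum_D: "(\<Sum>i<q. S (int (p * i)) * D * S (- int (p * i))) = S 0"
    and \<tau>_add: "\<And>x y. \<tau> (x + y) = \<tau> x + \<tau> y"
    and \<tau>_comm: "\<And>x y. S 0 * x = x \<Longrightarrow> x * S 0 = x \<Longrightarrow> S 0 * y = y \<Longrightarrow> y * S 0 = y \<Longrightarrow>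
      \<tau> (x * y) = \<tau> (y * x)"
    and k: "\<not> int (p ^ j) dvd k"
  shows "\<tau> (S k) = 0"
proof -
  obtain \<theta> where \<theta>: "S 0 * \<theta> = \<theta>" "\<theta> * S 0 = \<theta>"
    and sum_\<theta>: "(\<Sum>i<p * q. S (int i) * \<theta> * S (- int i)) = S 0"
    using cyclic_lift_of_unit[OF S_add S_per _ pq(2) D sum_D] prime_gt_0_nat[OF p] by blast
  define Z where "Z i = \<theta> * S (- i)" for i
  have S_per': "S (i + int (p * q) * n) = S i" for i n
  proof (induction n rule: int_induct[where k = 0])
    case (step1 n)
    then show ?case
      using S_per[of "i + int (p * q) * n"] by (simp add: algebra_simps del: of_nat_mult)
  next
    case (step2 n)
    then show ?case
      using S_per[of "i + int (p * q) * (n - 1)"] by (simp add: algebra_simps del: of_nat_mult)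
  qed simp
  have S_mod: "S (i mod int (p * q)) = S i" for i
    using S_per'[of "i mod int (p * q)" "i div int (p * q)"] by (simp only: mod_mult_div_eq)
  have S_0_S: "S 0 * S i = S i" "S i * S 0 = S i" for i
    by (simp_all add: S_add)
  have Z_corner: "Z i * S 0 = Z i" "S 0 * Z i = Z i" for i
    by (simp_all add: Z_def mult.assoc S_0_S) (simp add: mult.assoc[symmetric] \<theta>)
  have Z_per: "Z (i mod int (p * q)) = Z i" for i
    unfolding Z_def using S_mod[of "- (i mod int (p * q))"] S_mod[of "- i"]
    by (simp only: mod_minus_eq)
  have \<tau>_0: "\<tau> 0 = 0"
    using \<tau>_add[of 0 0] by simp
  have \<tau>_sum: "\<tau> (sum f A) = (\<Sum>a\<in>A. \<tau> (f a))" if "finite A" for f and A :: "nat set"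
    using that by (induction A) (simp_all add: \<tau>_0 \<tau>_add)
  have sum_\<theta>': "(\<Sum>i<p * q. S (- int i) * \<theta> * S (int i)) = S 0"
  proof -
    define \<sigma> where "\<sigma> i = nat ((- int i) mod int (p * q))" for i
    have pos: "0 < int (p * q)"
      using p unfolding pq(1) by (simp add: prime_gt_0_nat)
    have int_\<sigma>: "int (\<sigma> i) = (- int i) mod int (p * q)" for i
      using pos by (simp add: \<sigma>_def del: of_nat_mult)
    have \<sigma>: "\<sigma> i < p * q" for i
      using int_\<sigma>[of i] pos by (metis of_nat_less_iff pos_mod_bound)
    have \<sigma>_\<sigma>: "\<sigma> (\<sigma> i) = i" if "i < p * q" for i
    proof -
      have "int (\<sigma> (\<sigma> i)) = int i"
        unfolding int_\<sigma> mod_minus_eq using that by (simp only: minus_minus mod_less flip: of_nat_mod)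
      then show ?thesis
        by simp
    qed
    have "(\<Sum>i<p * q. S (- int i) * \<theta> * S (int i)) = (\<Sum>i<p * q. S (int i) * \<theta> * S (- int i))"
    proof (rule sum.reindex_bij_witness[where i = \<sigma> and j = \<sigma>])
      fix i assume i: "i \<in> {..<p * q}"
      have "S (- int (\<sigma> i)) = S (int i)"
        using S_mod[of "- int (\<sigma> i)"] S_mod[of "int i"] unfolding int_\<sigma> by (simp only: mod_minus_eq minus_minus)
      moreover have "S (int (\<sigma> i)) = S (- int i)"
        unfolding int_\<sigma> by (rule S_mod)
      ultimately show "S (int (\<sigma> i)) * \<theta> * S (- int (\<sigma> i)) = S (- int i) * \<theta> * S (int i)"
        by simp
    qed (use \<sigma> \<sigma>_\<sigma> in auto)
    then show ?thesis
      using sum_\<theta> by simp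
  qed
  have Z_mult: "Z l = (\<Sum>i<p ^ j. Z (int i) * Z (l - int i))" for l
  proof -
    have "Z (int i) * Z (l - int i) = \<theta> * (S (- int i) * \<theta> * S (int i)) * S (- l)" for i
    proof -
      have "S (int i - l) = S (int i) * S (- l)"
        by (simp add: S_add)
      then show ?thesis
        by (simp add: Z_def mult.assoc)
    qed
    then have "(\<Sum>i<p ^ j. Z (int i) * Z (l - int i)) = \<theta> * S 0 * S (- l)"
      unfolding pq(1)[symmetric] by (simp only: sum_distrib_left[symmetric] sum_distrib_right[symmetric] sum_\<theta>')
    then show ?thesis
      by (simp add: \<theta> Z_def)
  qed
  have Z_zero: "\<tau> (Z (- k)) = 0"
  proof (rule trace_zero_of_graded_idempotent[OF p, where Z = Z and j = j and e = "S 0"])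
    show "Z (i mod int (p ^ j)) = Z i" for i
      using Z_per unfolding pq(1) .
    show "\<tau> (Z i * x) = \<tau> (x * Z i)" if "S 0 * x = x" "x * S 0 = x" for i x
      using that by (intro \<tau>_comm) (simp_all add: Z_corner)
    show "Z l = (\<Sum>i<p ^ j. Z (int i) * Z (l - int i))" for l
      by (rule Z_mult)
  qed (use \<tau>_add Z_corner k in auto)
  have "S k = (\<Sum>i<p * q. S (int i) * \<theta> * S (- int i)) * S k"
    by (simp add: sum_\<theta> S_0_S)
  also have "\<dots> = (\<Sum>i<p * q. S (int i) * (Z (- k) * S (- int i)))"
  proof -
    have "S (- int i) * S k = S k * S (- int i)" for i
      by (simp add: S_add add.commute)
    then show ?thesis
      by (simp add: sum_distrib_right Z_def mult.assoc)
  qed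
  finally have "\<tau> (S k) = (\<Sum>i<p * q. \<tau> (S (int i) * (Z (- k) * S (- int i))))"
    using \<tau>_sum by simp
  also have "\<dots> = (\<Sum>i<p * q. \<tau> (Z (- k) * S (- int i) * S (int i)))"
  proof (intro sum.cong refl \<tau>_comm)
    show "S 0 * (Z (- k) * S (- int i)) = Z (- k) * S (- int i)" for i
      by (simp add: mult.assoc[symmetric] Z_corner)
  qed (simp_all add: S_0_S mult.assoc)
  also have "\<dots> = 0"
    by (simp add: mult.assoc S_add Z_corner Z_zero)
  finally show ?thesis .
qed

section \<open>Partial augmentations of units of order \<open>p\<close>\<close>

text \<open>
  Additive endomorphisms of the integer-valued functions on a type. They form a ring in the sense of
  the type classes; the endomorphisms of \<open>\<int>G\<close>, for a finite subset \<open>G\<close> of the type, are the corner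
  cut out by the restriction of functions to \<open>G\<close>.
\<close>

typedef 'a endo =
  "{f :: ('a \<Rightarrow> int) \<Rightarrow> 'a \<Rightarrow> int. \<forall>v w. f (\<lambda>a. v a + w a) = (\<lambda>a. f v a + f w a)}"
  morphisms apply_endo Endo
  by (rule exI[of _ "\<lambda>v. v"]) simp

setup_lifting type_definition_endo

instantiation endo :: (type) ring_1
begin

lift_definition zero_endo :: "'a endo" is "\<lambda>v a. 0"
  by simp
lift_definition one_endo :: "'a endo" is "\<lambda>v. v"
  by simp
lift_definition plus_endo :: "'a endo \<Rightarrow> 'a endo \<Rightarrow> 'a endo" is "\<lambda>f g v a. f v a + g v a"
  by (simp add: algebra_simps)
lift_definition uminus_endo :: "'a endo \<Rightarrow> 'a endo" is "\<lambda>f v a. - f v a"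
  by simp
lift_definition minus_endo :: "'a endo \<Rightarrow> 'a endo \<Rightarrow> 'a endo" is "\<lambda>f g v a. f v a - g v a"
  by (simp add: algebra_simps)
lift_definition times_endo :: "'a endo \<Rightarrow> 'a endo \<Rightarrow> 'a endo" is "\<lambda>f g v. f (g v)"
  by simp

instance
proof
  note rep = apply_endo_inject[symmetric] fun_eq_iff plus_endo.rep_eq times_endo.rep_eq
    minus_endo.rep_eq uminus_endo.rep_eq zero_endo.rep_eq one_endo.rep_eq
  fix f g h :: "'a endo"
  have "apply_endo f (\<lambda>a. v a + w a) = (\<lambda>a. apply_endo f v a + apply_endo f w a)" for v w
    using apply_endo[of f] by simp
  then show "f * (g + h) = f * g + f * h"
    by (simp add: rep)
  have "apply_endo (0 :: 'a endo) (\<lambda>_. 1) \<noteq> apply_endo 1 (\<lambda>_. 1)"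
    by (simp add: rep)
  then show "(0 :: 'a endo) \<noteq> 1"
    by metis
  show "f + g + h = f + (g + h)" "f + g = g + f" "0 + f = f" "- f + f = 0" "f - g = f + - g"
    "f * g * h = f * (g * h)" "(f + g) * h = f * h + g * h" "1 * f = f" "f * 1 = f"
    by (simp_all add: rep)
qed

end

lemma endo_expand:
  assumes "finite I" "\<And>i. i \<notin> I \<Longrightarrow> v i = 0"
  shows "apply_endo f v = (\<lambda>a. \<Sum>k\<in>I. v k * apply_endo f (\<lambda>i. of_bool (i = k)) a)"
proof -
  have add: "apply_endo f (\<lambda>a. v a + w a) = (\<lambda>a. apply_endo f v a + apply_endo f w a)" for v w
    using apply_endo[of f] by simp
  have zero: "apply_endo f (\<lambda>a. 0) = (\<lambda>a. 0)"
    using add[of "\<lambda>a. 0" "\<lambda>a. 0"] by (simp add: fun_eq_iff)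
  have scale: "apply_endo f (\<lambda>a. c * v a) = (\<lambda>a. c * apply_endo f v a)" for c v
  proof (induction c rule: int_induct[where k = 0])
    case (step1 c)
    then show ?case
      using add[of "\<lambda>a. c * v a" v] by (simp add: distrib_right)
  next
    case (step2 c)
    then show ?case
      using add[of "\<lambda>a. (c - 1) * v a" v] by (simp add: left_diff_distrib fun_eq_iff)
  qed (simp add: zero)
  have expand: "apply_endo f (\<lambda>a. \<Sum>k\<in>J. v k * of_bool (a = k)) =
      (\<lambda>a. \<Sum>k\<in>J. v k * apply_endo f (\<lambda>i. of_bool (i = k)) a)" if "finite J" for J
    using that
  proof (induction J)
    case (insert k J)
    then show ?case
      by (simp only: sum.insert add scale not_False_eq_True)
  qed (simp add: zero)
  have "(\<Sum>k\<in>I. v k * of_bool (a = k)) = v a" for a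
    using assms(2)[of a] by (cases "a \<in> I") (simp_all add: assms(1))
  then show ?thesis
    using expand[OF assms(1)] by simp
qed

definition endo_trace :: "'a set \<Rightarrow> 'a endo \<Rightarrow> int"
  where "endo_trace I f = (\<Sum>k\<in>I. apply_endo f (\<lambda>i. of_bool (i = k)) k)"

lemma endo_trace_add: "endo_trace I (f + g) = endo_trace I f + endo_trace I g"
  by (simp add: endo_trace_def plus_endo.rep_eq sum.distrib)

lemma endo_trace_commute:
  assumes "finite I" "\<And>v i. i \<notin> I \<Longrightarrow> apply_endo f v i = 0" "\<And>v i. i \<notin> I \<Longrightarrow> apply_endo g v i = 0"
  shows "endo_trace I (f * g) = endo_trace I (g * f)"
proof -
  have "endo_trace I (f * g) =
      (\<Sum>k\<in>I. \<Sum>l\<in>I. apply_endo g (\<lambda>i. of_bool (i = k)) l * apply_endo f (\<lambda>i. of_bool (i = l)) k)"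
    unfolding endo_trace_def times_endo.rep_eq by (subst endo_expand[OF assms(1) assms(3)]) simp_all
  also have "\<dots> = (\<Sum>l\<in>I. \<Sum>k\<in>I. apply_endo f (\<lambda>i. of_bool (i = l)) k * apply_endo g (\<lambda>i. of_bool (i = k)) l)"
    by (subst sum.swap) (simp add: mult.commute)
  also have "\<dots> = endo_trace I (g * f)"
    unfolding endo_trace_def times_endo.rep_eq by (subst endo_expand[OF assms(1) assms(2)]) simp_all
  finally show ?thesis .
qed

locale finite_group = group +
  assumes fin: "finite (carrier G)"
begin

text \<open>
  The product of the group ring over an arbitrary commutative ring, with the convention that
  coefficients outside the carrier are \<open>0\<close>.
\<close>

definition conv :: "('a \<Rightarrow> 'c::comm_ring_1) \<Rightarrow> ('a \<Rightarrow> 'c) \<Rightarrow> 'a \<Rightarrow> 'c"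
  where "conv a b x = (if x \<in> carrier G then \<Sum>g\<in>carrier G. a g * b (inv g \<otimes> x) else 0)"

lemma int_group_ring_mult_eq_conv: "a \<otimes>\<^bsub>int_group_ring G\<^esub> b = conv a b"
  by (rule ext) (simp add: conv_def int_group_ring_mult int_group_ring_mult_outside fin)

lemma sum_translate_left: "g \<in> carrier G \<Longrightarrow> (\<Sum>x\<in>carrier G. F (g \<otimes> x)) = (\<Sum>x\<in>carrier G. F x)"
  by (rule sum.reindex_bij_witness[where i = "\<lambda>x. inv g \<otimes> x" and j = "\<lambda>x. g \<otimes> x"])
     (simp_all add: m_assoc[symmetric])

lemma sum_translate_right: "g \<in> carrier G \<Longrightarrow> (\<Sum>x\<in>carrier G. F (x \<otimes> g)) = (\<Sum>x\<in>carrier G. F x)"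
  by (rule sum.reindex_bij_witness[where i = "\<lambda>x. x \<otimes> inv g" and j = "\<lambda>x. x \<otimes> g"])
     (simp_all add: m_assoc)

lemma sum_conv:
  "(\<Sum>x\<in>carrier G. conv a b x * F x) = (\<Sum>g\<in>carrier G. \<Sum>h\<in>carrier G. a g * b h * F (g \<otimes> h))"
proof -
  have "(\<Sum>x\<in>carrier G. conv a b x * F x) =
      (\<Sum>x\<in>carrier G. \<Sum>g\<in>carrier G. a g * b (inv g \<otimes> x) * F x)"
    by (simp add: conv_def sum_distrib_right)
  also have "\<dots> = (\<Sum>g\<in>carrier G. \<Sum>x\<in>carrier G. a g * b (inv g \<otimes> x) * F x)"
    by (rule sum.swap)
  also have "\<dots> = (\<Sum>g\<in>carrier G. \<Sum>h\<in>carrier G. a g * b h * F (g \<otimes> h))"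
  proof (rule sum.cong[OF refl])
    fix g assume g: "g \<in> carrier G"
    have "(\<Sum>x\<in>carrier G. a g * b (inv g \<otimes> x) * F x) =
        (\<Sum>x\<in>carrier G. a g * b (inv g \<otimes> (g \<otimes> x)) * F (g \<otimes> x))"
      by (rule sum_translate_left[OF g, symmetric])
    also have "\<dots> = (\<Sum>h\<in>carrier G. a g * b h * F (g \<otimes> h))"
      by (rule sum.cong) (simp_all add: g m_assoc[symmetric])
    finally show "(\<Sum>x\<in>carrier G. a g * b (inv g \<otimes> x) * F x) = (\<Sum>h\<in>carrier G. a g * b h * F (g \<otimes> h))" .
  qed
  finally show ?thesis .
qed

text \<open>
  A transversal of the left cosets of \<open>\<langle>z\<rangle>\<close>. In the form of the second condition it shows that \<open>\<int>G\<close> is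
  free over \<open>\<langle>z\<rangle>\<close>: the restrictions of functions to the translates of \<open>T\<close> sum to the identity.
\<close>

lemma transversal_of_cyclic_subgroup:
  assumes z: "z \<in> carrier G"
  obtains T where "T \<subseteq> carrier G"
    "\<And>x. x \<in> carrier G \<Longrightarrow> (\<Sum>i < ord z. of_bool (x \<otimes> z [^] i \<in> T)) = (1::int)"
proof -
  define C where "C x = range (\<lambda>i::int. x \<otimes> z [^] i)" for x
  define r where "r x = (SOME t. t \<in> C x)" for x
  define T where "T = {x \<in> carrier G. r x = x}"
  have ord: "ord z > 0"
    using ord_ge_1[OF fin z] by simp
  have C_shift: "C (x \<otimes> z [^] i) = C x" if x: "x \<in> carrier G" for x and i :: int
  proof -
    have "x \<otimes> z [^] j = x \<otimes> z [^] i \<otimes> z [^] (j - i)" for j :: int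
      using x z by (simp add: m_assoc flip: int_pow_mult)
    moreover have "x \<otimes> z [^] i \<otimes> z [^] j = x \<otimes> z [^] (i + j)" for j :: int
      using x z by (simp add: m_assoc int_pow_mult)
    ultimately have "x \<otimes> z [^] j \<in> C (x \<otimes> z [^] i)" "x \<otimes> z [^] i \<otimes> z [^] j \<in> C x" for j :: int
      unfolding C_def by (metis rangeI)+
    then show ?thesis
      unfolding C_def by blast
  qed
  have "(\<Sum>i < ord z. of_bool (x \<otimes> z [^] i \<in> T)) = (1::int)" if x: "x \<in> carrier G" for x
  proof -
    have "x \<otimes> z [^] (0::int) \<in> C x"
      unfolding C_def by blast
    then have "r x \<in> C x"
      unfolding r_def by (rule someI)
    then obtain i :: int where i: "r x = x \<otimes> z [^] i"
      by (auto simp: C_def)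
    define n where "n = nat (i mod int (ord z))"
    have n: "n < ord z" "int n = i mod int (ord z)"
      using ord by (simp_all add: n_def nat_less_iff)
    have "z [^] i = z [^] int n"
      using mod_mod_trivial[of i "int (ord z)"] unfolding mod_eq_dvd_iff n(2) int_pow_eq[OF z] .
    then have rx: "r x = x \<otimes> z [^] n"
      by (simp add: i int_pow_int)
    have r_shift: "r (x \<otimes> z [^] k) = r x" for k :: nat
      using C_shift[OF x, of "int k"] by (simp add: r_def int_pow_int)
    have T_iff: "x \<otimes> z [^] k \<in> T \<longleftrightarrow> k = n" if k: "k < ord z" for k
    proof -
      have "x \<otimes> z [^] k \<in> T \<longleftrightarrow> z [^] n = z [^] k"
        unfolding T_def mem_Collect_eq r_shift rx using x z by simp
      also have "\<dots> \<longleftrightarrow> k = n"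
      proof
        assume "z [^] n = z [^] k"
        then have "n = k"
          using k n(1) by (intro inj_onD[OF ord_inj[OF z]]) simp_all
        then show "k = n"
          by simp
      qed simp
      finally show ?thesis .
    qed
    have "(\<Sum>k < ord z. of_bool (x \<otimes> z [^] k \<in> T)) = (\<Sum>k < ord z. of_bool (k = n) :: int)"
      by (rule sum.cong[OF refl]) (simp only: T_iff lessThan_iff)
    also have "\<dots> = 1"
      using n(1) by (simp add: sum.remove[of _ n])
    finally show ?thesis .
  qed
  moreover have "T \<subseteq> carrier G"
    unfolding T_def by blast
  ultimately show thesis
    using that by blast
qed

text \<open>
  The function \<open>U 1\<close> stands for a unit \<open>u\<close> of \<open>\<int>G\<close> with \<open>u\<^sup>p = 1\<close>, and \<open>U i\<close> for its powers. The sum is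
  the order of the centralizer of \<open>y\<close> times the partial augmentation of \<open>u\<close> at \<open>y\<close>, and also the trace of
  \<open>v \<mapsto> u v y\<^sup>-\<^sup>1\<close> on \<open>\<int>G\<close>. The \<open>p\<close>-th power of this map is the multiplication by \<open>z\<^sup>-\<^sup>1\<close>, where
  \<open>z = y\<^sup>p\<close> has the order \<open>q = p ^ (j - 1)\<close>, divisible by \<open>p\<close> as \<open>j \<ge> 2\<close>. The restriction of functions to a
  transversal of \<open>\<langle>z\<rangle>\<close> has conjugates that sum to the identity, as \<open>trace_zero_of_lifted_cyclic_family\<close>
  demands.
\<close>

lemma class_sum_zero_of_larger_order:
  fixes U :: "int \<Rightarrow> 'a \<Rightarrow> int"
  assumes p: "Factorial_Ring.prime p"
    and U_0: "U 0 = (\<lambda>x. of_bool (x = \<one>))"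
    and U_add: "\<And>i j. conv (U i) (U j) = U (i + j)"
    and U_p: "\<And>i. U (i + int p) = U i"
    and y: "y \<in> carrier G" and ord_y: "ord y = p ^ j" "j \<ge> 2"
  shows "(\<Sum>x\<in>carrier G. U 1 (x \<otimes> y \<otimes> inv x)) = 0"
proof -
  define q where "q = p ^ (j - 1)"
  have q: "p * q = p ^ j" "p dvd q"
    using ord_y(2) by (simp_all add: q_def flip: power_Suc)
  \<comment> \<open>The map \<open>v \<mapsto> u\<^sup>i v y\<^sup>-\<^sup>i\<close>, followed by the restriction to \<open>G\<close>.\<close>
  define F where "F i v x = (if x \<in> carrier G then \<Sum>g\<in>carrier G. U i g * v (inv g \<otimes> x \<otimes> y [^] i) else 0)"
    for i :: int and v :: "'a \<Rightarrow> int" and x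
  define S where "S i = Endo (F i)" for i
  have S: "apply_endo (S i) = F i" for i
    unfolding S_def by (rule Endo_inverse) (simp add: F_def fun_eq_iff algebra_simps sum.distrib)
  have F_0: "F 0 v x = of_bool (x \<in> carrier G) * v x" for v x
    by (simp add: F_def U_0 fin y)
  have U_per: "U (i + int p * n) = U i" for i n
  proof (induction n rule: int_induct[where k = 0])
    case (step1 n)
    then show ?case
      using U_p[of "i + int p * n"] by (simp add: algebra_simps)
  next
    case (step2 n)
    then show ?case
      using U_p[of "i + int p * (n - 1)"] by (simp add: algebra_simps)
  qed simp
  have F_p: "F (int p * i) v x = of_bool (x \<in> carrier G) * v (x \<otimes> y [^] (int p * i))" for i v x
    using U_per[of 0 i] by (simp add: F_def U_0 fin y)
  have S_add: "S i * S j = S (i + j)" for i j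
  proof -
    have "F i (F j v) x = F (i + j) v x" for v x
    proof (cases "x \<in> carrier G")
      case x: True
      have "F i (F j v) x =
          (\<Sum>g\<in>carrier G. \<Sum>h\<in>carrier G. U i g * U j h * v (inv (g \<otimes> h) \<otimes> x \<otimes> y [^] (i + j)))"
        using x y by (simp add: F_def sum_distrib_left mult.assoc inv_mult_group m_assoc int_pow_mult)
      also have "\<dots> = (\<Sum>k\<in>carrier G. conv (U i) (U j) k * v (inv k \<otimes> x \<otimes> y [^] (i + j)))"
        by (rule sum_conv[symmetric])
      finally show ?thesis
        using x by (simp add: F_def U_add)
    qed (simp add: F_def)
    then show ?thesis
      by (simp add: apply_endo_inject[symmetric] times_endo.rep_eq S fun_eq_iff)
  qed
  have S_per: "S (i + int (p * q)) = S i" for i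
  proof -
    have "y [^] (i + int (p * q)) = y [^] i"
      using y by (simp add: int_pow_eq ord_y q(1) del: of_nat_mult)
    moreover have "U (i + int (p * q)) = U i"
      using U_per[of i "int q"] by simp
    ultimately have "F (i + int (p * q)) = F i"
      by (intro ext) (simp only: F_def)
    then show ?thesis
      by (simp only: S_def)
  qed
  define z where "z = y [^] p"
  have z: "z \<in> carrier G"
    using y by (simp add: z_def)
  have "ord z = q"
  proof -
    have "p \<noteq> 0" "p dvd p ^ j"
      using p ord_y(2) by auto
    then show ?thesis
      using y q(1) by (metis nonzero_mult_div_cancel_left ord_pow ord_y(1) z_def)
  qed
  obtain T where T: "T \<subseteq> carrier G"
    "\<And>x. x \<in> carrier G \<Longrightarrow> (\<Sum>i<q. of_bool (x \<otimes> z [^] i \<in> T)) = (1::int)"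
    using transversal_of_cyclic_subgroup[OF z] \<open>ord z = q\<close> by metis
  define D where "D = Endo (\<lambda>v x. of_bool (x \<in> T) * v x)"
  have D: "apply_endo D = (\<lambda>v x. of_bool (x \<in> T) * v x)"
    unfolding D_def by (rule Endo_inverse) (simp add: fun_eq_iff algebra_simps)
  have corner: "apply_endo f v i = 0" if "S 0 * f = f" "i \<notin> carrier G" for f v i
  proof -
    have "apply_endo f v i = apply_endo (S 0 * f) v i"
      using that by simp
    then show ?thesis
      using that(2) by (simp add: times_endo.rep_eq S F_0)
  qed
  have "endo_trace (carrier G) (S 1) = 0"
  proof (rule trace_zero_of_lifted_cyclic_family[OF p q S_add S_per])
    show "S 0 * D = D" "D * S 0 = D"
      using T(1) by (auto simp: apply_endo_inject[symmetric] times_endo.rep_eq S F_0 D fun_eq_iff)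
    show "(\<Sum>i<q. S (int (p * i)) * D * S (- int (p * i))) = S 0"
    proof -
      have "apply_endo (S (int (p * i)) * D * S (- int (p * i))) v x =
          of_bool (x \<otimes> z [^] i \<in> T) * apply_endo (S 0) v x" for i v x
      proof (cases "x \<in> carrier G")
        case x: True
        have yz: "y [^] (int p * int i) = z [^] i"
          using int_pow_int[of G y "p * i"] y by (simp add: z_def nat_pow_pow)
        have "apply_endo (S (int (p * i)) * D * S (- int (p * i))) v x =
            of_bool (x \<otimes> z [^] i \<in> T) * F (int p * (- int i)) v (x \<otimes> z [^] i)"
          using x by (simp add: times_endo.rep_eq S D F_p yz)
        also have "F (int p * (- int i)) v (x \<otimes> z [^] i) = v x"
        proof -
          have "x \<otimes> z [^] i \<otimes> y [^] (int p * (- int i)) = x"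
            using x y z yz[symmetric] by (simp add: m_assoc flip: int_pow_mult)
          then show ?thesis
            unfolding F_p using x z by simp
        qed
        finally show ?thesis
          using x by (simp add: S F_0)
      qed (simp add: times_endo.rep_eq S D F_p F_0)
      note summand = this
      have sum: "apply_endo (\<Sum>i<n. f i) v x = (\<Sum>i<n. apply_endo (f i) v x)" for f v x and n :: nat
        by (induction n) (simp_all add: zero_endo.rep_eq plus_endo.rep_eq)
      have "apply_endo (\<Sum>i<q. S (int (p * i)) * D * S (- int (p * i))) v x = apply_endo (S 0) v x" for v x
      proof -
        have "apply_endo (\<Sum>i<q. S (int (p * i)) * D * S (- int (p * i))) v x =
            (\<Sum>i<q. of_bool (x \<otimes> z [^] i \<in> T)) * apply_endo (S 0) v x"
          by (simp only: sum summand sum_distrib_right)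
        then show ?thesis
          using T(2)[of x] by (cases "x \<in> carrier G") (simp_all add: S F_0)
      qed
      then show ?thesis
        by (simp add: apply_endo_inject[symmetric] fun_eq_iff)
    qed
    show "\<not> int (p ^ j) dvd 1"
      using p ord_y(2) by (auto simp: prime_nat_iff)
    show "endo_trace (carrier G) (x * y) = endo_trace (carrier G) (y * x)"
      if "S 0 * x = x" "S 0 * y = y" for x y
      using that by (intro endo_trace_commute[OF fin] corner)
  qed (simp add: endo_trace_add)
  also have "endo_trace (carrier G) (S 1) = (\<Sum>x\<in>carrier G. U 1 (x \<otimes> y \<otimes> inv x))"
  proof -
    have "F 1 (\<lambda>i. of_bool (i = x)) x = U 1 (x \<otimes> y \<otimes> inv x)" if x: "x \<in> carrier G" for x
    proof -
      have "inv g \<otimes> x \<otimes> y = x \<longleftrightarrow> g = x \<otimes> y \<otimes> inv x" if "g \<in> carrier G" for g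
      proof -
        have "inv g \<otimes> x \<otimes> y = x \<longleftrightarrow> x \<otimes> y = g \<otimes> x"
          using that x y inv_solve_left[of x g "x \<otimes> y"] by (auto simp: m_assoc)
        also have "\<dots> \<longleftrightarrow> g = x \<otimes> y \<otimes> inv x"
          using that x y inv_solve_right[of g "x \<otimes> y" x] by auto
        finally show ?thesis .
      qed
      then have "F 1 (\<lambda>i. of_bool (i = x)) x = (\<Sum>g\<in>carrier G. U 1 g * of_bool (g = x \<otimes> y \<otimes> inv x))"
        using x y by (simp add: F_def)
      then show ?thesis
        using x y by (simp add: fin)
    qed
    then show ?thesis
      by (simp add: endo_trace_def S)
  qed
  finally show ?thesis .
qed

end

section \<open>Traces of complex matrices\<close>

definition mat_trace :: "'a::semiring_1 mat \<Rightarrow> 'a"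
  where "mat_trace A = (\<Sum>i<dim_row A. A $$ (i, i))"

lemma mult_mat_entry:
  assumes "A \<in> carrier_mat n n" "B \<in> carrier_mat n n" "i < n" "j < n"
  shows "(A * B) $$ (i, j) = (\<Sum>k<n. A $$ (i, k) * B $$ (k, j))"
  using assms by (simp add: scalar_prod_def atLeast0LessThan)

lemma mat_trace_mult_commute:
  fixes A B :: "'a::comm_semiring_1 mat"
  assumes "A \<in> carrier_mat n n" "B \<in> carrier_mat n n"
  shows "mat_trace (A * B) = mat_trace (B * A)"
proof -
  have "mat_trace (A * B) = (\<Sum>i<n. \<Sum>k<n. A $$ (i, k) * B $$ (k, i))"
    using assms by (simp add: mat_trace_def mult_mat_entry[of _ n] del: index_mult_mat(1))
  also have "\<dots> = (\<Sum>k<n. \<Sum>i<n. B $$ (k, i) * A $$ (i, k))"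
    by (subst sum.swap) (simp add: mult.commute)
  also have "\<dots> = mat_trace (B * A)"
    using assms by (simp add: mat_trace_def mult_mat_entry[of _ n] del: index_mult_mat(1))
  finally show ?thesis .
qed

text \<open>
  Schur triangularization, with the properties of a matrix that are invariant under similarity and
  from which the traces below are computed.
\<close>

lemma complex_mat_triangularize:
  fixes A :: "complex mat"
  assumes A: "A \<in> carrier_mat n n"
  obtains T where "T \<in> carrier_mat n n" "upper_triangular T"
    "mat_trace A = mat_trace T" "det A = det T"
    "\<And>k. A ^\<^sub>m k = A \<Longrightarrow> T ^\<^sub>m k = T" "\<And>k. A ^\<^sub>m k = 1\<^sub>m n \<longleftrightarrow> T ^\<^sub>m k = 1\<^sub>m n"
    "A = 1\<^sub>m n \<longleftrightarrow> T = 1\<^sub>m n"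
proof -
  obtain as where "char_poly A = (\<Prod>a\<leftarrow>as. [:- a, 1:])"
    using char_poly_factorized[OF A] by blast
  then obtain T where T: "T \<in> carrier_mat n n" "upper_triangular T" "similar_mat A T"
    using schur_decomposition_exists[OF A] by blast
  then obtain P Q where wit: "similar_mat_wit A T P Q"
    by (auto simp: similar_mat_def)
  note w = similar_mat_witD2[OF A wit]
  have "mat_trace A = mat_trace (P * (T * Q))"
    using w by (simp add: assoc_mult_mat)
  also have "\<dots> = mat_trace (T * Q * P)"
    using w by (intro mat_trace_mult_commute) auto
  also have "T * Q * P = T"
    using w by (simp add: assoc_mult_mat[of T n n Q n P n])
  finally have tr: "mat_trace A = mat_trace T" .
  have Ak: "A ^\<^sub>m k = P * T ^\<^sub>m k * Q" for k
    using similar_mat_witD2(3)[OF _ similar_mat_wit_pow[OF wit]] A by blast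
  have Tk: "T ^\<^sub>m k = Q * A ^\<^sub>m k * P" for k
    using similar_mat_witD2(3)[OF _ similar_mat_wit_sym[OF similar_mat_wit_pow[OF wit]]] T(1) by blast
  have T1: "T = Q * A * P"
    using Tk[of 1] T(1) A by simp
  show thesis
  proof (rule that[OF T(1,2) tr det_similar[OF T(3)]])
    show "T ^\<^sub>m k = T" if "A ^\<^sub>m k = A" for k
      using Tk[of k] T1 that by simp
    show "A ^\<^sub>m k = 1\<^sub>m n \<longleftrightarrow> T ^\<^sub>m k = 1\<^sub>m n" for k
      using Tk[of k] Ak[of k] w by auto
    show "A = 1\<^sub>m n \<longleftrightarrow> T = 1\<^sub>m n"
      using T1 w by auto
  qed
qed

lemma upper_triangular_mult:
  fixes S T :: "'a::semiring_1 mat"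
  assumes S: "S \<in> carrier_mat n n" "upper_triangular S" and T: "T \<in> carrier_mat n n" "upper_triangular T"
  shows "upper_triangular (S * T)" "i < n \<Longrightarrow> (S * T) $$ (i, i) = S $$ (i, i) * T $$ (i, i)"
proof -
  have zero: "S $$ (i, k) * T $$ (k, j) = 0" if "i < n" "k < n" "j \<le> i" "k \<noteq> i \<or> j < i" for i j k
  proof (cases "k < i")
    case True
    then show ?thesis
      using upper_triangularD[OF S(2), of k i] S(1) that by simp
  next
    case False
    then have "j < k"
      using that by linarith
    then show ?thesis
      using upper_triangularD[OF T(2), of j k] T(1) that by simp
  qed
  show "upper_triangular (S * T)"
  proof (rule upper_triangularI)
    fix i j assume "j < i" "i < dim_row (S * T)"
    then show "(S * T) $$ (i, j) = 0"
      using S(1) zero by (subst mult_mat_entry[OF S(1) T(1)]) (auto intro!: sum.neutral)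
  qed
  show "(S * T) $$ (i, i) = S $$ (i, i) * T $$ (i, i)" if "i < n"
  proof -
    have "(S * T) $$ (i, i) = (\<Sum>k\<in>{i}. S $$ (i, k) * T $$ (k, i))"
      unfolding mult_mat_entry[OF S(1) T(1) that that]
      by (rule sum.mono_neutral_right) (use that zero in auto)
    then show ?thesis
      by simp
  qed
qed

lemma upper_triangular_pow:
  fixes T :: "'a::semiring_1 mat"
  assumes T: "T \<in> carrier_mat n n" "upper_triangular T"
  shows "upper_triangular (T ^\<^sub>m k)" "i < n \<Longrightarrow> (T ^\<^sub>m k) $$ (i, i) = T $$ (i, i) ^ k"
proof -
  have "upper_triangular (T ^\<^sub>m k) \<and> (\<forall>i<n. (T ^\<^sub>m k) $$ (i, i) = T $$ (i, i) ^ k)"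
  proof (induction k)
    case (Suc k)
    have "T ^\<^sub>m k \<in> carrier_mat n n"
      using T(1) by (rule pow_carrier_mat)
    then show ?case
      using Suc upper_triangular_mult[OF _ _ T] by (simp add: power_commutes del: index_mult_mat(1))
  qed (use T in simp)
  then show "upper_triangular (T ^\<^sub>m k)" "i < n \<Longrightarrow> (T ^\<^sub>m k) $$ (i, i) = T $$ (i, i) ^ k"
    by simp_all
qed

lemma idempotent_trace_nat:
  fixes A :: "complex mat"
  assumes A: "A \<in> carrier_mat n n" and idem: "A * A = A"
  obtains k :: nat where "mat_trace A = of_nat k"
proof -
  obtain T where T: "T \<in> carrier_mat n n" "upper_triangular T"
    and tr: "mat_trace A = mat_trace T" and pow: "\<And>k. A ^\<^sub>m k = A \<Longrightarrow> T ^\<^sub>m k = T"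
    using complex_mat_triangularize[OF A] by metis
  have "A ^\<^sub>m 2 = A"
    using A idem by (simp add: numeral_2_eq_2)
  then have "T $$ (i, i) ^ 2 = T $$ (i, i)" if "i < n" for i
    using upper_triangular_pow(2)[OF T that, of 2] pow by simp
  then have diag: "T $$ (i, i) = of_bool (T $$ (i, i) \<noteq> 0)" if "i < n" for i
    using that by (force simp: power2_eq_square)
  have "mat_trace T = (\<Sum>i<n. of_nat (of_bool (T $$ (i, i) \<noteq> 0)))"
    unfolding mat_trace_def using T(1) diag by (intro sum.cong) auto
  then show thesis
    using that tr by (simp only: flip: of_nat_sum)
qed

text \<open>
  On the first superdiagonal that is not zero, the entries of \<open>T\<^sup>k\<close> are \<open>k\<close> times those of \<open>T\<close>, so they
  cannot vanish for \<open>k = m > 0\<close>.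
\<close>

lemma unitriangular_finite_order_eq_one:
  fixes T :: "complex mat"
  assumes T: "T \<in> carrier_mat n n" "upper_triangular T" and diag: "\<And>i. i < n \<Longrightarrow> T $$ (i, i) = 1"
    and m: "T ^\<^sub>m m = 1\<^sub>m n" "m > 0"
  shows "T = 1\<^sub>m n"
proof -
  have gap: "T $$ (i, i + d) = 0" if "d > 0" "i + d < n" for i d
    using that
  proof (induction d arbitrary: i rule: less_induct)
    case (less d)
    have "(T ^\<^sub>m k) $$ (i, i + e) = of_nat k * T $$ (i, i + e)" if "0 < e" "e \<le> d" "i + e < n" for i e k
      using that
    proof (induction k arbitrary: i e)
      case 0
      then show ?case
        using T(1) by simp
    next
      case (Suc k)
      have Tk: "T ^\<^sub>m k \<in> carrier_mat n n"
        using T(1) by (rule pow_carrier_mat)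
      have "(T ^\<^sub>m Suc k) $$ (i, i + e) = (\<Sum>l<n. (T ^\<^sub>m k) $$ (i, l) * T $$ (l, i + e))"
        using mult_mat_entry[OF Tk T(1)] Suc.prems by simp
      also have "\<dots> = (\<Sum>l\<in>{i, i + e}. (T ^\<^sub>m k) $$ (i, l) * T $$ (l, i + e))"
      proof (rule sum.mono_neutral_right)
        show "\<forall>l\<in>{..<n} - {i, i + e}. (T ^\<^sub>m k) $$ (i, l) * T $$ (l, i + e) = 0"
        proof
          fix l assume l: "l \<in> {..<n} - {i, i + e}"
          consider "l < i" | "i < l" "l < i + e" | "i + e < l"
            using l by fastforce
          then show "(T ^\<^sub>m k) $$ (i, l) * T $$ (l, i + e) = 0"
          proof cases
            case 1
            then show ?thesis
              using upper_triangularD[OF upper_triangular_pow(1)[OF T], of l i k] T(1) Suc.prems by simp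
          next
            case 2
            then show ?thesis
              using less.IH[of "i + e - l" l] Suc.prems by simp
          next
            case 3
            then show ?thesis
              using upper_triangularD[OF T(2), of "i + e" l] T(1) l by simp
          qed
        qed
      qed (use Suc.prems in auto)
      also have "\<dots> = T $$ (i, i + e) + of_nat k * T $$ (i, i + e)"
        using Suc.prems Suc.IH[of e i] upper_triangular_pow(2)[OF T, of i k] diag by simp
      finally show ?case
        by (simp only: of_nat_Suc distrib_right mult_1)
    qed
    \<comment> \<open>The entry of \<open>T\<^sup>m\<close> is zero as \<open>d > 0\<close>, and it is \<open>m\<close> times the entry of \<open>T\<close>.\<close>
    from this[of d i m] show ?case
      using less.prems m by simp
  qed
  show ?thesis
  proof (rule eq_matI)
    fix i j assume "i < dim_row (1\<^sub>m n :: complex mat)" "j < dim_col (1\<^sub>m n :: complex mat)"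
    then have ij: "i < n" "j < n"
      by simp_all
    then show "T $$ (i, j) = 1\<^sub>m n $$ (i, j)"
      using diag[of i] upper_triangularD[OF T(2), of j i] gap[of "j - i" i] T(1)
      by (cases i j rule: linorder_cases) simp_all
  qed (use T(1) in simp_all)
qed

text \<open>
  The trace is a sum of \<open>n\<close> roots of unity. It equals \<open>n\<close> only if all of them are \<open>1\<close>.
\<close>

lemma finite_order_trace:
  fixes A :: "complex mat"
  assumes A: "A \<in> carrier_mat n n" and m: "A ^\<^sub>m m = 1\<^sub>m n" "m > 0"
  shows "cmod (mat_trace A) \<le> of_nat n" "mat_trace A = of_nat n \<Longrightarrow> A = 1\<^sub>m n"
proof -
  obtain T where T: "T \<in> carrier_mat n n" "upper_triangular T"
    and tr: "mat_trace A = mat_trace T"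
    and pow: "\<And>k. A ^\<^sub>m k = 1\<^sub>m n \<longleftrightarrow> T ^\<^sub>m k = 1\<^sub>m n" and one: "A = 1\<^sub>m n \<longleftrightarrow> T = 1\<^sub>m n"
    using complex_mat_triangularize[OF A] by metis
  have Tm: "T ^\<^sub>m m = 1\<^sub>m n"
    using m pow by simp
  have norm_1: "cmod (T $$ (i, i)) = 1" if "i < n" for i
  proof -
    have "T $$ (i, i) ^ m = 1"
      using upper_triangular_pow(2)[OF T that, of m] Tm that by simp
    then have "cmod (T $$ (i, i)) ^ m = 1"
      by (metis norm_one norm_power)
    then show ?thesis
      using power_eq_imp_eq_base[of "cmod (T $$ (i, i))" m 1] m(2) by simp
  qed
  have tr_T: "mat_trace T = (\<Sum>i<n. T $$ (i, i))"
    using T(1) by (simp add: mat_trace_def)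
  have "cmod (mat_trace T) \<le> (\<Sum>i<n. cmod (T $$ (i, i)))"
    unfolding tr_T by (rule norm_sum)
  also have "\<dots> = of_nat n"
    using norm_1 by simp
  finally show "cmod (mat_trace A) \<le> of_nat n"
    by (simp add: tr)
  assume "mat_trace A = of_nat n"
  then have "(\<Sum>i<n. 1 - Re (T $$ (i, i))) = 0"
    by (simp add: tr tr_T sum_subtractf flip: Re_sum)
  moreover have Re_le: "Re (T $$ (i, i)) \<le> 1" if "i < n" for i
    using norm_1[OF that] complex_Re_le_cmod[of "T $$ (i, i)"] by simp
  ultimately have Re_1: "Re (T $$ (i, i)) = 1" if "i < n" for i
    using that by (subst (asm) sum_nonneg_eq_0_iff) auto
  have "T $$ (i, i) = 1" if "i < n" for i
  proof -
    have "(Re (T $$ (i, i)))\<^sup>2 + (Im (T $$ (i, i)))\<^sup>2 = 1"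
      using norm_1[OF that] cmod_power2[of "T $$ (i, i)"] by simp
    then show ?thesis
      using Re_1[OF that] by (simp add: complex_eq_iff)
  qed
  then have "T = 1\<^sub>m n"
    using unitriangular_finite_order_eq_one[OF T] Tm m(2) by simp
  then show "A = 1\<^sub>m n"
    using one by simp
qed

text \<open>
  The eigenvalue \<open>-1\<close> has even multiplicity \<open>2 k\<close>, as the determinant is \<open>1\<close>.
\<close>

lemma involution_trace_of_det_one:
  fixes A :: "complex mat"
  assumes A: "A \<in> carrier_mat n n" and "A * A = 1\<^sub>m n" "det A = 1"
  obtains k :: nat where "mat_trace A = of_nat n - 4 * of_nat k"
proof -
  obtain T where T: "T \<in> carrier_mat n n" "upper_triangular T"
    and tr: "mat_trace A = mat_trace T" and det: "det A = det T"
    and pow: "\<And>k. A ^\<^sub>m k = 1\<^sub>m n \<longleftrightarrow> T ^\<^sub>m k = 1\<^sub>m n"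
    using complex_mat_triangularize[OF A] by metis
  have "A ^\<^sub>m 2 = 1\<^sub>m n"
    using A assms(2) by (simp add: numeral_2_eq_2)
  then have T2: "T ^\<^sub>m 2 = 1\<^sub>m n"
    using pow by simp
  define I where "I = {i. i < n \<and> T $$ (i, i) = - 1}"
  have diag: "T $$ (i, i) = (if i \<in> I then - 1 else 1)" if "i < n" for i
  proof -
    have "T $$ (i, i) ^ 2 = 1"
      using upper_triangular_pow(2)[OF T that, of 2] T2 that by simp
    then show ?thesis
      using that by (auto simp: I_def power2_eq_1_iff)
  qed
  have "det T = (\<Prod>i<n. T $$ (i, i))"
    using det_upper_triangular[OF T(2,1)] T(1) by (simp add: prod_list_diag_prod atLeast0LessThan)
  also have "\<dots> = (\<Prod>i<n. if i \<in> I then - 1 else 1)"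
    by (rule prod.cong) (simp_all add: diag)
  also have "\<dots> = (- 1) ^ card I"
    by (subst prod.If_cases) (auto simp: I_def Int_def intro!: arg_cong[of _ _ card])
  finally have "(- 1 :: complex) ^ card I = 1"
    using det assms(3) by simp
  then have "even (card I)"
    by (metis neg_one_odd_power one_neq_neg_one)
  then obtain k where k: "card I = 2 * k"
    by (elim evenE)
  have "mat_trace T = (\<Sum>i<n. 1 - 2 * of_bool (i \<in> I))"
    using T(1) diag unfolding mat_trace_def by (intro sum.cong) auto
  also have "\<dots> = of_nat n - 2 * of_nat (card ({..<n} \<inter> I))"
    by (simp add: sum_subtractf flip: sum_distrib_left)
  also have "{..<n} \<inter> I = I"
    by (auto simp: I_def)
  finally show thesis
    using that[of k] tr k by simp
qed

lemma pow_mat_add: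
  fixes A :: "'a::semiring_1 mat"
  assumes "A \<in> carrier_mat n n"
  shows "A ^\<^sub>m (k + l) = A ^\<^sub>m k * A ^\<^sub>m l"
proof (induction l)
  case (Suc l)
  have "A ^\<^sub>m k \<in> carrier_mat n n" "A ^\<^sub>m l \<in> carrier_mat n n"
    using assms by simp_all
  then show ?case
    using Suc assms by (simp add: assoc_mult_mat[of _ n n _ n _ n])
qed (use assms in \<open>simp add: right_mult_one_mat[of _ n n]\<close>)

lemma uminus_mat_even_pow:
  fixes A :: "'a::comm_ring_1 mat"
  assumes "A \<in> carrier_mat n n"
  shows "(- A) ^\<^sub>m (2 * k) = A ^\<^sub>m (2 * k)"
proof (induction k)
  case (Suc k)
  have Ak: "A ^\<^sub>m (2 * k) \<in> carrier_mat n n"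
    using assms by (rule pow_carrier_mat)
  have "(- A) ^\<^sub>m (2 * Suc k) = A ^\<^sub>m (2 * k) * - A * - A"
    using Suc by simp
  also have "\<dots> = A ^\<^sub>m (2 * k) * A * A"
    using assms Ak by simp
  finally show ?case
    by simp
qed (use assms in simp)

lemma finite_order_trace_minus:
  fixes A :: "complex mat"
  assumes A: "A \<in> carrier_mat n n" and m: "A ^\<^sub>m m = 1\<^sub>m n" "m > 0" and tr: "mat_trace A = - of_nat n"
  shows "A = - 1\<^sub>m n"
proof -
  have "A ^\<^sub>m (m * 2) = 1\<^sub>m n"
    using A m(1) pow_mat_add[OF A, of m m] by (simp add: mult_2_right)
  then have "(- A) ^\<^sub>m (2 * m) = 1\<^sub>m n"
    using uminus_mat_even_pow[OF A, of m] by (simp add: mult.commute)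
  moreover have "mat_trace (- A) = of_nat n"
    using A tr by (simp add: mat_trace_def sum_negf)
  ultimately have "- A = 1\<^sub>m n"
    using finite_order_trace(2)[of "- A" n "2 * m"] A m(2) by simp
  then show ?thesis
    using uminus_uminus_mat[of A] by simp
qed

section \<open>The regular representations\<close>

context finite_group
begin

lemma inv_cancel_left: "x \<in> carrier G \<Longrightarrow> g \<in> carrier G \<Longrightarrow> inv x \<otimes> (x \<otimes> g) = g"
  by (simp add: m_assoc[symmetric])

text \<open>
  A numbering of the group, since matrices are indexed by natural numbers.
\<close>

definition idx :: "nat \<Rightarrow> 'a"
  where "idx = (SOME f. bij_betw f {..<card (carrier G)} (carrier G))"

lemma bij_idx: "bij_betw idx {..<card (carrier G)} (carrier G)"
proof -
  have "\<exists>f. bij_betw f {..<card (carrier G)} (carrier G)"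
    using ex_bij_betw_nat_finite[OF fin] by (simp add: atLeast0LessThan)
  then show ?thesis
    unfolding idx_def by (rule someI_ex)
qed

lemma idx_carrier: "i < card (carrier G) \<Longrightarrow> idx i \<in> carrier G"
  using bij_idx by (auto simp: bij_betw_def)

lemma idx_eq_iff: "i < card (carrier G) \<Longrightarrow> j < card (carrier G) \<Longrightarrow> idx i = idx j \<longleftrightarrow> i = j"
  using bij_idx by (auto simp: bij_betw_def inj_on_def)

lemma sum_idx: "(\<Sum>i < card (carrier G). F (idx i)) = (\<Sum>g\<in>carrier G. F g)"
  by (rule sum.reindex_bij_betw[OF bij_idx])

text \<open>
  The matrices of \<open>v \<mapsto> a v\<close> and, below, of \<open>v \<mapsto> v a\<close> with respect to the basis \<open>G\<close> of the group ring.
\<close>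

definition lmat :: "('a \<Rightarrow> 'c) \<Rightarrow> 'c mat"
  where "lmat a = mat (card (carrier G)) (card (carrier G)) (\<lambda>(i, j). a (idx i \<otimes> inv (idx j)))"

definition rmat :: "('a \<Rightarrow> 'c) \<Rightarrow> 'c mat"
  where "rmat a = mat (card (carrier G)) (card (carrier G)) (\<lambda>(i, j). a (inv (idx j) \<otimes> idx i))"

definition delta :: "'a \<Rightarrow> 'c::comm_ring_1"
  where "delta x = of_bool (x = \<one>)"

lemma lmat_carrier: "lmat a \<in> carrier_mat (card (carrier G)) (card (carrier G))"
  by (simp add: lmat_def)

lemma lmat_dim: "dim_row (lmat a) = card (carrier G)"
  by (simp add: lmat_def)

lemma rmat_carrier: "rmat a \<in> carrier_mat (card (carrier G)) (card (carrier G))"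
  by (simp add: rmat_def)

lemma lmat_delta: "lmat delta = 1\<^sub>m (card (carrier G))"
proof (rule eq_matI)
  fix i j assume "i < dim_row (1\<^sub>m (card (carrier G)) :: 'c mat)" "j < dim_col (1\<^sub>m (card (carrier G)) :: 'c mat)"
  then have ij: "i < card (carrier G)" "j < card (carrier G)"
    by simp_all
  have "idx i \<otimes> inv (idx j) = \<one> \<longleftrightarrow> i = j"
    using ij idx_carrier inv_solve_right'[of \<one> "idx i" "idx j"] idx_eq_iff by auto
  then show "(lmat delta :: 'c mat) $$ (i, j) = 1\<^sub>m (card (carrier G)) $$ (i, j)"
    using ij by (simp add: lmat_def delta_def)
qed (simp_all add: lmat_def)

lemma rmat_delta: "rmat delta = 1\<^sub>m (card (carrier G))"
proof (rule eq_matI)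
  fix i j assume "i < dim_row (1\<^sub>m (card (carrier G)) :: 'c mat)" "j < dim_col (1\<^sub>m (card (carrier G)) :: 'c mat)"
  then have ij: "i < card (carrier G)" "j < card (carrier G)"
    by simp_all
  have "inv (idx j) \<otimes> idx i = \<one> \<longleftrightarrow> i = j"
    using ij idx_carrier inv_solve_left'[of \<one> "idx j" "idx i"] idx_eq_iff by auto
  then show "(rmat delta :: 'c mat) $$ (i, j) = 1\<^sub>m (card (carrier G)) $$ (i, j)"
    using ij by (simp add: rmat_def delta_def)
qed (simp_all add: rmat_def)

lemma sum_left_quotient:
  assumes x: "x \<in> carrier G"
  shows "(\<Sum>g\<in>carrier G. F (x \<otimes> inv g) g) = (\<Sum>h\<in>carrier G. F h (inv h \<otimes> x))"
  by (rule sum.reindex_bij_witness[where i = "\<lambda>h. inv h \<otimes> x" and j = "\<lambda>g. x \<otimes> inv g"])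
     (use x in \<open>simp_all add: inv_mult_group m_assoc\<close>, simp_all add: m_assoc[symmetric])

lemma lmat_mult: "lmat a * lmat b = (lmat (conv a b) :: 'c::comm_ring_1 mat)"
proof (rule eq_matI)
  fix i j assume "i < dim_row (lmat (conv a b))" "j < dim_col (lmat (conv a b))"
  then have ij: "i < card (carrier G)" "j < card (carrier G)"
    by (simp_all add: lmat_def)
  note x = idx_carrier[OF ij(1)] idx_carrier[OF ij(2)]
  have "(lmat a * lmat b) $$ (i, j) =
      (\<Sum>k < card (carrier G). a (idx i \<otimes> inv (idx k)) * b (idx k \<otimes> inv (idx j)))"
    unfolding mult_mat_entry[OF lmat_carrier lmat_carrier ij] using ij by (simp add: lmat_def)
  also have "\<dots> = (\<Sum>g\<in>carrier G. a (idx i \<otimes> inv g) * b (g \<otimes> inv (idx j)))"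
    by (rule sum_idx)
  also have "\<dots> = (\<Sum>h\<in>carrier G. a h * b (inv h \<otimes> idx i \<otimes> inv (idx j)))"
    by (rule sum_left_quotient[OF x(1)])
  also have "\<dots> = conv a b (idx i \<otimes> inv (idx j))"
    using x by (simp add: conv_def m_assoc)
  finally show "(lmat a * lmat b) $$ (i, j) = lmat (conv a b) $$ (i, j)"
    using ij by (simp add: lmat_def)
qed (simp_all add: lmat_def)

lemma rmat_mult: "rmat a * rmat b = (rmat (conv b a) :: 'c::comm_ring_1 mat)"
proof (rule eq_matI)
  fix i j assume "i < dim_row (rmat (conv b a))" "j < dim_col (rmat (conv b a))"
  then have ij: "i < card (carrier G)" "j < card (carrier G)"
    by (simp_all add: rmat_def)
  note x = idx_carrier[OF ij(1)] idx_carrier[OF ij(2)]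
  have "(rmat a * rmat b) $$ (i, j) =
      (\<Sum>k < card (carrier G). a (inv (idx k) \<otimes> idx i) * b (inv (idx j) \<otimes> idx k))"
    unfolding mult_mat_entry[OF rmat_carrier rmat_carrier ij] using ij by (simp add: rmat_def)
  also have "\<dots> = (\<Sum>g\<in>carrier G. a (inv g \<otimes> idx i) * b (inv (idx j) \<otimes> g))"
    by (rule sum_idx)
  also have "\<dots> = (\<Sum>g\<in>carrier G. a (inv (idx j \<otimes> g) \<otimes> idx i) * b (inv (idx j) \<otimes> (idx j \<otimes> g)))"
    by (rule sum_translate_left[OF x(2), symmetric])
  also have "\<dots> = conv b a (inv (idx j) \<otimes> idx i)"
    using x by (simp add: conv_def inv_mult_group inv_cancel_left m_assoc mult.commute)
  finally show "(rmat a * rmat b) $$ (i, j) = rmat (conv b a) $$ (i, j)"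
    using ij by (simp add: rmat_def)
qed (simp_all add: rmat_def)

lemma lmat_rmat_commute: "lmat a * rmat b = (rmat b * lmat a :: 'c::comm_ring_1 mat)"
proof (rule eq_matI)
  fix i j assume "i < dim_row (rmat b * lmat a)" "j < dim_col (rmat b * lmat a)"
  then have ij: "i < card (carrier G)" "j < card (carrier G)"
    by (simp_all add: rmat_def lmat_def)
  note x = idx_carrier[OF ij(1)] idx_carrier[OF ij(2)]
  have "(lmat a * rmat b) $$ (i, j) =
      (\<Sum>k < card (carrier G). a (idx i \<otimes> inv (idx k)) * b (inv (idx j) \<otimes> idx k))"
    unfolding mult_mat_entry[OF lmat_carrier rmat_carrier ij] using ij by (simp add: rmat_def lmat_def)
  also have "\<dots> = (\<Sum>g\<in>carrier G. a (idx i \<otimes> inv g) * b (inv (idx j) \<otimes> g))"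
    by (rule sum_idx)
  also have "\<dots> = (\<Sum>h\<in>carrier G. a h * b (inv (idx j) \<otimes> (inv h \<otimes> idx i)))"
    by (rule sum_left_quotient[OF x(1)])
  finally have *: "(lmat a * rmat b) $$ (i, j) = (\<Sum>h\<in>carrier G. a h * b (inv (idx j) \<otimes> (inv h \<otimes> idx i)))" .
  have "(rmat b * lmat a) $$ (i, j) =
      (\<Sum>k < card (carrier G). b (inv (idx k) \<otimes> idx i) * a (idx k \<otimes> inv (idx j)))"
    unfolding mult_mat_entry[OF rmat_carrier lmat_carrier ij] using ij by (simp add: rmat_def lmat_def)
  also have "\<dots> = (\<Sum>g\<in>carrier G. b (inv g \<otimes> idx i) * a (g \<otimes> inv (idx j)))"
    by (rule sum_idx)
  also have "\<dots> = (\<Sum>g\<in>carrier G. b (inv (g \<otimes> idx j) \<otimes> idx i) * a (g \<otimes> idx j \<otimes> inv (idx j)))"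
    by (rule sum_translate_right[OF x(2), symmetric])
  also have "\<dots> = (\<Sum>h\<in>carrier G. a h * b (inv (idx j) \<otimes> (inv h \<otimes> idx i)))"
    using x by (simp add: inv_mult_group m_assoc mult.commute)
  finally show "(lmat a * rmat b) $$ (i, j) = (rmat b * lmat a) $$ (i, j)"
    using * by simp
qed (simp_all add: rmat_def lmat_def)

text \<open>
  For an idempotent \<open>b\<close> over \<open>\<complex>\<close>, this trace is the value at \<open>a\<close> of the character of the left module
  \<open>\<complex>G b\<close>. It depends on the sums of \<open>a\<close> over the conjugacy classes of \<open>G\<close> only.
\<close>

lemma trace_lmat_rmat:
  fixes a b :: "'a \<Rightarrow> 'c::comm_ring_1"
  shows "mat_trace (lmat a * rmat b) = (\<Sum>y\<in>carrier G. b y * (\<Sum>x\<in>carrier G. a (x \<otimes> inv y \<otimes> inv x)))"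
proof -
  have entry: "(lmat a * rmat b) $$ (i, i) = (\<Sum>y\<in>carrier G. b y * a (idx i \<otimes> inv y \<otimes> inv (idx i)))"
    if i: "i < card (carrier G)" for i
  proof -
    note x = idx_carrier[OF i]
    have "(lmat a * rmat b) $$ (i, i) =
        (\<Sum>k < card (carrier G). a (idx i \<otimes> inv (idx k)) * b (inv (idx i) \<otimes> idx k))"
      unfolding mult_mat_entry[OF lmat_carrier rmat_carrier i i] using i by (simp add: rmat_def lmat_def)
    also have "\<dots> = (\<Sum>g\<in>carrier G. a (idx i \<otimes> inv g) * b (inv (idx i) \<otimes> g))"
      by (rule sum_idx)
    also have "\<dots> = (\<Sum>y\<in>carrier G. a (idx i \<otimes> inv (idx i \<otimes> y)) * b (inv (idx i) \<otimes> (idx i \<otimes> y)))"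
      by (rule sum_translate_left[OF x, symmetric])
    also have "\<dots> = (\<Sum>y\<in>carrier G. b y * a (idx i \<otimes> inv y \<otimes> inv (idx i)))"
      using x by (simp add: inv_mult_group inv_cancel_left m_assoc mult.commute)
    finally show ?thesis .
  qed
  have "mat_trace (lmat a * rmat b) = (\<Sum>i < card (carrier G). \<Sum>y\<in>carrier G. b y * a (idx i \<otimes> inv y \<otimes> inv (idx i)))"
    unfolding mat_trace_def by (rule sum.cong) (simp_all add: entry lmat_dim)
  also have "\<dots> = (\<Sum>x\<in>carrier G. \<Sum>y\<in>carrier G. b y * a (x \<otimes> inv y \<otimes> inv x))"
    by (rule sum_idx)
  also have "\<dots> = (\<Sum>y\<in>carrier G. b y * (\<Sum>x\<in>carrier G. a (x \<otimes> inv y \<otimes> inv x)))"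
    by (subst sum.swap) (simp add: sum_distrib_left)
  finally show ?thesis .
qed

lemma trace_lmat: "mat_trace (lmat a) = of_nat (card (carrier G)) * (a \<one> :: 'c::comm_ring_1)"
proof -
  have "mat_trace (lmat a) = (\<Sum>i < card (carrier G). a \<one>)"
    unfolding mat_trace_def by (rule sum.cong) (simp_all add: lmat_def idx_carrier)
  then show ?thesis
    by simp
qed

lemma trace_rmat: "mat_trace (rmat a) = of_nat (card (carrier G)) * (a \<one> :: 'c::comm_ring_1)"
proof -
  have "mat_trace (rmat a) = (\<Sum>i < card (carrier G). a \<one>)"
    unfolding mat_trace_def by (rule sum.cong) (simp_all add: rmat_def idx_carrier)
  then show ?thesis
    by simp
qed

lemma lmat_eq_imp_eq:
  assumes "lmat a = lmat b" "x \<in> carrier G"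
  shows "a x = b x"
proof -
  have surj: "\<exists>i < card (carrier G). idx i = g" if "g \<in> carrier G" for g
  proof -
    have "g \<in> idx ` {..<card (carrier G)}"
      using bij_betw_imp_surj_on[OF bij_idx] that by simp
    then show ?thesis
      by blast
  qed
  obtain i where i: "i < card (carrier G)" "idx i = x"
    using surj[OF assms(2)] by blast
  obtain j where j: "j < card (carrier G)" "idx j = \<one>"
    using surj[OF one_closed] by blast
  have "lmat a $$ (i, j) = lmat b $$ (i, j)"
    by (simp add: assms(1))
  then show ?thesis
    using i j assms(2) by (simp add: lmat_def)
qed

section \<open>Characters of finite subgroups of the normalized units\<close>

definition cx :: "('a \<Rightarrow> int) \<Rightarrow> 'a \<Rightarrow> complex"
  where "cx u x = of_int (u x)"

lemma conv_cx: "conv (cx u) (cx v) = cx (conv u v)"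
  by (simp add: conv_def cx_def fun_eq_iff)

lemma delta_cx: "cx delta = delta"
  by (simp add: cx_def delta_def fun_eq_iff)

abbreviation V :: "('a \<Rightarrow> int) monoid"
  where "V \<equiv> normalized_units G"

sublocale V: group V
  by (rule normalized_units_is_group[OF fin])

lemma V_mult: "u \<otimes>\<^bsub>V\<^esub> v = conv u v"
  by (simp add: normalized_units_def units_of_def int_group_ring_mult_eq_conv)

lemma V_one: "\<one>\<^bsub>V\<^esub> = delta"
  by (simp add: normalized_units_def units_of_def int_group_ring_def delta_def of_bool_def fun_eq_iff)

lemma V_supported: "u \<in> carrier V \<Longrightarrow> x \<notin> carrier G \<Longrightarrow> u x = 0"
  by (auto simp: normalized_units_def Units_def int_group_ring_def)

lemma V_augmentation: "u \<in> carrier V \<Longrightarrow> (\<Sum>x\<in>carrier G. u x) = 1"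
  by (simp add: normalized_units_def augmentation_def)

lemma V_eqI:
  assumes "u \<in> carrier V" "v \<in> carrier V" "\<And>x. x \<in> carrier G \<Longrightarrow> u x = v x"
  shows "u = v"
proof
  show "u x = v x" for x
    using assms V_supported[of u x] V_supported[of v x] by (cases "x \<in> carrier G") simp_all
qed

lemma lmat_pow: "u \<in> carrier V \<Longrightarrow> lmat (cx u) ^\<^sub>m k = lmat (cx (u [^]\<^bsub>V\<^esub> (k :: nat)))"
proof (induction k)
  case 0
  show ?case
    by (simp add: V_one delta_cx lmat_delta lmat_dim)
next
  case (Suc k)
  then show ?case
    by (simp add: lmat_mult conv_cx V_mult)
qed

text \<open>
  The theorem of Berman and Higman. The multiplication by \<open>u\<close> has trace \<open>|G| u(1)\<close>, and this is a sum of
  \<open>|G|\<close> roots of unity. So the integer \<open>u(1)\<close> is \<open>0\<close>, \<open>1\<close> or \<open>-1\<close>, and in the last two cases \<open>u\<close> is \<open>1\<close>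
  or \<open>-1\<close>, which the augmentation excludes for \<open>-1\<close>.
\<close>

theorem finite_order_coefficient_one_zero:
  assumes u: "u \<in> carrier V" and m: "u [^]\<^bsub>V\<^esub> (m :: nat) = \<one>\<^bsub>V\<^esub>" "m > 0" and ne: "u \<noteq> \<one>\<^bsub>V\<^esub>"
  shows "u \<one> = 0"
proof -
  let ?n = "card (carrier G)"
  have n: "?n > 0"
    using fin by (auto simp: card_gt_0_iff)
  have Lm: "lmat (cx u) ^\<^sub>m m = 1\<^sub>m ?n"
    using lmat_pow[OF u, of m] m(1) by (simp add: V_one delta_cx lmat_delta)
  have tr: "mat_trace (lmat (cx u)) = of_nat ?n * of_int (u \<one>)"
    by (simp add: trace_lmat cx_def)
  have "real ?n * \<bar>real_of_int (u \<one>)\<bar> \<le> real ?n * 1"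
    using finite_order_trace(1)[OF lmat_carrier Lm m(2)] by (simp add: tr norm_mult)
  then have "\<bar>real_of_int (u \<one>)\<bar> \<le> 1"
    using n by (simp only: mult_le_cancel_left_pos of_nat_0_less_iff)
  then consider "u \<one> = 0" | "u \<one> = 1" | "u \<one> = - 1"
    by linarith
  then show ?thesis
  proof cases
    case 2
    then have "lmat (cx u) = lmat (cx delta)"
      using finite_order_trace(2)[OF lmat_carrier Lm m(2)] by (simp add: tr lmat_delta delta_cx)
    then have "u = \<one>\<^bsub>V\<^esub>"
      using u V.one_closed by (intro V_eqI) (auto dest: lmat_eq_imp_eq simp: cx_def V_one)
    with ne show ?thesis
      by simp
  next
    case 3
    then have L: "lmat (cx u) = - 1\<^sub>m ?n"
      using finite_order_trace_minus[OF lmat_carrier Lm m(2)] by (simp add: tr)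
    have "- 1\<^sub>m ?n = lmat (\<lambda>x. - delta x :: complex)"
      unfolding lmat_delta[symmetric] by (rule eq_matI) (simp_all add: lmat_def)
    with L have L': "lmat (cx u) = lmat (\<lambda>x. - delta x)"
      by simp
    then have "of_int (u x) = (of_int (- delta x) :: complex)" if "x \<in> carrier G" for x
      using lmat_eq_imp_eq[OF L' that] by (simp add: cx_def delta_def)
    then have "u x = - delta x" if "x \<in> carrier G" for x
      using that by (simp only: of_int_eq_iff)
    then have "(\<Sum>x\<in>carrier G. u x) = - (\<Sum>x\<in>carrier G. delta x)"
      by (simp add: sum_negf)
    also have "(\<Sum>x\<in>carrier G. delta x) = (1 :: int)"
      by (simp add: delta_def fin)
    finally show ?thesis
      using V_augmentation[OF u] by simp
  qed
qed

lemma finite_subgroup_pow_card: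
  assumes K: "subgroup K V" "finite K" and k: "k \<in> K"
  shows "k [^]\<^bsub>V\<^esub> card K = \<one>\<^bsub>V\<^esub>"
proof -
  interpret K: group "V\<lparr>carrier := K\<rparr>"
    by (rule V.subgroup_imp_group[OF K(1)])
  have "k [^]\<^bsub>V\<lparr>carrier := K\<rparr>\<^esub> card K = \<one>\<^bsub>V\<lparr>carrier := K\<rparr>\<^esub>"
    using K.pow_order_eq_1[of k] k by (simp add: Coset.order_def)
  then show ?thesis
    by (simp flip: V.nat_pow_consistent)
qed

text \<open>
  The idempotent of \<open>\<complex>G\<close> that projects onto the fixed points of the subgroup \<open>K\<close>.
\<close>

definition avg :: "('a \<Rightarrow> int) set \<Rightarrow> 'a \<Rightarrow> complex"
  where "avg K x = (\<Sum>u\<in>K. cx u x) / of_nat (card K)"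

lemma conv_sum_left:
  "conv (\<lambda>x. (\<Sum>i\<in>I. f i x) / c) b = (\<lambda>x. (\<Sum>i\<in>I. conv (f i) b x) / (c :: complex))"
proof
  show "conv (\<lambda>x. (\<Sum>i\<in>I. f i x) / c) b x = (\<Sum>i\<in>I. conv (f i) b x) / c" for x
  proof (cases "x \<in> carrier G")
    case True
    have "conv (\<lambda>x. (\<Sum>i\<in>I. f i x) / c) b x = (\<Sum>g\<in>carrier G. \<Sum>i\<in>I. f i g * b (inv g \<otimes> x) / c)"
      using True by (simp add: conv_def sum_divide_distrib sum_distrib_right)
    also have "\<dots> = (\<Sum>i\<in>I. \<Sum>g\<in>carrier G. f i g * b (inv g \<otimes> x) / c)"
      by (rule sum.swap)
    finally show ?thesis
      using True by (simp add: conv_def sum_divide_distrib)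
  qed (simp add: conv_def)
qed

lemma conv_sum_right:
  "conv b (\<lambda>x. (\<Sum>i\<in>I. f i x) / c) = (\<lambda>x. (\<Sum>i\<in>I. conv b (f i) x) / (c :: complex))"
proof
  show "conv b (\<lambda>x. (\<Sum>i\<in>I. f i x) / c) x = (\<Sum>i\<in>I. conv b (f i) x) / c" for x
  proof (cases "x \<in> carrier G")
    case True
    have "conv b (\<lambda>x. (\<Sum>i\<in>I. f i x) / c) x = (\<Sum>g\<in>carrier G. \<Sum>i\<in>I. b g * f i (inv g \<otimes> x) / c)"
      using True by (simp add: conv_def sum_divide_distrib sum_distrib_left)
    also have "\<dots> = (\<Sum>i\<in>I. \<Sum>g\<in>carrier G. b g * f i (inv g \<otimes> x) / c)"
      by (rule sum.swap)
    finally show ?thesis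
      using True by (simp add: conv_def sum_divide_distrib)
  qed (simp add: conv_def)
qed

lemma avg_idempotent:
  assumes K: "subgroup K V" "finite K"
  shows "conv (avg K) (avg K) = avg K"
proof -
  have card: "card K > 0"
    using K(2) subgroup.one_closed[OF K(1)] by (auto simp: card_gt_0_iff)
  have left: "conv (cx u) (avg K) = avg K" if u: "u \<in> K" for u
  proof -
    have "(\<Sum>v\<in>K. cx (conv u v) x) = (\<Sum>v\<in>K. cx v x)" for x
    proof (rule sum.reindex_bij_witness[where i = "\<lambda>v. inv\<^bsub>V\<^esub> u \<otimes>\<^bsub>V\<^esub> v" and j = "\<lambda>v. u \<otimes>\<^bsub>V\<^esub> v"])
      note mem = subgroup.mem_carrier[OF K(1)]
      fix v assume v: "v \<in> K"
      show "u \<otimes>\<^bsub>V\<^esub> v \<in> K" "inv\<^bsub>V\<^esub> u \<otimes>\<^bsub>V\<^esub> v \<in> K"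
        using u v K(1) by (simp_all add: subgroup.m_closed subgroup.m_inv_closed)
      show "inv\<^bsub>V\<^esub> u \<otimes>\<^bsub>V\<^esub> (u \<otimes>\<^bsub>V\<^esub> v) = v" "u \<otimes>\<^bsub>V\<^esub> (inv\<^bsub>V\<^esub> u \<otimes>\<^bsub>V\<^esub> v) = v"
        using u v mem by (simp_all add: V.m_assoc[symmetric])
    qed (simp add: V_mult)
    then show ?thesis
      unfolding avg_def[abs_def] conv_sum_right by (simp add: conv_cx)
  qed
  have "conv (avg K) (avg K) = (\<lambda>x. (\<Sum>u\<in>K. conv (cx u) (avg K) x) / of_nat (card K))"
    by (subst (1) avg_def[abs_def]) (rule conv_sum_left)
  also have "\<dots> = avg K"
    using card by (simp add: left)
  finally show ?thesis .
qed

lemma mat_trace_avg: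
  "mat_trace (lmat (avg K) * rmat f) = (\<Sum>u\<in>K. mat_trace (lmat (cx u) * rmat f)) / of_nat (card K)"
proof -
  let ?t = "\<lambda>u y x. f y * cx u (x \<otimes> inv y \<otimes> inv x) / of_nat (card K)"
  have "mat_trace (lmat (avg K) * rmat f) = (\<Sum>y\<in>carrier G. \<Sum>x\<in>carrier G. \<Sum>u\<in>K. ?t u y x)"
    by (simp add: trace_lmat_rmat avg_def sum_distrib_left sum_divide_distrib)
  also have "\<dots> = (\<Sum>y\<in>carrier G. \<Sum>u\<in>K. \<Sum>x\<in>carrier G. ?t u y x)"
    by (intro sum.cong refl sum.swap)
  also have "\<dots> = (\<Sum>u\<in>K. \<Sum>y\<in>carrier G. \<Sum>x\<in>carrier G. ?t u y x)"
    by (rule sum.swap)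
  also have "\<dots> = (\<Sum>u\<in>K. mat_trace (lmat (cx u) * rmat f)) / of_nat (card K)"
    by (simp add: trace_lmat_rmat sum_distrib_left sum_divide_distrib)
  finally show ?thesis .
qed

text \<open>
  The number \<open>k\<close> is the multiplicity of the trivial character in the restriction to \<open>K\<close> of the
  character of \<open>\<complex>G f\<close>.
\<close>

lemma trace_avg_nat:
  assumes K: "subgroup K V" "finite K" and f: "conv f f = f"
  obtains k :: nat where "(\<Sum>u\<in>K. mat_trace (lmat (cx u) * rmat f)) = of_nat (card K * k)"
proof -
  let ?n = "card (carrier G)"
  let ?L = "lmat (avg K)" and ?R = "rmat f"
  note carr = lmat_carrier[of "avg K"] rmat_carrier[of f]
  have "?L * ?R * (?L * ?R) = ?L * (?R * ?L) * ?R"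
    using carr by (simp add: assoc_mult_mat[of _ ?n ?n _ ?n _ ?n])
  also have "\<dots> = ?L * (?L * ?R) * ?R"
    by (simp only: lmat_rmat_commute)
  also have "\<dots> = (?L * ?L) * (?R * ?R)"
    using carr by (simp add: assoc_mult_mat[of _ ?n ?n _ ?n _ ?n])
  also have "\<dots> = ?L * ?R"
    by (simp only: lmat_mult rmat_mult avg_idempotent[OF K] f)
  finally obtain k :: nat where "mat_trace (?L * ?R) = of_nat k"
    using idempotent_trace_nat[of "?L * ?R" ?n] carr by auto
  moreover have "card K > 0"
    using K(2) subgroup.one_closed[OF K(1)] by (auto simp: card_gt_0_iff)
  ultimately have "(\<Sum>u\<in>K. mat_trace (lmat (cx u) * rmat f)) = of_nat (card K * k)"
    unfolding mat_trace_avg by (simp add: field_simps)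
  then show thesis
    using that by blast
qed

text \<open>
  By Berman and Higman, the trace on \<open>\<complex>G\<close> of the idempotent that belongs to \<open>K\<close> is \<open>|G| / |K|\<close>.
\<close>

theorem card_finite_subgroup_dvd:
  assumes K: "subgroup K V" "finite K"
  shows "card K dvd card (carrier G)"
proof -
  have one: "\<one>\<^bsub>V\<^esub> \<in> K"
    using K(1) by (rule subgroup.one_closed)
  have card: "card K > 0"
    using K(2) one by (auto simp: card_gt_0_iff)
  have "conv delta delta = (delta :: 'a \<Rightarrow> complex)"
    using V.l_one[OF V.one_closed] conv_cx[of delta delta] by (simp add: V_mult V_one delta_cx)
  from trace_avg_nat[OF K this] obtain k :: nat
    where k: "(\<Sum>u\<in>K. mat_trace (lmat (cx u) * rmat delta)) = of_nat (card K * k)" .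
  have "mat_trace (lmat (cx u) * rmat delta) = of_nat (card (carrier G)) * of_bool (u = \<one>\<^bsub>V\<^esub>)"
    if "u \<in> K" for u
  proof (cases "u = \<one>\<^bsub>V\<^esub>")
    case True
    then show ?thesis
      using lmat_carrier[of "cx u"] by (simp add: rmat_delta trace_lmat V_one delta_cx) (simp add: delta_def)
  next
    case False
    have "u \<one> = 0"
      using finite_order_coefficient_one_zero[OF subgroup.mem_carrier[OF K(1) that]
          finite_subgroup_pow_card[OF K that] card False] .
    then show ?thesis
      using lmat_carrier[of "cx u"] False by (simp add: rmat_delta trace_lmat cx_def)
  qed
  then have "(\<Sum>u\<in>K. mat_trace (lmat (cx u) * rmat delta)) = of_nat (card (carrier G))"
    using one K(2) by (simp flip: sum_distrib_left)
  with k have "of_nat (card (carrier G)) = (of_nat (card K * k) :: complex)"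
    by simp
  then show ?thesis
    by (simp only: of_nat_eq_iff) simp
qed

text \<open>
  The hypothesis on \<open>f\<close> leaves only classes at which the partial augmentation of \<open>u\<close> is zero: the
  class of \<open>1\<close>, and those of elements of order \<open>p ^ j\<close> with \<open>j \<ge> 2\<close>.
\<close>

lemma trace_zero_of_prime_order:
  assumes p: "Factorial_Ring.prime p"
    and u: "u \<in> carrier V" "u [^]\<^bsub>V\<^esub> p = \<one>\<^bsub>V\<^esub>" "u \<noteq> \<one>\<^bsub>V\<^esub>"
    and f: "\<And>y. y \<in> carrier G \<Longrightarrow> f y \<noteq> 0 \<Longrightarrow> \<exists>j. ord y = p ^ j \<and> j \<noteq> 1"
  shows "mat_trace (lmat (cx u) * rmat f) = 0"
proof -
  have "f y * (\<Sum>x\<in>carrier G. cx u (x \<otimes> inv y \<otimes> inv x)) = 0" if y: "y \<in> carrier G" for y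
  proof (cases "f y = 0")
    case False
    then obtain j where j: "ord y = p ^ j" "j \<noteq> 1"
      using f[OF y] by blast
    have "(\<Sum>x\<in>carrier G. u (x \<otimes> inv y \<otimes> inv x)) = 0"
    proof (cases "j = 0")
      case True
      then have "y = \<one>"
        using j(1) ord_eq_1[OF y] by simp
      then show ?thesis
        using finite_order_coefficient_one_zero[OF u(1,2) _ u(3)] prime_gt_0_nat[OF p] by simp
    next
      case False
      let ?U = "\<lambda>i :: int. u [^]\<^bsub>V\<^esub> i"
      have up: "u [^]\<^bsub>V\<^esub> int p = \<one>\<^bsub>V\<^esub>"
        using u(2) by (simp add: int_pow_int)
      have "(\<Sum>x\<in>carrier G. ?U 1 (x \<otimes> inv y \<otimes> inv x)) = 0"
      proof (rule class_sum_zero_of_larger_order[OF p])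
        show "?U 0 = (\<lambda>x. of_bool (x = \<one>))"
          by (simp add: V_one delta_def fun_eq_iff)
        show "conv (?U i) (?U j) = ?U (i + j)" for i j
          using V.int_pow_mult[OF u(1), of i j] by (simp add: V_mult)
        show "?U (i + int p) = ?U i" for i
          using V.int_pow_mult[OF u(1), of i "int p"] u(1) by (simp add: up)
        show "inv y \<in> carrier G" "ord (inv y) = p ^ j" "j \<ge> 2"
          using y j False by simp_all
      qed
      then show ?thesis
        using u(1) by simp
    qed
    then have "(\<Sum>x\<in>carrier G. cx u (x \<otimes> inv y \<otimes> inv x)) = 0"
      unfolding cx_def by (simp flip: of_int_sum)
    then show ?thesis
      by simp
  qed simp
  then show ?thesis
    unfolding trace_lmat_rmat by (simp add: sum.neutral)
qed

end

section \<open>The character induced from a cyclic Sylow subgroup\<close>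

lemma primitive_root_of_unity:
  assumes "q > 0"
  obtains \<omega> :: complex where "\<omega> \<noteq> 0" "\<And>t :: int. \<omega> powi t = 1 \<longleftrightarrow> int q dvd t"
proof
  let ?\<omega> = "cis (2 * pi / real q)"
  show "?\<omega> \<noteq> 0"
    by (rule cis_neq_zero)
  fix t :: int
  have pow: "?\<omega> powi t = cis (2 * pi * (of_int t / real q))"
    by (simp add: cis_power_int field_simps)
  show "?\<omega> powi t = 1 \<longleftrightarrow> int q dvd t"
  proof
    assume "?\<omega> powi t = 1"
    then have "cos (2 * pi * (of_int t / real q)) = 1"
      unfolding pow by (metis cis.simps(1) one_complex.simps(1))
    then obtain n :: int where "2 * pi * (of_int t / real q) = of_int n * 2 * pi"
      unfolding cos_one_2pi_int by blast
    then have "of_int t = (of_int (int q * n) :: real)"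
      using assms by (simp add: field_simps)
    then have "t = int q * n"
      by (simp only: of_int_eq_iff)
    then show "int q dvd t"
      by simp
  next
    assume "int q dvd t"
    then obtain n where "t = int q * n"
      by (elim dvdE)
    then have "2 * pi * (of_int t / real q) = 2 * pi * of_int n"
      using assms by simp
    then show "?\<omega> powi t = 1"
      unfolding pow using cis_multiple_2pi[of "of_int n"] by simp
  qed
qed

context finite_group
begin

text \<open>
  For a faithful linear character \<open>\<lambda>\<close> of \<open>\<langle>c\<rangle>\<close>, the function \<open>f\<close> is the idempotent of the group
  ring of \<open>\<langle>c\<rangle>\<close> that projects onto the sum of the eigenspaces for \<open>p\<close> consecutive powers of \<open>\<lambda>\<close>. On an
  element \<open>y\<close> of order \<open>p\<close> these powers take each \<open>p\<close>-th root of unity as a value exactly once, so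
  their sum, and with it \<open>f y\<close>, is \<open>0\<close>.
\<close>

lemma cyclic_p_subgroup_idempotent:
  assumes p: "Factorial_Ring.prime p" and c: "c \<in> carrier G" and ord_c: "ord c = p ^ N" and N: "N > 0"
  obtains f :: "'a \<Rightarrow> complex" where "conv f f = f" "f \<one> = of_nat p / of_nat (p ^ N)"
    "\<And>y. y \<in> carrier G \<Longrightarrow> f y \<noteq> 0 \<Longrightarrow> \<exists>j. ord y = p ^ j \<and> j \<noteq> 1"
proof -
  define q where "q = p ^ N"
  have q: "q > 0" "p \<le> q" "ord c = q"
    using p N ord_c self_le_power[OF prime_ge_1_nat[OF p] N] by (simp_all add: q_def prime_gt_0_nat)
  obtain \<omega> :: complex where \<omega>: "\<omega> \<noteq> 0" "\<And>t :: int. \<omega> powi t = 1 \<longleftrightarrow> int q dvd t"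
    using primitive_root_of_unity[OF q(1)] by metis
  define \<phi> where "\<phi> k = (\<Sum>l<p. \<omega> powi (int l * k)) / of_nat q" for k :: int
  have \<omega>_cong: "\<omega> powi s = \<omega> powi t" if "int q dvd t - s" for s t
  proof -
    have "\<omega> powi t = \<omega> powi s * \<omega> powi (t - s)"
      using \<omega>(1) by (simp flip: power_int_add)
    then show ?thesis
      using that \<omega>(2) by simp
  qed
  have \<phi>_cong: "\<phi> s = \<phi> t" if "int q dvd t - s" for s t
  proof -
    have "int q dvd int l * t - int l * s" for l
      using that by (simp flip: right_diff_distrib)
    then have "\<omega> powi (int l * s) = \<omega> powi (int l * t)" for l
      by (rule \<omega>_cong)
    then show ?thesis
      by (simp add: \<phi>_def)
  qed
  have geometric: "(\<Sum>i<n. \<omega> powi (int i * t)) = 0" if "int q dvd int n * t" "\<not> int q dvd t" for n :: nat and t :: int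
  proof -
    have pow: "\<omega> powi (int i * t) = (\<omega> powi t) ^ i" for i
      by (metis power_int_mult power_int_of_nat mult.commute)
    have "\<omega> powi t \<noteq> 1" "(\<omega> powi t) ^ n = 1"
      using that \<omega>(2) by (simp_all flip: pow)
    then show ?thesis
      by (simp add: pow geometric_sum)
  qed
  have \<phi>_conv: "(\<Sum>i<q. \<phi> (int i) * \<phi> (k - int i)) = \<phi> k" for k
  proof -
    have orth: "(\<Sum>i<q. \<omega> powi (int i * (int l - int l'))) = of_nat q * of_bool (l = l')" if "l < p" "l' < p" for l l'
    proof (cases "l = l'")
      case False
      have "\<not> int q dvd int l - int l'"
        using that False q(2) dvd_imp_le_int[of "int l - int l'" "int q"] by auto
      then show ?thesis
        using geometric[of q "int l - int l'"] False by simp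
    qed simp
    have summand: "\<phi> (int i) * \<phi> (k - int i) =
        (\<Sum>l<p. \<Sum>l'<p. \<omega> powi (int l' * k) * \<omega> powi (int i * (int l - int l')) / (of_nat q)\<^sup>2)" for i
    proof -
      have "\<omega> powi (int l * int i) * \<omega> powi (int l' * (k - int i)) =
          \<omega> powi (int l' * k) * \<omega> powi (int i * (int l - int l'))" for l l'
        using \<omega>(1) by (simp add: algebra_simps flip: power_int_add)
      then show ?thesis
        by (simp add: \<phi>_def sum_product power2_eq_square flip: sum_divide_distrib)
    qed
    have "(\<Sum>i<q. \<phi> (int i) * \<phi> (k - int i)) =
        (\<Sum>l<p. \<Sum>l'<p. \<Sum>i<q. \<omega> powi (int l' * k) * \<omega> powi (int i * (int l - int l')) / (of_nat q)\<^sup>2)"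
      unfolding summand by (subst sum.swap) (intro sum.cong refl sum.swap)
    also have "\<dots> = (\<Sum>l<p. \<Sum>l'<p. \<omega> powi (int l' * k) * (of_nat q * of_bool (l = l')) / (of_nat q)\<^sup>2)"
      by (intro sum.cong refl) (simp add: orth flip: sum_divide_distrib sum_distrib_left)
    also have "\<dots> = (\<Sum>l<p. \<omega> powi (int l * k) * of_nat q / (of_nat q)\<^sup>2)"
    proof (rule sum.cong[OF refl])
      fix l assume l: "l \<in> {..<p}"
      let ?h = "\<lambda>l'. \<omega> powi (int l' * k) * (of_nat q * of_bool (l = l')) / (of_nat q)\<^sup>2"
      have "(\<Sum>l'<p. ?h l') = (\<Sum>l'\<in>{l}. ?h l')"
        by (rule sum.mono_neutral_right) (use l in auto)
      then show "(\<Sum>l'<p. ?h l') = \<omega> powi (int l * k) * of_nat q / (of_nat q)\<^sup>2"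
        by simp
    qed
    also have "\<dots> = \<phi> k"
      using q(1) by (simp add: \<phi>_def power2_eq_square flip: sum_divide_distrib sum_distrib_right)
    finally show ?thesis .
  qed
  define f where "f x = (if x \<in> range (\<lambda>k :: int. c [^] k) then \<phi> (SOME k. x = c [^] k) else 0)" for x
  have f_pow: "f (c [^] k) = \<phi> k" for k :: int
  proof -
    define j :: int where "j = (SOME j. c [^] k = c [^] j)"
    have "c [^] k = c [^] j"
      unfolding j_def by (rule someI[of "\<lambda>j. c [^] k = c [^] j" k]) (rule refl)
    then have "int q dvd j - k"
      using int_pow_eq[OF c] q(3) by simp
    then have "\<phi> k = \<phi> j"
      by (rule \<phi>_cong)
    moreover have "f (c [^] k) = \<phi> j"
      unfolding f_def j_def by (rule if_P) blast
    ultimately show ?thesis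
      by simp
  qed
  have range: "range (\<lambda>k :: int. c [^] k) = (\<lambda>i. c [^] int i) ` {..<q}"
  proof (intro equalityI subsetI)
    fix x assume "x \<in> range (\<lambda>k :: int. c [^] k)"
    then obtain k :: int where k: "x = c [^] k"
      by blast
    define i where "i = nat (k mod int q)"
    have i: "i < q" "int i = k mod int q"
      using q(1) by (simp_all add: i_def nat_less_iff)
    have "int q dvd k mod int q - k"
      using mod_mod_trivial[of k "int q"] unfolding mod_eq_dvd_iff .
    then have "c [^] k = c [^] int i"
      unfolding int_pow_eq[OF c] q(3) i(2) .
    then show "x \<in> (\<lambda>i. c [^] int i) ` {..<q}"
      using i(1) k by blast
  qed blast
  have inj: "inj_on (\<lambda>i. c [^] int i) {..<q}"
  proof (rule inj_onI)
    fix i j assume ij: "i \<in> {..<q}" "j \<in> {..<q}" "c [^] int i = c [^] int j"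
    then show "i = j"
      using ord_inj[OF c] q(1,3) by (auto simp: int_pow_int elim!: inj_onD)
  qed
  have f_conv: "conv f f x = f x" for x
  proof (cases "x \<in> range (\<lambda>k :: int. c [^] k)")
    case True
    then obtain k :: int where k: "x = c [^] k"
      by blast
    have "conv f f x = (\<Sum>g\<in>carrier G. f g * f (inv g \<otimes> x))"
      using c k by (simp add: conv_def)
    also have "\<dots> = (\<Sum>g\<in>range (\<lambda>k :: int. c [^] k). f g * f (inv g \<otimes> x))"
      by (rule sum.mono_neutral_right) (use c fin in \<open>auto simp: f_def\<close>)
    also have "\<dots> = (\<Sum>i<q. f (c [^] int i) * f (inv (c [^] int i) \<otimes> x))"
      unfolding range by (simp add: sum.reindex[OF inj])
    also have "\<dots> = (\<Sum>i<q. \<phi> (int i) * \<phi> (k - int i))"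
    proof (rule sum.cong[OF refl])
      fix i
      have "inv (c [^] int i) \<otimes> x = c [^] (- int i) \<otimes> c [^] k"
        using c k by (simp only: int_pow_neg)
      also have "\<dots> = c [^] (k - int i)"
        using c by (simp flip: int_pow_mult)
      finally show "f (c [^] int i) * f (inv (c [^] int i) \<otimes> x) = \<phi> (int i) * \<phi> (k - int i)"
        by (simp only: f_pow)
    qed
    finally show ?thesis
      by (simp only: \<phi>_conv k f_pow)
  next
    case False
    have "f g * f (inv g \<otimes> x) = 0" if g: "g \<in> carrier G" and x: "x \<in> carrier G" for g
    proof (rule ccontr)
      assume "f g * f (inv g \<otimes> x) \<noteq> 0"
      then have "g \<in> range (\<lambda>k :: int. c [^] k)" "inv g \<otimes> x \<in> range (\<lambda>k :: int. c [^] k)"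
        by (auto simp: f_def split: if_splits)
      then obtain i j :: int where ij: "g = c [^] i" "inv g \<otimes> x = c [^] j"
        by blast
      have "x = g \<otimes> (inv g \<otimes> x)"
        using g x by (simp flip: m_assoc)
      also have "\<dots> = c [^] (i + j)"
        unfolding ij(2) unfolding ij(1) using c by (simp add: int_pow_mult)
      finally show False
        using False by blast
    qed
    then have "conv f f x = 0"
      by (simp add: conv_def sum.neutral)
    then show ?thesis
      using False by (simp add: f_def)
  qed
  show thesis
  proof (rule that)
    show "conv f f = f"
      by (rule ext) (rule f_conv)
    show "f \<one> = of_nat p / of_nat (p ^ N)"
      using f_pow[of 0] by (simp add: \<phi>_def q_def)
    fix y assume y: "y \<in> carrier G" and fy: "f y \<noteq> 0"
    then obtain k :: int where k: "y = c [^] k"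
      by (auto simp: f_def split: if_splits)
    have "y [^] q = c [^] (k * int q)"
      unfolding k int_pow_pow[OF c, symmetric] by (simp only: int_pow_int)
    also have "\<dots> = \<one>"
      using int_pow_eq_id[OF c, of "k * int q"] q(3) by simp
    finally have "ord y dvd p ^ N"
      using pow_eq_id[OF y] by (simp add: q_def)
    then obtain j where j: "ord y = p ^ j"
      using divides_primepow_nat[OF p] by blast
    have "j \<noteq> 1"
    proof
      assume "j = 1"
      then have ord_y: "ord y = p"
        using j by simp
      have "int q dvd int p * k"
      proof -
        have "c [^] (k * int p) = y [^] p"
          unfolding k int_pow_pow[OF c, symmetric] by (simp only: int_pow_int)
        also have "\<dots> = \<one>"
          using pow_eq_id[OF y] ord_y by simp
        finally show ?thesis
          using int_pow_eq_id[OF c] q(3) by (simp add: mult.commute)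
      qed
      moreover have "\<not> int q dvd k"
      proof
        assume "int q dvd k"
        then have "y = \<one>"
          using int_pow_eq_id[OF c] q(3) k by simp
        then show False
          using ord_y prime_gt_1_nat[OF p] by simp
      qed
      ultimately have "\<phi> k = 0"
        unfolding \<phi>_def by (simp add: geometric)
      then show False
        using fy k f_pow by simp
    qed
    then show "\<exists>j. ord y = p ^ j \<and> j \<noteq> 1"
      using j by blast
  qed
qed

end

text \<open>
  The element \<open>c\<close> generates a Sylow \<open>p\<close>-subgroup, which is not trivial.
\<close>

locale cyclic_sylow = finite_group +
  fixes p N :: nat and c
  assumes p: "Factorial_Ring.prime p"
    and c: "c \<in> carrier G" "ord c = p ^ N"
    and sylow: "\<not> p ^ Suc N dvd card (carrier G)"
    and N: "N > 0"
begin

text \<open>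
  The character of \<open>\<complex>G f\<close> has degree \<open>p |G| / p\<^sup>N\<close> and vanishes on \<open>K\<close> outside \<open>1\<close>, so the trivial
  character would have multiplicity \<open>|G| / p\<^sup>N\<^sup>+\<^sup>1\<close> in it.
\<close>

lemma no_elementary_abelian_subgroup:
  assumes K: "subgroup K V" "finite K" "card K = p\<^sup>2" and exponent: "\<And>u. u \<in> K \<Longrightarrow> u [^]\<^bsub>V\<^esub> p = \<one>\<^bsub>V\<^esub>"
  shows False
proof -
  obtain f :: "'a \<Rightarrow> complex" where f: "conv f f = f" "f \<one> = of_nat p / of_nat (p ^ N)"
    "\<And>y. y \<in> carrier G \<Longrightarrow> f y \<noteq> 0 \<Longrightarrow> \<exists>j. ord y = p ^ j \<and> j \<noteq> 1"
    using cyclic_p_subgroup_idempotent[OF p c N] by metis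
  obtain k :: nat where k: "(\<Sum>u\<in>K. mat_trace (lmat (cx u) * rmat f)) = of_nat (card K * k)"
    using trace_avg_nat[OF K(1,2) f(1)] .
  have one: "\<one>\<^bsub>V\<^esub> \<in> K"
    using K(1) by (rule subgroup.one_closed)
  have "(\<Sum>u\<in>K. mat_trace (lmat (cx u) * rmat f)) =
      (\<Sum>u\<in>{\<one>\<^bsub>V\<^esub>}. mat_trace (lmat (cx u) * rmat f))"
  proof (rule sum.mono_neutral_right)
    show "\<forall>u\<in>K - {\<one>\<^bsub>V\<^esub>}. mat_trace (lmat (cx u) * rmat f) = 0"
      using trace_zero_of_prime_order[OF p _ exponent _ f(3)] subgroup.mem_carrier[OF K(1)] by blast
  qed (use K(2) one in auto)
  also have "\<dots> = mat_trace (rmat f)"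
    using rmat_carrier[of f] by (simp add: V_one delta_cx lmat_delta)
  also have "\<dots> = of_nat (card (carrier G)) * of_nat p / of_nat (p ^ N)"
    by (simp add: trace_rmat f(2))
  finally have "of_nat (card K * k * p ^ N) = (of_nat (card (carrier G) * p) :: complex)"
    using k prime_gt_0_nat[OF p] by (simp add: field_simps)
  then have "card K * k * p ^ N = card (carrier G) * p"
    by (simp only: of_nat_eq_iff)
  then have "p ^ Suc N * k = card (carrier G)"
    using prime_gt_0_nat[OF p] K(3) by (simp add: power2_eq_square mult_ac)
  then show False
    using sylow by (metis dvd_triv_left)
qed

text \<open>
  The trace of an involution \<open>u\<close> on \<open>\<complex>G f\<close> is \<open>0\<close>. Hence half of the eigenvalues are \<open>-1\<close>, and their
  number \<open>|G| / 2\<^sup>N\<close> is odd, while a commutator has determinant \<open>1\<close>.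
\<close>

lemma involution_not_commutator:
  assumes "p = 2" and a: "a \<in> carrier V" and b: "b \<in> carrier V" and u: "u \<in> carrier V"
    and comm: "a \<otimes>\<^bsub>V\<^esub> b = b \<otimes>\<^bsub>V\<^esub> a \<otimes>\<^bsub>V\<^esub> u" and u2: "u [^]\<^bsub>V\<^esub> p = \<one>\<^bsub>V\<^esub>"
  shows "u = \<one>\<^bsub>V\<^esub>"
proof (rule ccontr)
  assume ne: "u \<noteq> \<one>\<^bsub>V\<^esub>"
  let ?n = "card (carrier G)"
  obtain f :: "'a \<Rightarrow> complex" where f: "conv f f = f" "f \<one> = of_nat p / of_nat (p ^ N)"
    "\<And>y. y \<in> carrier G \<Longrightarrow> f y \<noteq> 0 \<Longrightarrow> \<exists>j. ord y = p ^ j \<and> j \<noteq> 1"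
    using cyclic_p_subgroup_idempotent[OF p c N] by metis
  define E where "E = rmat f"
  define D where "D = 1\<^sub>m ?n - E"
  \<comment> \<open>The operator of \<open>v\<close> on \<open>\<complex>G f\<close>, extended by the identity on the complement \<open>\<complex>G (1 - f)\<close>, so that
    its determinant is the one on \<open>\<complex>G f\<close>.\<close>
  define W where "W v = lmat (cx v) * E + D" for v
  have E: "E \<in> carrier_mat ?n ?n" "E * E = E"
    by (simp_all add: E_def rmat_carrier rmat_mult f(1))
  have D: "D \<in> carrier_mat ?n ?n"
    unfolding D_def by (rule minus_carrier_mat[OF E(1)])
  have minus_self: "A - A = 0\<^sub>m ?n ?n" "A - 0\<^sub>m ?n ?n = A" if "A \<in> carrier_mat ?n ?n" for A :: "complex mat"
    by (rule eq_matI; use that in simp)+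
  have ED: "E * D = 0\<^sub>m ?n ?n"
  proof -
    have "E * D = E * 1\<^sub>m ?n - E * E"
      unfolding D_def by (rule mult_minus_distrib_mat[OF E(1) _ E(1)]) simp
    then show ?thesis
      using E minus_self(1)[OF E(1)] by simp
  qed
  have DE: "D * E = 0\<^sub>m ?n ?n"
  proof -
    have "D * E = 1\<^sub>m ?n * E - E * E"
      unfolding D_def by (rule minus_mult_distrib_mat[OF _ E(1) E(1)]) simp
    then show ?thesis
      using E minus_self(1)[OF E(1)] by simp
  qed
  have DD: "D * D = D"
  proof -
    have "D * D = D * 1\<^sub>m ?n - D * E"
      by (subst (2) D_def) (rule mult_minus_distrib_mat[OF D _ E(1)], simp)
    then show ?thesis
      using D DE minus_self(2)[OF D] by simp
  qed
  note L = lmat_carrier[of "cx _"]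
  have LE: "lmat (cx v) * E \<in> carrier_mat ?n ?n" for v
    using E(1) L[of v] by simp
  have W: "W v \<in> carrier_mat ?n ?n" for v
    unfolding W_def by (rule add_carrier_mat[OF D])
  have W_mult: "W v * W w = W (v \<otimes>\<^bsub>V\<^esub> w)" for v w
  proof -
    have 1: "lmat (cx v) * E * (lmat (cx w) * E) = lmat (cx (v \<otimes>\<^bsub>V\<^esub> w)) * E"
    proof -
      have "lmat (cx v) * E * (lmat (cx w) * E) = lmat (cx v) * (E * lmat (cx w)) * E"
        using E L[of v] L[of w] by (simp add: assoc_mult_mat[of _ ?n ?n _ ?n _ ?n])
      also have "\<dots> = lmat (cx v) * (lmat (cx w) * E) * E"
        by (simp only: E_def lmat_rmat_commute)
      also have "\<dots> = (lmat (cx v) * lmat (cx w)) * (E * E)"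
        using E(1) L[of v] L[of w] by (simp add: assoc_mult_mat[of _ ?n ?n _ ?n _ ?n])
      finally show ?thesis
        by (simp add: E(2) lmat_mult conv_cx V_mult)
    qed
    have 2: "lmat (cx v) * E * D = 0\<^sub>m ?n ?n"
      using E(1) D L[of v] ED by (simp add: assoc_mult_mat[of _ ?n ?n _ ?n _ ?n])
    have 3: "D * (lmat (cx w) * E) = 0\<^sub>m ?n ?n"
    proof -
      have "D * (lmat (cx w) * E) = D * (E * lmat (cx w))"
        by (simp only: E_def lmat_rmat_commute)
      also have "\<dots> = D * E * lmat (cx w)"
        using E(1) D L[of w] by (simp add: assoc_mult_mat[of _ ?n ?n _ ?n _ ?n])
      finally show ?thesis
        using DE L[of w] by simp
    qed
    have "W v * W w = (lmat (cx v) * E) * W w + D * W w"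
      using add_mult_distrib_mat[OF LE D W] by (simp add: W_def)
    also have "(lmat (cx v) * E) * W w = lmat (cx (v \<otimes>\<^bsub>V\<^esub> w)) * E + 0\<^sub>m ?n ?n"
      using mult_add_distrib_mat[OF LE LE D] by (simp only: W_def 1 2)
    also have "D * W w = 0\<^sub>m ?n ?n + D"
      using mult_add_distrib_mat[OF D LE D] by (simp only: W_def 3 DD)
    finally show ?thesis
      using LE[of "v \<otimes>\<^bsub>V\<^esub> w"] D by (simp add: W_def)
  qed
  have W_one: "W \<one>\<^bsub>V\<^esub> = 1\<^sub>m ?n"
    unfolding W_def D_def using E(1) by (simp add: V_one delta_cx lmat_delta) (rule eq_matI; simp)
  have det_mult': "det (W (v \<otimes>\<^bsub>V\<^esub> w)) = det (W v) * det (W w)" for v w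
    using det_mult[OF W W] by (simp flip: W_mult)
  have det_ne: "det (W v) \<noteq> 0" if v: "v \<in> carrier V" for v
    using det_mult'[of v "inv\<^bsub>V\<^esub> v"] v by (auto simp: W_one)
  have "det (W a) * det (W b) = det (W b) * det (W a) * det (W u)"
    using arg_cong[OF comm, of "\<lambda>v. det (W v)"] by (simp only: det_mult')
  then have det_u: "det (W u) = 1"
    using det_ne[OF a] det_ne[OF b] by simp
  have "u \<otimes>\<^bsub>V\<^esub> u = \<one>\<^bsub>V\<^esub>"
    using u2 u \<open>p = 2\<close> by (simp add: numeral_2_eq_2)
  then have "W u * W u = 1\<^sub>m ?n"
    by (simp add: W_mult W_one)
  then obtain k :: nat where k: "mat_trace (W u) = of_nat ?n - 4 * of_nat k"
    using involution_trace_of_det_one[OF W _ det_u] by blast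
  have "mat_trace (W u) = mat_trace (lmat (cx u) * E) + (of_nat ?n - mat_trace E)"
    using E(1) L[of u] by (simp add: W_def D_def mat_trace_def sum.distrib sum_subtractf)
  also have "mat_trace (lmat (cx u) * E) = 0"
    unfolding E_def by (rule trace_zero_of_prime_order[OF p u u2 ne f(3)])
  also have "mat_trace E = of_nat ?n * of_nat p / of_nat (p ^ N)"
    by (simp add: E_def trace_rmat f(2))
  finally have "of_nat (?n * p) = (of_nat (4 * k * p ^ N) :: complex)"
    using k prime_gt_0_nat[OF p] by (simp add: field_simps)
  then have "?n * p = 4 * k * p ^ N"
    by (simp only: of_nat_eq_iff)
  then have "?n = p ^ Suc N * k"
    using \<open>p = 2\<close> by simp
  then show False
    using sylow by simp
qed

end

section \<open>A criterion for \<open>p\<close>-groups to be cyclic\<close>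

lemma prime_dvd_power_diff_self:
  assumes p: "Factorial_Ring.prime p"
  shows "int p dvd int r ^ p - int r"
proof -
  obtain k where k: "p = Suc k"
    using p by (cases p) simp_all
  have "int p dvd int r * (int r ^ k - 1)"
  proof (cases "p dvd r")
    case False
    then have "[r ^ k = 1] (mod p)"
      using fermat_theorem[OF p] k by simp
    then have "int p dvd int r ^ k - 1"
      by (simp add: cong_iff_dvd_diff flip: cong_int_iff)
    then show ?thesis
      by (rule dvd_mult)
  qed simp
  then show ?thesis
    by (simp add: k right_diff_distrib)
qed

text \<open>
  The congruence lifts the exponent: \<open>r \<equiv> 1\<close> modulo \<open>p\<close> by Fermat, and then
  \<open>(r\<^sup>p - 1) / (r - 1) = 1 + r + \<dots> + r\<^sup>p\<^sup>-\<^sup>1\<close> is divisible by \<open>p\<close> exactly once, as \<open>p\<close> is odd.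
\<close>

lemma prime_power_dvd_of_power_minus_one:
  fixes p n r :: nat
  assumes p: "Factorial_Ring.prime p" "odd p" and dvd: "int (p ^ n) dvd int r ^ p - 1"
  shows "int (p ^ n) dvd int p * (int r - 1)"
proof (cases "n = 0")
  case False
  define T where "T i = (\<Sum>j<i. int r ^ j)" for i
  have geom: "int r ^ i - 1 = (int r - 1) * T i" for i
    by (simp add: T_def power_diff_1_eq)
  have "p dvd p ^ n"
    using False by simp
  then have "int p dvd int r ^ p - 1"
    using dvd dvd_trans int_dvd_int_iff by blast
  moreover have "int r - 1 = (int r ^ p - 1) - (int r ^ p - int r)"
    by simp
  ultimately have p_r: "int p dvd int r - 1"
    using prime_dvd_power_diff_self[OF p(1), of r] by (simp only: dvd_diff)
  have T_mod: "int p dvd T i - int i" for i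
  proof -
    have "T i - int i = (\<Sum>j<i. int r ^ j - 1)"
      by (simp add: T_def sum_subtractf)
    then show ?thesis
      using p_r by (simp add: geom dvd_sum)
  qed
  have "int p dvd (\<Sum>i<p. T i)"
  proof -
    have "int p dvd (\<Sum>i<p. T i - int i)"
      using T_mod by (simp add: dvd_sum)
    moreover have "p dvd (\<Sum>i<p. i)"
    proof -
      have "2 * (\<Sum>i<m. i) = m * (m - 1)" for m :: nat
      proof (induction m)
        case (Suc m)
        then show ?case
          by (cases m) simp_all
      qed simp
      then have "p dvd 2 * (\<Sum>i<p. i)"
        by simp
      moreover have "coprime p 2"
        using p(2) by simp
      ultimately show ?thesis
        by (simp add: coprime_dvd_mult_right_iff)
    qed
    then have "int p dvd (\<Sum>i<p. int i)"
      by (simp flip: of_nat_sum)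
    ultimately have "int p dvd (\<Sum>i<p. T i - int i) + (\<Sum>i<p. int i)"
      by (rule dvd_add)
    then show ?thesis
      by (simp add: sum_subtractf)
  qed
  then obtain w where w: "(\<Sum>i<p. T i) = int p * w"
    by (elim dvdE)
  obtain v where v: "int r - 1 = int p * v"
    using p_r by (elim dvdE)
  have "T p = int p + (\<Sum>i<p. int r ^ i - 1)"
    by (simp add: T_def sum_subtractf)
  also have "(\<Sum>i<p. int r ^ i - 1) = (int r - 1) * (\<Sum>i<p. T i)"
    by (simp add: geom sum_distrib_left)
  finally have T_p: "T p = int p * (1 + int p * (v * w))"
    by (simp add: v w algebra_simps)
  have "int (p ^ n) dvd int p * (int r - 1) * (1 + int p * (v * w))"
    using dvd geom[of p] T_p by (simp add: mult_ac)
  moreover have "coprime (int p) (1 + int p * (v * w))"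
    using gcd_add_mult[of "int p" "v * w" 1] by (simp add: coprime_iff_gcd_eq_1 mult.commute add.commute)
  ultimately show ?thesis
    by (simp add: coprime_dvd_mult_left_iff)
qed simp

context group
begin

lemma finite_submonoid_subgroup:
  assumes "finite K" "K \<subseteq> carrier G" "\<one> \<in> K" "\<And>x y. x \<in> K \<Longrightarrow> y \<in> K \<Longrightarrow> x \<otimes> y \<in> K"
  shows "subgroup K G"
proof (rule subgroupI)
  fix x assume x: "x \<in> K"
  have "inj_on (\<lambda>y. x \<otimes> y) K"
    using inj_on_subset[OF inj_on_cmult assms(2), of x] assms(2) x by blast
  then have "(\<lambda>y. x \<otimes> y) ` K = K"
    using assms(1,4) x by (intro endo_inj_surj) auto
  then obtain y where "y \<in> K" "x \<otimes> y = \<one>"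
    using assms(3) by (metis imageE)
  then show "inv x \<in> K"
    using assms(2) x inv_equality[of y x] inv_comm[of x y] by auto
qed (use assms in auto)

lemma subgroup_pow_closed: "subgroup S G \<Longrightarrow> x \<in> S \<Longrightarrow> x [^] (i::nat) \<in> S"
  by (induction i) (simp_all add: subgroup.one_closed subgroup.m_closed)

lemma card_subgroup_dvd_card_subgroup:
  assumes "subgroup K G" "subgroup S G" "K \<subseteq> S"
  shows "card K dvd card S"
proof -
  interpret S: group "G\<lparr>carrier := S\<rparr>"
    by (rule subgroup_imp_group[OF assms(2)])
  have "card (rcosets\<^bsub>G\<lparr>carrier := S\<rparr>\<^esub> K) * card K = card S"
    using S.lagrange[OF subgroup_incl[OF assms]] by (simp add: Coset.order_def)
  then show ?thesis
    by (metis dvd_triv_right)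
qed

lemma powers_subgroup:
  assumes "finite (carrier G)" "x \<in> carrier G"
  shows "subgroup (range (\<lambda>i::nat. x [^] i)) G"
proof (rule finite_submonoid_subgroup)
  show "\<one> \<in> range (\<lambda>i::nat. x [^] i)"
    by (rule range_eqI[of _ _ 0]) simp
qed (use assms in \<open>auto simp: nat_pow_mult intro: finite_subset[OF _ assms(1)]\<close>)

text \<open>
  Multiplication by \<open>a\<close> permutes the \<open>p\<close> right cosets of \<open>A\<close> in \<open>S\<close>. The cosets that it moves lie in
  orbits whose lengths are multiples of \<open>p\<close>, but \<open>A\<close> itself is fixed, so nothing is moved.
\<close>

lemma normalized_of_prime_index:
  assumes fin: "finite (carrier G)" and p: "Factorial_Ring.prime p"
    and S: "subgroup S G" "card S = p ^ Suc n" and A: "subgroup A G" "A \<subseteq> S" "card A = p ^ n"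
    and a: "a \<in> A" and b: "b \<in> S"
  shows "b \<otimes> a \<otimes> inv b \<in> A"
proof -
  interpret S: group "G\<lparr>carrier := S\<rparr>"
    by (rule subgroup_imp_group[OF S(1)])
  note SG = subgroup.mem_carrier[OF S(1)]
  have AG: "A \<subseteq> carrier G"
    using subgroup.subset[OF A(1)] .
  define cosets where "cosets = (\<lambda>b. A #> b) ` S"
  have "finite S"
    using subgroup.subset[OF S(1)] fin by (rule finite_subset)
  then have fin_cosets: "finite cosets"
    by (simp add: cosets_def)
  have "rcosets\<^bsub>G\<lparr>carrier := S\<rparr>\<^esub> A = cosets"
    by (auto simp: RCOSETS_def r_coset_def cosets_def)
  then have "card cosets * p ^ n = p * p ^ n"
    using S.lagrange[OF subgroup_incl[OF A(1) S(1) A(2)]] S(2) A(3) by (simp add: Coset.order_def)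
  then have card_cosets: "card cosets = p"
    using p by (simp add: prime_gt_0_nat)
  define W where "W = {C \<in> cosets. C #> a \<noteq> C}"
  have a_pow: "a [^] (p ^ n) = \<one>"
  proof -
    interpret A: group "G\<lparr>carrier := A\<rparr>"
      by (rule subgroup_imp_group[OF A(1)])
    have "a [^]\<^bsub>G\<lparr>carrier := A\<rparr>\<^esub> card A = \<one>\<^bsub>G\<lparr>carrier := A\<rparr>\<^esub>"
      using A.pow_order_eq_1[of a] a by (simp add: Coset.order_def)
    then show ?thesis
      by (simp add: A(3) flip: nat_pow_consistent)
  qed
  have aS: "a \<in> S" and aG: "a \<in> carrier G"
    using a A(2) AG by auto
  have coset_mult: "A #> b #> x = A #> (b \<otimes> x)" if "b \<in> S" "x \<in> S" for b x
    using coset_mult_assoc[OF AG SG SG] that by simp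
  have iter: "((\<lambda>C. C #> a) ^^ i) (A #> b) = A #> (b \<otimes> a [^] i)" if b: "b \<in> S" for b and i :: nat
  proof (induction i)
    case 0
    then show ?case
      using SG[OF b] by simp
  next
    case (Suc i)
    have "b \<otimes> a [^] i \<in> S"
      using b aS S(1) by (simp add: subgroup.m_closed subgroup_pow_closed)
    then show ?case
      using Suc coset_mult[OF _ aS] SG[OF b] aG by (simp add: m_assoc)
  qed
  have "int (p ^ Suc 0) dvd (\<Sum>C\<in>W. 1)"
  proof (rule dvd_weighted_sum_of_long_orbits[OF p, where \<rho> = "\<lambda>C. C #> a" and N = n])
    show "finite W"
      using fin_cosets by (simp add: W_def)
    fix C assume C: "C \<in> W"
    then obtain b where b: "b \<in> S" "C = A #> b" "C #> a \<noteq> C"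
      by (auto simp: W_def cosets_def)
    show "((\<lambda>C. C #> a) ^^ (p ^ n)) C = C"
      using iter[OF b(1)] SG[OF b(1)] by (simp add: b(2) a_pow)
    show "((\<lambda>C. C #> a) ^^ (p ^ 0)) C \<noteq> C"
      using b(3) by simp
    show "C #> a \<in> W"
    proof -
      have "b \<otimes> a \<in> S"
        using b(1) aS S(1) by (simp add: subgroup.m_closed)
      moreover have "C #> a #> a \<noteq> C #> a"
      proof
        assume "C #> a #> a = C #> a"
        then have "C #> a #> a #> inv a = C #> a #> inv a"
          by simp
        then have "C #> a = C"
          using b(1,2) aS aG SG S(1) \<open>b \<otimes> a \<in> S\<close>
          by (simp add: coset_mult subgroup.m_closed subgroup.m_inv_closed m_assoc)
        then show False
          using b(3) by simp
      qed
      ultimately show ?thesis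
        using b(1,2) aS by (auto simp: W_def cosets_def coset_mult)
    qed
  qed simp
  then have "p dvd card W"
    by simp
  moreover have "card W < p"
  proof -
    have "A #> \<one> = A"
      using AG by (rule coset_mult_one)
    moreover have "A #> a = A"
      using a A(1) aG by (simp add: coset_join2)
    moreover have "\<one> \<in> S"
      using S(1) by (rule subgroup.one_closed)
    ultimately have "A \<in> cosets - W"
      by (auto simp: W_def cosets_def intro!: image_eqI[of _ _ \<one>])
    then have "W \<subset> cosets"
      by (auto simp: W_def)
    then have "card W < card cosets"
      using fin_cosets by (rule psubset_card_mono[rotated])
    then show ?thesis
      by (simp add: card_cosets)
  qed
  ultimately have "card W = 0"
    by (auto dest: dvd_imp_le)
  then have "W = {}"
    using fin_cosets by (simp add: W_def)
  then have "A #> b #> a = A #> b"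
    using b by (auto simp: W_def cosets_def)
  then have "A #> (b \<otimes> a) = A #> b"
    using b aS by (simp add: coset_mult)
  then have "b \<otimes> a \<in> A #> b"
    using rcos_self[OF _ A(1), of "b \<otimes> a"] SG[OF b] aG by simp
  then obtain x where "x \<in> A" "b \<otimes> a = x \<otimes> b"
    by (auto simp: r_coset_def)
  then show ?thesis
    using SG[OF b] AG by (auto simp: m_assoc)
qed

lemma card_powers:
  assumes "finite (carrier G)" "x \<in> carrier G"
  shows "card (range (\<lambda>i::nat. x [^] i)) = ord x"
proof -
  have "ord x \<noteq> 0"
    using ord_ge_1[OF assms] by simp
  then have "generate G {x} = range (\<lambda>i::nat. x [^] i)"
    using generate_pow_nat[OF assms(2)] by (simp add: full_SetCompr_eq)
  then show ?thesis
    using generate_pow_card[OF assms(2)] by simp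
qed

text \<open>
  By induction, \<open>S\<close> has a cyclic subgroup \<open>A = \<langle>a\<rangle>\<close> of index \<open>p\<close>, which is normal. Choose \<open>b\<close>
  outside \<open>A\<close> with \<open>b\<^sup>p \<in> A\<close>. Then \<open>b a = u a b\<close> for a central element \<open>u\<close> of \<open>A\<close> with \<open>u\<^sup>p = 1\<close>, and
  \<open>u = 1\<close> if \<open>p = 2\<close>. If \<open>a\<close> is a power of \<open>b\<close>, then \<open>S = \<langle>b\<rangle>\<close>. Otherwise \<open>b\<^sup>p\<close> is the \<open>p\<close>-th power of
  an element of \<open>A\<close>. Let \<open>x\<close> be the inverse of that element. As raising to the power \<open>p\<close> respects the
  product of \<open>x\<close> and \<open>b\<close>, the element \<open>y = x b\<close> has order \<open>p\<close>, and it lies outside \<open>A\<close>. Together with an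
  element \<open>z\<close> of order \<open>p\<close> in \<open>A\<close> it generates an elementary abelian group of order \<open>p\<^sup>2\<close>.
\<close>

theorem p_subgroup_cyclic:
  assumes fin: "finite (carrier G)" and p: "Factorial_Ring.prime p"
    and no_square: "\<And>K. subgroup K G \<Longrightarrow> card K = p\<^sup>2 \<Longrightarrow> \<exists>x\<in>K. x [^] p \<noteq> \<one>"
    and no_commutator: "\<And>a b u. p = 2 \<Longrightarrow> a \<in> carrier G \<Longrightarrow> b \<in> carrier G \<Longrightarrow> u \<in> carrier G \<Longrightarrow>
      a \<otimes> b = b \<otimes> a \<otimes> u \<Longrightarrow> u [^] p = \<one> \<Longrightarrow> u = \<one>"
    and S: "subgroup S G" "card S = p ^ k"
  shows "\<exists>a\<in>S. S = range (\<lambda>i::nat. a [^] i)"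
  using S
proof (induction k arbitrary: S)
  case 0
  then obtain x where "S = {x}"
    by (auto simp: card_1_singleton_iff)
  then have "S = {\<one>}"
    using subgroup.one_closed[OF 0(1)] by auto
  then show ?case
    by (auto simp: image_def)
next
  case (Suc n)
  note S = Suc.prems
  interpret S: group "G\<lparr>carrier := S\<rparr>"
    by (rule subgroup_imp_group[OF S(1)])
  have SG: "x \<in> carrier G" if "x \<in> S" for x
    using that S(1) by (rule subgroup.mem_carrier[rotated])
  have p0: "p > 0" "p > 1"
    using prime_gt_0_nat[OF p] prime_gt_1_nat[OF p] by simp_all
  have fin_S: "finite S"
    using subgroup.subset[OF S(1)] fin by (rule finite_subset)
  obtain A where "subgroup A (G\<lparr>carrier := S\<rparr>)" and card_A: "card A = p ^ n"
    using sylow_thm[OF p S.is_group, of n p] S(2) fin_S by (auto simp: Coset.order_def)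
  then have A: "subgroup A G" and AS: "A \<subseteq> S"
    using incl_subgroup[OF S(1)] subgroup.subset by force+
  obtain a where a: "a \<in> A" and A_eq: "A = range (\<lambda>i::nat. a [^] i)"
    using Suc.IH[OF A card_A] by blast
  have aG: "a \<in> carrier G"
    using a AS SG by auto
  have ord_a: "ord a = p ^ n"
    using card_powers[OF fin aG] card_A by (simp add: A_eq)
  have A_pow: "a [^] (i::nat) \<in> A" for i
    using A_eq by blast
  have "card A < card S"
    using S(2) card_A p0 by simp
  then have "\<not> S \<subseteq> A"
    using card_mono[of A S] fin_S AS finite_subset by (metis not_less)
  then obtain b\<^sub>0 where b\<^sub>0: "b\<^sub>0 \<in> S" "b\<^sub>0 \<notin> A"
    by blast
  define t where "t = (LEAST t. b\<^sub>0 [^] (p ^ t) \<in> A)"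
  have "b\<^sub>0 [^] (p ^ Suc n) = \<one>"
    using S.pow_order_eq_1[of b\<^sub>0] b\<^sub>0(1) S(2) by (simp add: Coset.order_def flip: nat_pow_consistent)
  then have "b\<^sub>0 [^] (p ^ Suc n) \<in> A"
    using subgroup.one_closed[OF A] by simp
  then have t: "b\<^sub>0 [^] (p ^ t) \<in> A"
    unfolding t_def by (rule LeastI)
  have "t \<noteq> 0"
    using t b\<^sub>0(2) SG[OF b\<^sub>0(1)] by (cases t) simp_all
  define b where "b = b\<^sub>0 [^] (p ^ (t - 1))"
  have b: "b \<in> S" "b \<notin> A" "b [^] p \<in> A"
  proof -
    show "b \<in> S"
      using b\<^sub>0(1) S(1) by (simp add: b_def subgroup_pow_closed)
    show "b \<notin> A"
      using not_less_Least[of "t - 1" "\<lambda>t. b\<^sub>0 [^] (p ^ t) \<in> A"] \<open>t \<noteq> 0\<close> by (simp add: b_def t_def)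
    have "p ^ (t - 1) * p = p ^ t"
      using \<open>t \<noteq> 0\<close> by (cases t) simp_all
    then show "b [^] p \<in> A"
      using t SG[OF b\<^sub>0(1)] by (simp add: b_def nat_pow_pow)
  qed
  have bG: "b \<in> carrier G"
    using b(1) by (rule SG)
  obtain r :: nat where "b \<otimes> a \<otimes> inv b = a [^] r"
    using normalized_of_prime_index[OF fin p S A AS card_A a b(1)] A_eq by blast
  then have ba: "b \<otimes> a = a [^] r \<otimes> b"
    using aG bG inv_solve_right[of "a [^] r" "b \<otimes> a" b] by auto
  have b_pow_a: "b \<otimes> a [^] i = a [^] (r * i) \<otimes> b" for i :: nat
  proof (induction i)
    case (Suc i)
    have "b \<otimes> a [^] Suc i = b \<otimes> a [^] i \<otimes> a"
      using aG bG by (simp add: m_assoc)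
    also have "\<dots> = a [^] (r * i) \<otimes> (b \<otimes> a)"
      using aG bG by (simp add: Suc m_assoc)
    also have "\<dots> = a [^] (r * i) \<otimes> a [^] r \<otimes> b"
      using aG bG by (simp add: ba m_assoc)
    finally show ?case
      using aG by (simp add: nat_pow_mult add.commute)
  qed (use bG in simp)
  have pow_b_a: "b [^] l \<otimes> a = a [^] (r ^ l) \<otimes> b [^] l" for l :: nat
  proof (induction l)
    case (Suc l)
    have "b [^] Suc l \<otimes> a = b [^] l \<otimes> a [^] r \<otimes> b"
      using aG bG by (simp add: m_assoc ba)
    also have "b [^] l \<otimes> a [^] r = a [^] (r ^ l * r) \<otimes> b [^] l"
    proof -
      have "b [^] l \<otimes> a [^] i = a [^] (r ^ l * i) \<otimes> b [^] l" for i :: nat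
      proof (induction i)
        case (Suc i)
        have "b [^] l \<otimes> a [^] Suc i = b [^] l \<otimes> a [^] i \<otimes> a"
          using aG bG by (simp add: m_assoc)
        also have "\<dots> = a [^] (r ^ l * i) \<otimes> (b [^] l \<otimes> a)"
          using aG bG by (simp add: Suc m_assoc)
        also have "\<dots> = a [^] (r ^ l * i) \<otimes> a [^] (r ^ l) \<otimes> b [^] l"
          using aG bG by (simp add: \<open>b [^] l \<otimes> a = a [^] (r ^ l) \<otimes> b [^] l\<close> m_assoc)
        finally show ?case
          using aG by (simp add: nat_pow_mult add.commute)
      qed (use bG in simp)
      then show ?thesis .
    qed
    finally show ?case
      using aG bG by (simp add: m_assoc mult.commute)
  qed (use aG in simp)
  have commA: "x \<otimes> y = y \<otimes> x" if "x \<in> A" "y \<in> A" for x y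
    using that aG A_eq by (auto simp: nat_pow_mult add.commute)
  have "a [^] (r ^ p) \<otimes> b [^] p = a \<otimes> b [^] p"
    using commA[OF b(3) a] pow_b_a[of p] by simp
  then have "a [^] (r ^ p) = a"
    using aG bG by simp
  then have "a [^] (1::int) = a [^] int (r ^ p)"
    using aG by (simp only: int_pow_int int_pow_1)
  then have r_p: "int (p ^ n) dvd int r ^ p - 1"
    unfolding int_pow_eq[OF aG] ord_a by simp
  \<comment> \<open>On the elements of order \<open>p\<close> in \<open>A\<close>, conjugation by \<open>b\<close> is the power map with exponent \<open>r\<close>, and its
    \<open>p\<close>-th iterate is trivial. By Fermat this iterate is the map itself.\<close>
  have central: "b \<otimes> z = z \<otimes> b" if z: "z \<in> A" "z [^] p = \<one>" for z
  proof -
    obtain i :: nat where i: "z = a [^] i"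
      using z(1) A_eq by blast
    have zG: "z \<in> carrier G"
      using i aG by simp
    have "z [^] (r ^ p) = (a [^] (r ^ p)) [^] i"
      using aG by (simp add: i nat_pow_pow mult.commute)
    then have "z [^] (r ^ p) = z"
      using \<open>a [^] (r ^ p) = a\<close> i by simp
    moreover have "z [^] (r ^ p) = z [^] r"
    proof -
      have "int (ord z) dvd int r - int (r ^ p)"
        using z(2) pow_eq_id[OF zG] prime_dvd_power_diff_self[OF p, of r]
        by (metis dvd_diff_commute dvd_trans int_dvd_int_iff of_nat_power)
      then show ?thesis
        using int_pow_eq[OF zG, of "int (r ^ p)" "int r"] by (simp only: int_pow_int)
    qed
    moreover have "b \<otimes> z = z [^] r \<otimes> b"
      using b_pow_a[of i] aG by (simp add: i nat_pow_pow mult.commute)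
    ultimately show ?thesis
      by simp
  qed
  obtain u where u: "u \<in> A" "u [^] p = \<one>" "b \<otimes> a = u \<otimes> a \<otimes> b" and u_2: "p = 2 \<Longrightarrow> u = \<one>"
  proof -
    define u where "u = a [^] r \<otimes> inv a"
    have u: "u \<in> A"
      using a A A_pow by (simp add: u_def subgroup.m_closed subgroup.m_inv_closed)
    have uG: "u \<in> carrier G"
      using aG by (simp add: u_def)
    have u_pow: "u [^] i = a [^] (int i * (int r - 1))" for i :: nat
    proof -
      have "u = a [^] (int r - 1)"
        using aG by (simp add: u_def int_pow_diff int_pow_int)
      then have "u [^] int i = a [^] ((int r - 1) * int i)"
        using int_pow_pow[OF aG] by simp
      then show ?thesis
        by (simp add: int_pow_int mult.commute)
    qed
    have rel: "b \<otimes> a = u \<otimes> a \<otimes> b"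
      using aG bG by (simp add: u_def ba m_assoc)
    show thesis
    proof (cases "p = 2")
      case False
      then have "odd p"
        using p p0 by (metis prime_odd_nat le_neq_implies_less Suc_leI numeral_2_eq_2 One_nat_def)
      then have "int (p ^ n) dvd int p * (int r - 1)"
        using prime_power_dvd_of_power_minus_one[OF p _ r_p] by simp
      then have "u [^] p = \<one>"
        unfolding u_pow using int_pow_eq_id[OF aG] ord_a by simp
      then show thesis
        using that u rel False by blast
    next
      case True
      have "u = \<one>"
      proof (rule ccontr)
        assume ne: "u \<noteq> \<one>"
        have "u [^] (p ^ n) = \<one>"
          unfolding u_pow using int_pow_eq_id[OF aG] ord_a by simp
        then obtain s where s: "ord u = p ^ s"
          using pow_eq_id[OF uG] divides_primepow_nat[OF p] by blast
        have "s \<noteq> 0"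
          using s ne ord_eq_1[OF uG] by auto
        \<comment> \<open>If \<open>b\<close> and \<open>a\<close> did not commute, some power of \<open>a\<close> would have an involution as its commutator with \<open>b\<close>.\<close>
        define j where "j = p ^ (s - 1)"
        have j: "j * p = ord u" "\<not> ord u dvd j"
        proof -
          show "j * p = ord u"
            using \<open>s \<noteq> 0\<close> by (cases s) (simp_all add: j_def s)
          show "\<not> ord u dvd j"
          proof
            assume "ord u dvd j"
            then have "s \<le> s - 1"
              using p0(2) by (auto simp: j_def s dest: power_dvd_imp_le)
            then show False
              using \<open>s \<noteq> 0\<close> by simp
          qed
        qed
        have uj: "u [^] j \<in> A" "(u [^] j) [^] p = \<one>" "u [^] j \<noteq> \<one>"
          using j u A uG pow_eq_id[OF uG] by (simp_all add: subgroup_pow_closed nat_pow_pow)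
        have "b \<otimes> a [^] j = u [^] j \<otimes> a [^] j \<otimes> b"
        proof -
          have "u [^] j \<otimes> a [^] j = a [^] (int j * (int r - 1)) \<otimes> a [^] int j"
            by (simp only: u_pow int_pow_int)
          also have "\<dots> = a [^] int (r * j)"
            using aG by (simp add: algebra_simps flip: int_pow_mult)
          finally show ?thesis
            by (simp only: b_pow_a int_pow_int)
        qed
        also have "\<dots> = a [^] j \<otimes> (u [^] j \<otimes> b)"
          using commA[OF uj(1) A_pow[of j]] uG aG bG by (simp add: m_assoc)
        also have "\<dots> = a [^] j \<otimes> b \<otimes> u [^] j"
          using central[OF uj(1,2)] uG aG bG by (simp add: m_assoc)
        finally have "u [^] j = \<one>"
          using no_commutator[OF True bG _ _ _ uj(2)] uG aG by blast
        then show False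
          using uj(3) by simp
      qed
      then show thesis
        using that[OF u _ rel] by simp
    qed
  qed
  show ?case
  proof (cases "a \<in> range (\<lambda>i::nat. b [^] i)")
    case True
    let ?B = "range (\<lambda>i::nat. b [^] i)"
    have B: "subgroup ?B G"
      by (rule powers_subgroup[OF fin bG])
    have BS: "?B \<subseteq> S"
      using b(1) S(1) subgroup_pow_closed by auto
    have "A \<subseteq> ?B"
      unfolding A_eq using True B subgroup_pow_closed by blast
    moreover have "b \<in> ?B"
      using bG by (intro range_eqI[of _ _ 1]) simp
    ultimately have "A \<subset> ?B"
      using b(2) by blast
    then have "card A < card ?B"
      using BS fin_S finite_subset by (intro psubset_card_mono) blast+
    moreover obtain l where l: "card ?B = p ^ l" "l \<le> Suc n"
      using card_subgroup_dvd_card_subgroup[OF B S(1) BS] unfolding S(2) divides_primepow_nat[OF p] by blast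
    ultimately have "n < l"
      using card_A p0 by simp
    then have "l = Suc n"
      using l(2) by simp
    then have "card ?B = card S"
      using l(1) S(2) by simp
    then have "?B = S"
      using BS fin_S by (intro card_subset_eq)
    then show ?thesis
      using b(1) by blast
  next
    case False
    have "n \<noteq> 0"
    proof
      assume "n = 0"
      then have "a = b [^] (0::nat)"
        using ord_a ord_eq_1[OF aG] by simp
      then show False
        using False by blast
    qed
    obtain M :: nat where M: "b [^] p = a [^] M"
      using b(3) A_eq by blast
    have "p dvd M"
    proof (rule ccontr)
      assume "\<not> p dvd M"
      then have "coprime M (p ^ n)"
        using prime_imp_coprime[OF p] by (simp add: coprime_commute)
      then obtain v where v: "[M * v = 1] (mod p ^ n)"
        using cong_solve_coprime_nat[of M "p ^ n"] by auto
      have "a [^] (M * v) = a [^] (1::nat)"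
      proof -
        have "int (ord a) dvd int 1 - int (M * v)"
          using v unfolding ord_a cong_int_iff[symmetric] by (simp add: cong_iff_dvd_diff dvd_diff_commute)
        then show ?thesis
          using int_pow_eq[OF aG, of "int (M * v)" "int 1"] by (simp only: int_pow_int)
      qed
      then have "a = b [^] (p * v)"
        using aG bG M by (simp flip: nat_pow_pow)
      then show False
        using False by blast
    qed
    then obtain M' where M': "M = p * M'"
      by (elim dvdE)
    \<comment> \<open>The exponent \<open>i\<close> is \<open>-M'\<close> modulo the order of \<open>a\<close>, so \<open>x\<close> is the inverse of \<open>a ^ M'\<close>.\<close>
    define i where "i = p ^ n * M' - M'"
    have i: "i + M' = p ^ n * M'"
      using p0 by (simp add: i_def)
    define x where "x = a [^] i"
    have x: "x \<in> A" "x \<in> carrier G"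
      using aG by (simp_all add: x_def A_pow)
    have uG: "u \<in> carrier G"
      using u(1) AS SG by blast
    have uj: "u [^] (j::nat) \<in> A" "(u [^] j) [^] p = \<one>" for j
    proof -
      show "u [^] j \<in> A"
        using A u(1) by (rule subgroup_pow_closed)
      have "(u [^] j) [^] p = (u [^] p) [^] j"
        using uG by (simp add: nat_pow_pow mult.commute)
      then show "(u [^] j) [^] p = \<one>"
        by (simp add: u(2))
    qed
    define w where "w = u [^] i"
    have w: "w \<in> A" "w [^] p = \<one>" "w \<in> carrier G"
      using uj uG by (simp_all add: w_def)
    have bx: "b \<otimes> x = w \<otimes> x \<otimes> b"
    proof -
      have "b \<otimes> a [^] i = u [^] i \<otimes> a [^] i \<otimes> b" for i :: nat
      proof (induction i)
        case (Suc i)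
        have "b \<otimes> a [^] Suc i = u [^] i \<otimes> a [^] i \<otimes> (b \<otimes> a)"
          using aG bG uG by (simp add: m_assoc[symmetric] Suc)
        also have "\<dots> = u [^] i \<otimes> (a [^] i \<otimes> u) \<otimes> a \<otimes> b"
          using aG bG uG by (simp add: u(3) m_assoc)
        also have "a [^] i \<otimes> u = u \<otimes> a [^] i"
          using commA[OF A_pow u(1)] .
        finally show ?case
          using aG bG uG by (simp add: m_assoc)
      qed (use bG in simp)
      then show ?thesis
        by (simp add: x_def w_def)
    qed
    have wb: "b \<otimes> w [^] (j::nat) = w [^] j \<otimes> b" for j
      using central[of "w [^] j"] uj[of "i * j"] uG by (simp add: w_def nat_pow_pow)
    have wb': "b [^] l \<otimes> w [^] (j::nat) = w [^] j \<otimes> b [^] l" for j l :: nat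
    proof (induction l)
      case (Suc l)
      have "b [^] Suc l \<otimes> w [^] j = b [^] l \<otimes> w [^] j \<otimes> b"
        using bG w(3) by (simp add: m_assoc wb)
      then show ?case
        using bG w(3) by (simp add: Suc m_assoc)
    qed (use w(3) in simp)
    have blx: "b [^] l \<otimes> x = w [^] l \<otimes> x \<otimes> b [^] l" for l :: nat
    proof (induction l)
      case (Suc l)
      have "b [^] Suc l \<otimes> x = b [^] l \<otimes> w [^] (1::nat) \<otimes> x \<otimes> b"
        using bG x(2) w(3) by (simp add: m_assoc bx)
      also have "\<dots> = w \<otimes> (b [^] l \<otimes> x) \<otimes> b"
        unfolding wb' using bG x(2) w(3) by (simp add: m_assoc)
      also have "\<dots> = w [^] Suc l \<otimes> x \<otimes> b [^] Suc l"
        using bG x(2) w(3) nat_pow_comm[OF w(3), of 1 l] by (simp add: Suc m_assoc[symmetric])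
      finally show ?case .
    qed (use x(2) w(3) in simp)
    \<comment> \<open>The exponent counts the transpositions that bring all factors \<open>x\<close> to the left of the factors \<open>b\<close>.\<close>
    have xb_pow: "(x \<otimes> b) [^] l = w [^] (l * (l - 1) div 2) \<otimes> (x [^] l \<otimes> b [^] l)" for l :: nat
    proof (induction l)
      case (Suc l)
      let ?e = "l * (l - 1) div 2"
      have xl: "x [^] l \<otimes> w [^] l = w [^] l \<otimes> x [^] l"
        using commA subgroup_pow_closed[OF A] x(1) w(1) by blast
      have "(x \<otimes> b) [^] Suc l = w [^] ?e \<otimes> (x [^] l \<otimes> b [^] l) \<otimes> (x \<otimes> b)"
        by (simp add: Suc)
      also have "\<dots> = w [^] ?e \<otimes> x [^] l \<otimes> (b [^] l \<otimes> x) \<otimes> b"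
        using bG x(2) w(3) by (simp add: m_assoc)
      also have "\<dots> = w [^] ?e \<otimes> (x [^] l \<otimes> w [^] l) \<otimes> x \<otimes> b [^] l \<otimes> b"
        using bG x(2) w(3) by (simp add: blx m_assoc)
      also have "\<dots> = (w [^] ?e \<otimes> w [^] l) \<otimes> (x [^] Suc l \<otimes> b [^] Suc l)"
        unfolding xl using bG x(2) w(3) by (simp add: m_assoc)
      also have "w [^] ?e \<otimes> w [^] l = w [^] (?e + l)"
        using w(3) by (rule nat_pow_mult)
      also have "?e + l = Suc l * (Suc l - 1) div 2"
        by (cases l) simp_all
      finally show ?case .
    qed simp
    define y where "y = x \<otimes> b"
    have yG: "y \<in> carrier G" and yS: "y \<in> S"
      using x bG b(1) AS S(1) by (auto simp: y_def subgroup.m_closed)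
    have y_A: "y \<notin> A"
    proof
      assume "y \<in> A"
      then have "inv x \<otimes> y \<in> A"
        using x(1) A by (simp add: subgroup.m_closed subgroup.m_inv_closed)
      moreover have "inv x \<otimes> y = b"
        using x(2) bG by (simp add: y_def flip: m_assoc)
      ultimately show False
        using b(2) by simp
    qed
    have y_p: "y [^] p = \<one>"
    proof -
      have "w [^] (p * (p - 1) div 2) = \<one>"
      proof (cases "p = 2")
        case True
        then have "w = \<one>"
          using u_2 by (simp add: w_def)
        then show ?thesis
          by simp
      next
        case False
        then have "odd p"
          using p p0 by (metis prime_odd_nat le_neq_implies_less Suc_leI numeral_2_eq_2 One_nat_def)
        then have "p * (p - 1) div 2 = p * ((p - 1) div 2)"
          by (elim oddE) simp
        then show ?thesis
          using w nat_pow_pow[OF w(3), of p "(p - 1) div 2"] by simp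
      qed
      then have "y [^] p = x [^] p \<otimes> b [^] p"
        using xb_pow[of p] x(2) bG by (simp add: y_def)
      also have "\<dots> = a [^] (i * p + p * M')"
        unfolding x_def M M' using aG by (simp add: nat_pow_pow nat_pow_mult)
      also have "i * p + p * M' = p ^ n * (M' * p)"
        using arg_cong[OF i, of "\<lambda>m. m * p"] by (simp add: algebra_simps)
      also have "a [^] (p ^ n * (M' * p)) = \<one>"
        using pow_eq_id[OF aG] ord_a by simp
      finally show ?thesis .
    qed
    define z where "z = a [^] (p ^ (n - 1))"
    have z: "z \<in> A" "z \<in> carrier G" "z \<in> S"
      using aG A_pow AS by (auto simp: z_def)
    have "p ^ (n - 1) * p = p ^ n"
      using \<open>n \<noteq> 0\<close> by (cases n) simp_all
    then have z_p: "z [^] p = \<one>"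
      using pow_eq_id[OF aG] ord_a aG by (simp add: z_def nat_pow_pow)
    have z_1: "z \<noteq> \<one>"
      using pow_eq_id[OF aG, of "p ^ (n - 1)"] ord_a \<open>n \<noteq> 0\<close> p0 by (auto simp: z_def dest!: power_dvd_imp_le)
    have yz: "y \<otimes> z = z \<otimes> y"
    proof -
      have "y \<otimes> z = x \<otimes> z \<otimes> b"
        using central[OF z(1) z_p] x(2) bG z(2) by (simp add: y_def m_assoc)
      then show ?thesis
        using commA[OF x(1) z(1)] x(2) bG z(2) by (simp add: y_def m_assoc)
    qed
    define K where "K = (\<lambda>(i, j). y [^] (i::nat) \<otimes> z [^] (j::nat)) ` UNIV"
    have K_mem: "y [^] (i::nat) \<otimes> z [^] (j::nat) \<in> K" for i j
      by (auto simp: K_def)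
    have yz_pow: "z [^] (j::nat) \<otimes> y [^] (i::nat) = y [^] i \<otimes> z [^] j" for i j
      using group_commutes_pow[OF group_commutes_pow[OF yz yG z(2), symmetric] z(2)] yG by simp
    have KS: "K \<subseteq> S"
      using yS z(3) S(1) by (auto simp: K_def subgroup.m_closed subgroup_pow_closed)
    have K: "subgroup K G"
    proof (rule finite_submonoid_subgroup)
      show "finite K"
        using KS fin_S by (rule finite_subset)
      show "K \<subseteq> carrier G"
        using KS SG by blast
      show "\<one> \<in> K"
        using K_mem[of 0 0] by simp
      fix k k' assume "k \<in> K" "k' \<in> K"
      then obtain i j i' j' :: nat where k: "k = y [^] i \<otimes> z [^] j" "k' = y [^] i' \<otimes> z [^] j'"
        by (auto simp: K_def)
      have "k \<otimes> k' = y [^] i \<otimes> (z [^] j \<otimes> y [^] i') \<otimes> z [^] j'"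
        using yG z(2) by (simp add: k m_assoc)
      also have "\<dots> = (y [^] i \<otimes> y [^] i') \<otimes> (z [^] j \<otimes> z [^] j')"
        unfolding yz_pow using yG z(2) by (simp add: m_assoc)
      also have "\<dots> = y [^] (i + i') \<otimes> z [^] (j + j')"
        using yG z(2) by (simp only: nat_pow_mult)
      finally show "k \<otimes> k' \<in> K"
        using K_mem by simp
    qed
    have pow_mod: "v [^] (i mod p) = v [^] i" if "v \<in> carrier G" "v [^] p = \<one>" for v and i :: nat
    proof -
      have "v [^] i = v [^] (p * (i div p) + i mod p)"
        by simp
      also have "\<dots> = (v [^] p) [^] (i div p) \<otimes> v [^] (i mod p)"
        using that(1) by (simp only: nat_pow_mult nat_pow_pow)
      finally show ?thesis
        using that by simp
    qed
    have "K \<subseteq> (\<lambda>(i, j). y [^] i \<otimes> z [^] j) ` ({..<p} \<times> {..<p})"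
    proof
      fix k assume "k \<in> K"
      then obtain i j :: nat where "k = y [^] i \<otimes> z [^] j"
        by (auto simp: K_def)
      then have "k = y [^] (i mod p) \<otimes> z [^] (j mod p)"
        using pow_mod yG y_p z(2) z_p by simp
      then show "k \<in> (\<lambda>(i, j). y [^] i \<otimes> z [^] j) ` ({..<p} \<times> {..<p})"
        using p0 by auto
    qed
    then have "card K \<le> card ({..<p} \<times> {..<p})"
      by (rule surj_card_le[rotated]) simp
    then have K_le: "card K \<le> p ^ 2"
      by (simp add: power2_eq_square)
    let ?Z = "range (\<lambda>i::nat. z [^] i)"
    have ZA: "?Z \<subseteq> A"
      using subgroup_pow_closed[OF A z(1)] by blast
    have "ord z = p"
      using z_1 z_p pow_eq_id[OF z(2)] ord_eq_1[OF z(2)] p by (auto simp: prime_nat_iff)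
    then have "card ?Z = p"
      using card_powers[OF fin z(2)] by simp
    moreover have "?Z \<subset> K"
    proof
      show "?Z \<subseteq> K"
      proof
        fix v assume "v \<in> ?Z"
        then obtain j :: nat where "v = z [^] j"
          by blast
        then show "v \<in> K"
          using K_mem[of 0 j] z(2) by simp
      qed
      have "y \<in> K"
        using K_mem[of 1 0] yG by simp
      then show "?Z \<noteq> K"
        using ZA y_A by blast
    qed
    then have "card ?Z < card K"
      using KS fin_S by (intro psubset_card_mono) (rule finite_subset)
    moreover obtain s where s: "card K = p ^ s"
      using card_subgroup_dvd_card_subgroup[OF K S(1) KS] unfolding S(2) divides_primepow_nat[OF p] by blast
    ultimately have "p ^ 1 < p ^ s"
      by simp
    then have "1 < s"
      using p0 by (simp only: power_strict_increasing_iff)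
    moreover have "s \<le> 2"
      using K_le p0 unfolding s by (simp only: power_increasing_iff)
    ultimately have "s = 2"
      by simp
    then have "card K = p\<^sup>2"
      using s by simp
    then obtain k where k: "k \<in> K" "k [^] p \<noteq> \<one>"
      using no_square[OF K] by blast
    then obtain i j :: nat where "k = y [^] i \<otimes> z [^] j"
      by (auto simp: K_def)
    then have "k [^] p = (y [^] i) [^] p \<otimes> (z [^] j) [^] p"
      using pow_mult_distrib[of "y [^] i" "z [^] j" p] yz_pow yG z(2) by simp
    also have "\<dots> = (y [^] p) [^] i \<otimes> (z [^] p) [^] j"
      using yG z(2) by (simp add: nat_pow_pow mult.commute)
    finally show ?thesis
      using k(2) y_p z_p by simp
  qed
qed

end

section \<open>Embedding finite \<open>p\<close>-subgroups\<close>

lemma iso_of_powers: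
  assumes G: "group G" "x \<in> carrier G" "carrier G = range (\<lambda>i::nat. x [^]\<^bsub>G\<^esub> i)"
    and H: "group H" "y \<in> carrier H" "carrier H = range (\<lambda>i::nat. y [^]\<^bsub>H\<^esub> i)"
    and ord: "group.ord G x = group.ord H y"
  shows "G \<cong> H"
proof -
  interpret G: group G
    by (rule G(1))
  interpret H: group H
    by (rule H(1))
  have eq_iff: "x [^]\<^bsub>G\<^esub> i = x [^]\<^bsub>G\<^esub> j \<longleftrightarrow> y [^]\<^bsub>H\<^esub> i = y [^]\<^bsub>H\<^esub> j" for i j :: nat
    using G.int_pow_eq[OF G(2), of "int i" "int j"] H.int_pow_eq[OF H(2), of "int i" "int j"] ord
    by (simp add: int_pow_int)
  define \<phi> where "\<phi> z = y [^]\<^bsub>H\<^esub> (SOME i :: nat. z = x [^]\<^bsub>G\<^esub> i)" for z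
  have \<phi>: "\<phi> (x [^]\<^bsub>G\<^esub> i) = y [^]\<^bsub>H\<^esub> i" for i :: nat
  proof -
    have "x [^]\<^bsub>G\<^esub> i = x [^]\<^bsub>G\<^esub> (SOME j :: nat. x [^]\<^bsub>G\<^esub> i = x [^]\<^bsub>G\<^esub> j)"
      by (rule someI[of "\<lambda>j :: nat. x [^]\<^bsub>G\<^esub> i = x [^]\<^bsub>G\<^esub> j" i]) (rule refl)
    then show ?thesis
      unfolding \<phi>_def eq_iff by (rule sym)
  qed
  have "\<phi> \<in> iso G H"
  proof (rule isoI)
    show "\<phi> \<in> hom G H"
    proof (rule homI)
      fix z assume "z \<in> carrier G"
      then obtain i :: nat where "z = x [^]\<^bsub>G\<^esub> i"
        using G(3) by blast
      then show "\<phi> z \<in> carrier H"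
        using H(2) by (simp add: \<phi>)
      fix z' assume "z' \<in> carrier G"
      then obtain j :: nat where "z' = x [^]\<^bsub>G\<^esub> j"
        using G(3) by blast
      then show "\<phi> (z \<otimes>\<^bsub>G\<^esub> z') = \<phi> z \<otimes>\<^bsub>H\<^esub> \<phi> z'"
        using \<open>z = x [^]\<^bsub>G\<^esub> i\<close> G(2) H(2) by (simp add: G.nat_pow_mult H.nat_pow_mult \<phi>)
    qed
    show "bij_betw \<phi> (carrier G) (carrier H)"
      unfolding G(3) H(3) by (auto simp: bij_betw_def inj_on_def \<phi> eq_iff image_def)
  qed
  then show ?thesis
    by (rule is_isoI)
qed

context finite_group
begin

text \<open>
  \<open>U\<close> is cyclic, and its order \<open>p ^ k\<close> divides that of a Sylow subgroup \<open>\<langle>c\<rangle>\<close>, so \<open>U\<close> is isomorphic to the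
  subgroup of \<open>\<langle>c\<rangle>\<close> of order \<open>p ^ k\<close>.
\<close>

theorem finite_p_subgroup_embeds:
  assumes p: "Factorial_Ring.prime p"
    and cyclic: "\<And>P. sylow_subgroup p P G \<Longrightarrow> cyclic_group (G\<lparr>carrier := P\<rparr>)"
    and U: "subgroup U V" and pU: "finite_p_group p (V\<lparr>carrier := U\<rparr>)"
  shows "\<exists>H. subgroup H G \<and> V\<lparr>carrier := U\<rparr> \<cong> G\<lparr>carrier := H\<rparr>"
proof -
  have p0: "p > 0" "p > 1"
    using prime_gt_0_nat[OF p] prime_gt_1_nat[OF p] by simp_all
  interpret U: group "V\<lparr>carrier := U\<rparr>"
    by (rule V.subgroup_imp_group[OF U])
  obtain k where k: "card U = p ^ k"
    using pU by (auto simp: finite_p_group_def Coset.order_def)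
  have fin_U: "finite U"
    using k p0 by (intro card_ge_0_finite) simp
  define N where "N = multiplicity p (card (carrier G))"
  have card_G: "card (carrier G) \<noteq> 0"
    using fin one_closed by auto
  have k_N: "k \<le> N"
    using card_finite_subgroup_dvd[OF U fin_U] p0 card_G
    by (simp add: k N_def multiplicity_geI)
  obtain P where P: "subgroup P G" "card P = p ^ N" "cyclic_group (G\<lparr>carrier := P\<rparr>)"
    using sylow_subgroup_exists[OF is_group fin p] cyclic
    by (auto simp: sylow_subgroup_def Coset.order_def N_def)
  interpret P: group "G\<lparr>carrier := P\<rparr>"
    by (rule subgroup_imp_group[OF P(1)])
  obtain c where c: "c \<in> P" "P = range (\<lambda>i::int. c [^] i)"
    using P(3) unfolding P.cyclic_group by (auto simp flip: int_pow_consistent[OF P(1)])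
  have cG: "c \<in> carrier G"
    using subgroup.mem_carrier[OF P(1) c(1)] .
  have ord_c: "ord c = p ^ N"
    using generate_pow_card[OF cG] generate_pow[OF cG] c(2) P(2) by (simp add: full_SetCompr_eq)
  obtain u where u: "u \<in> U" "U = range (\<lambda>i::nat. u [^]\<^bsub>V\<^esub> i)"
  proof (cases "k = 0")
    case True
    then have "U = {\<one>\<^bsub>V\<^esub>}"
      using k subgroup.one_closed[OF U] by (auto simp: card_1_singleton_iff)
    then show thesis
      using that[of "\<one>\<^bsub>V\<^esub>"] by auto
  next
    case False
    interpret cyclic_sylow G p N c
    proof
      show "\<not> p ^ Suc N dvd card (carrier G)"
      proof
        assume "p ^ Suc N dvd card (carrier G)"
        then have "Suc N \<le> multiplicity p (card (carrier G))"
          using card_G p0(2) by (intro multiplicity_geI) auto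
        then show False
          by (simp add: N_def)
      qed
    qed (use p cG ord_c False k_N in simp_all)
    have sub_V: "subgroup K V" "K \<subseteq> U" if "subgroup K (V\<lparr>carrier := U\<rparr>)" for K
      using that V.incl_subgroup[OF U] subgroup.subset[OF that] by simp_all
    have "\<exists>a\<in>U. U = range (\<lambda>i::nat. a [^]\<^bsub>V\<lparr>carrier := U\<rparr>\<^esub> i)"
    proof (rule U.p_subgroup_cyclic[OF _ p])
      show "finite (carrier (V\<lparr>carrier := U\<rparr>))"
        using fin_U by simp
      show "subgroup U (V\<lparr>carrier := U\<rparr>)"
        using U.subgroup_self by simp
      show "\<exists>x\<in>K. x [^]\<^bsub>V\<lparr>carrier := U\<rparr>\<^esub> p \<noteq> \<one>\<^bsub>V\<lparr>carrier := U\<rparr>\<^esub>"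
        if "subgroup K (V\<lparr>carrier := U\<rparr>)" "card K = p\<^sup>2" for K
        using no_elementary_abelian_subgroup[OF sub_V(1)[OF that(1)] finite_subset[OF sub_V(2)[OF that(1)] fin_U] that(2)]
        by (auto simp flip: V.nat_pow_consistent)
      show "v = \<one>\<^bsub>V\<lparr>carrier := U\<rparr>\<^esub>"
        if "p = 2" "a \<in> carrier (V\<lparr>carrier := U\<rparr>)" "b \<in> carrier (V\<lparr>carrier := U\<rparr>)" "v \<in> carrier (V\<lparr>carrier := U\<rparr>)"
          "a \<otimes>\<^bsub>V\<lparr>carrier := U\<rparr>\<^esub> b = b \<otimes>\<^bsub>V\<lparr>carrier := U\<rparr>\<^esub> a \<otimes>\<^bsub>V\<lparr>carrier := U\<rparr>\<^esub> v"
          "v [^]\<^bsub>V\<lparr>carrier := U\<rparr>\<^esub> p = \<one>\<^bsub>V\<lparr>carrier := U\<rparr>\<^esub>" for a b v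
        using involution_not_commutator[of a b v] that subgroup.mem_carrier[OF U]
        by (simp flip: V.nat_pow_consistent)
    qed (fact k)
    then show thesis
      using that by (auto simp flip: V.nat_pow_consistent)
  qed
  define d where "d = c [^] (p ^ (N - k))"
  have dG: "d \<in> carrier G"
    using cG by (simp add: d_def)
  have pow_split: "p ^ N = p ^ (N - k) * p ^ k"
    using k_N by (simp flip: power_add)
  have ord_d: "ord d = p ^ k"
    using ord_pow[OF cG, of "p ^ (N - k)"] p0 by (simp add: d_def ord_c pow_split)
  define H where "H = range (\<lambda>i::nat. d [^] i)"
  have H: "subgroup H G"
    unfolding H_def by (rule powers_subgroup[OF fin dG])
  interpret H: group "G\<lparr>carrier := H\<rparr>"
    by (rule subgroup_imp_group[OF H])
  have d_H: "d \<in> H"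
    unfolding H_def using dG by (intro range_eqI[of _ _ 1]) simp
  have "V\<lparr>carrier := U\<rparr> \<cong> G\<lparr>carrier := H\<rparr>"
  proof (rule iso_of_powers[OF U.is_group _ _ H.is_group])
    show "u \<in> carrier (V\<lparr>carrier := U\<rparr>)" "d \<in> carrier (G\<lparr>carrier := H\<rparr>)"
      using u(1) d_H by simp_all
    show U_eq: "carrier (V\<lparr>carrier := U\<rparr>) = range (\<lambda>i::nat. u [^]\<^bsub>V\<lparr>carrier := U\<rparr>\<^esub> i)"
      using u(2) by (simp flip: V.nat_pow_consistent)
    show H_eq: "carrier (G\<lparr>carrier := H\<rparr>) = range (\<lambda>i::nat. d [^]\<^bsub>G\<lparr>carrier := H\<rparr>\<^esub> i)"
      unfolding H_def by (simp flip: nat_pow_consistent)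
    have "U.ord u = card U"
      using U.card_powers[of u] u(1) fin_U U_eq by simp
    moreover have "H.ord d = card H"
      using H.card_powers[of d] d_H H_eq finite_subset[OF subgroup.subset[OF H] fin] by simp
    moreover have "card H = p ^ k"
      using card_powers[OF fin dG] ord_d by (simp add: H_def)
    ultimately show "U.ord u = H.ord d"
      by (simp add: k)
  qed
  then show ?thesis
    using H by blast
qed

end

theorem corollary1:
  fixes G :: "'a monoid" and p :: nat and U :: "('a \<Rightarrow> int) set"
  assumes "group G" and "finite (carrier G)"
    and "Factorial_Ring.prime p"
    and "\<And>P. sylow_subgroup p P G \<Longrightarrow> cyclic_group (G\<lparr>carrier := P\<rparr>)"
    and "subgroup U (normalized_units G)"
    and "finite_p_group p ((normalized_units G)\<lparr>carrier := U\<rparr>)"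
  shows "\<exists>H. subgroup H G \<and> (normalized_units G)\<lparr>carrier := U\<rparr> \<cong> G\<lparr>carrier := H\<rparr>"
proof -
  interpret finite_group G
    using assms(1,2) by (simp add: finite_group_def finite_group_axioms_def)
  show ?thesis
    using assms(3-6) by (rule finite_p_subgroup_embeds)
qed

end
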